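(* Assume Assumptions 1, 2 and 3. Let $h_i=(n-1)^{-1}\sum_{k\ne i}(\hat H_k(X_i)-\theta_{ik})$, $\nu_n^2=\operatorname{Var}(\sum_{i\in\mathcal I_n}h_i)$, and $W_n=\frac{1}{2(n-1)\nu_n}\big(S_n-\sum_{i\ne k}\theta_{ik}\big)$; let $Z\sim N(0,1)$. Then for any $\delta>0$ and $m\ge1$, up to a multiplicative constant not depending on $n$ or $m$, $$\mathbf d_W(W_n,Z)\lesssim \frac{1}{\nu_n n}\Big[(\tau_4^m+\tau_{2,2}^m)\mathbf H_2^2+n^4\mathbf H_{2+\delta}^2\beta(1,3,m)^{\frac{\delta}{2+\delta}}\Big]^{1/2}+\frac{n}{\nu_n}\mathbf H_{1+\delta}\beta(1,\infty,m)^{\frac{\delta}{1+\delta}}$$ $$+\frac{n^2}{\nu_n^2}\mathbf H_{2+\delta}^2\beta(1,1,m)^{\frac{\delta}{2+\delta}}+\frac{\tau_2^m}{\nu_n^2}\mathbf H_{2+\delta}^2\beta(2,\infty,m)^{\frac{\delta}{2+\delta}}+\frac{\tau_3^m}{\nu_n^3}\mathbf H_3^3.$$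
   Context: For each $n$, $\mathcal I_n$ is a finite index set with $|\mathcal I_n|=n$, equipped with a metric $\mathbf d:\mathcal I_n\times\mathcal I_n\to[0,\infty]$, and $\{X_i:i\in\mathcal I_n\}$ are random vectors in $\mathbb R^d$ on a probability space $(\Omega,\mathcal F,P)$. For $\mathcal I_1,\mathcal I_2\subset\mathcal I_n$, $\mathbf d(\mathcal I_1,\mathcal I_2)=\inf_{i\in\mathcal I_1,j\in\mathcal I_2}\mathbf d(i,j)$. The $\beta$-mixing coefficient of sub-$\sigma$-algebras is $\beta(\mathcal F_1,\mathcal F_2)=\sup\frac12\sum_{i}\sum_{j}|P(A_i\cap B_j)-P(A_i)P(B_j)|$, the sup over finite partitions $\{A_i\}\subset\mathcal F_1$, $\{B_j\}\subset\mathcal F_2$ of $\Omega$. $\mathcal P_n(n_1,n_2,m)$ is the set of pairs $(\mathcal I_1,\mathcal I_2)$ of subsets of $\mathcal I_n$ with $|\mathcal I_1|\le n_1$, $|\mathcal I_2|\le n_2$, $\mathbf d(\mathcal I_1,\mathcal I_2)\ge m$ ($n_1,n_2$ may be $\infty$). Assumption 1: $\mathbf d(i,j)\ge 1$ for all $n$ and all $i\ne j$. Assumption 2: there are numbers $\beta_n(n_1,n_2,m)$ with $\sup_{(\mathcal I_1,\mathcal I_2)\in\mathcal P_n(n_1,n_2,m)}\beta(\sigma(X_i:i\in\mathcal I_1),\sigma(X_i:i\in\mathcal I_2))\le\beta_n(n_1,n_2,m)$; $\beta(n_1,n_2,m):=\sup_n\beta_n(n_1,n_2,m)$. Assumption 3: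 the kernel $H=H_n:\mathbb R^d\times\mathbb R^d\to\mathbb R$ is measurable and symmetric, and $E H_n(X_i,\tilde X_j)^2<\infty$ for all $i\ne j$ and $n$. Notation: $H_{ij}=H(X_i,X_j)$; for $i\neq j$, $\tilde X_j$ denotes a random vector with the law of $X_j$ independent of $X_i$, and $H_{i\tilde j}=H(X_i,\tilde X_j)$; $\mathbf H_p=\sup_{i\ne j}\max\{\|H_{ij}\|_p,\|H_{i\tilde j}\|_p\}$. $S_n=\sum_{i\ne k}H(X_i,X_k)$. $\hat H_k(x)=E H(X_k,x)$, $\theta_{ik}=E\hat H_k(X_i)$. Sparsity: for $\mathbf i=(i_1,\dots,i_q)\in\mathcal I_n^q$, entries are $m$-connected in $\mathbf i$ if joined by a chain of entries of $\mathbf i$ with consecutive distances $\le m$; the $m$-profile $\pi_m(\mathbf i)$ is the decreasingly ordered vector of the numbers of entries (counting repeats) in each equivalence class; $\tau^m_{q_1,\dots,q_S}$ is the number of $\mathbf i\in\mathcal I_n^q$ with $\pi_m(\mathbf i)=(q_1,\dots,q_S)$. Wasserstein distance: $\mathbf d_W(Z_1,Z_2)=\sup_{g}|Eg(Z_1)-Eg(Z_2)|$ over all $1$-Lipschitz $g:\mathbb R\to\mathbb R$. *)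

theory Defs
  imports "HOL-Probability.Probability" "HOL-Library.Multiset"
begin

definition finite_partition :: "'a measure \<Rightarrow> 'a set set \<Rightarrow> 'a set set \<Rightarrow> bool" where
  "finite_partition M F P \<longleftrightarrow> finite P \<and> P \<subseteq> F \<and> disjoint P \<and> \<Union>P = space M"

definition beta_mix :: "'a measure \<Rightarrow> 'a set set \<Rightarrow> 'a set set \<Rightarrow> real" where
  "beta_mix M F1 F2 =
     (SUP AB \<in> {(A, B). finite_partition M F1 A \<and> finite_partition M F2 B}.
        (1/2) * (\<Sum>a\<in>fst AB. \<Sum>b\<in>snd AB. \<bar>measure M (a \<inter> b) - measure M a * measure M b\<bar>))"

definition gen_sigma :: "'a measure \<Rightarrow> ('i \<Rightarrow> 'a \<Rightarrow> 'v::topological_space) \<Rightarrow> 'i set \<Rightarrow> 'a set set" where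
  "gen_sigma M X J = sigma_sets (space M) (\<Union>i\<in>J. {X i -` B \<inter> space M | B. B \<in> sets borel})"

text \<open>distance between two index sets (infimum over the empty set is infinity)\<close>
definition set_dist :: "('i \<Rightarrow> 'i \<Rightarrow> ennreal) \<Rightarrow> 'i set \<Rightarrow> 'i set \<Rightarrow> ennreal" where
  "set_dist d J1 J2 = (INF i\<in>J1. INF j\<in>J2. d i j)"

definition pairs_P :: "'i set \<Rightarrow> ('i \<Rightarrow> 'i \<Rightarrow> ennreal) \<Rightarrow> enat \<Rightarrow> enat \<Rightarrow> real \<Rightarrow> ('i set \<times> 'i set) set" where
  "pairs_P I d n1 n2 m = {(J1, J2). J1 \<subseteq> I \<and> J2 \<subseteq> I \<and> enat (card J1) \<le> n1 \<and> enat (card J2) \<le> n2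
                               \<and> set_dist d J1 J2 \<ge> ennreal m}"

definition m_conn :: "('i \<Rightarrow> 'i \<Rightarrow> ennreal) \<Rightarrow> real \<Rightarrow> 'i list \<Rightarrow> (nat \<times> nat) set" where
  "m_conn d m xs = ({(a, b). a < length xs \<and> b < length xs \<and> d (xs ! a) (xs ! b) \<le> ennreal m})\<^sup>*"

definition m_classes :: "('i \<Rightarrow> 'i \<Rightarrow> ennreal) \<Rightarrow> real \<Rightarrow> 'i list \<Rightarrow> nat set set" where
  "m_classes d m xs = (\<lambda>a. {b. b < length xs \<and> (a, b) \<in> m_conn d m xs}) ` {..<length xs}"

text \<open>m-profile: decreasingly ordered sizes of the equivalence classes (counting repeated entries)\<close>
definition m_profile :: "('i \<Rightarrow> 'i \<Rightarrow> ennreal) \<Rightarrow> real \<Rightarrow> 'i list \<Rightarrow> nat list" where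
  "m_profile d m xs = rev (sorted_list_of_multiset (image_mset card (mset_set (m_classes d m xs))))"

definition tau :: "'i set \<Rightarrow> ('i \<Rightarrow> 'i \<Rightarrow> ennreal) \<Rightarrow> real \<Rightarrow> nat list \<Rightarrow> nat" where
  "tau I d m qs = card {xs. set xs \<subseteq> I \<and> length xs = sum_list qs \<and> m_profile d m xs = qs}"

definition law :: "'a measure \<Rightarrow> ('a \<Rightarrow> 'v::topological_space) \<Rightarrow> 'v measure" where
  "law M Y = distr M borel Y"

definition Lp_norm :: "'b measure \<Rightarrow> ('b \<Rightarrow> real) \<Rightarrow> real \<Rightarrow> real" where
  "Lp_norm N f p = (\<integral>x. \<bar>f x\<bar> powr p \<partial>N) powr (1 / p)"

text \<open>H_{ij} = H(X_i,X_j) as a random variable; H_{i~j} has law law(X_i) x law(X_j)\<close>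
definition Hnorm :: "'a measure \<Rightarrow> 'i set \<Rightarrow> ('i \<Rightarrow> 'a \<Rightarrow> 'v::topological_space) \<Rightarrow> ('v \<Rightarrow> 'v \<Rightarrow> real) \<Rightarrow> real \<Rightarrow> real" where
  "Hnorm M I X H p =
     (SUP ij \<in> {(i, j). i \<in> I \<and> j \<in> I \<and> i \<noteq> j}.
        max (Lp_norm M (\<lambda>\<omega>. H (X (fst ij) \<omega>) (X (snd ij) \<omega>)) p)
            (Lp_norm (law M (X (fst ij)) \<Otimes>\<^sub>M law M (X (snd ij))) (\<lambda>(x, y). H x y) p))"

definition Hmom_finite :: "'a measure \<Rightarrow> 'i set \<Rightarrow> ('i \<Rightarrow> 'a \<Rightarrow> 'v::topological_space) \<Rightarrow> ('v \<Rightarrow> 'v \<Rightarrow> real) \<Rightarrow> real \<Rightarrow> bool" where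
  "Hmom_finite M I X H p \<longleftrightarrow>
     (\<forall>i\<in>I. \<forall>j\<in>I. i \<noteq> j \<longrightarrow>
        integrable M (\<lambda>\<omega>. \<bar>H (X i \<omega>) (X j \<omega>)\<bar> powr p) \<and>
        integrable (law M (X i) \<Otimes>\<^sub>M law M (X j)) (\<lambda>(x, y). \<bar>H x y\<bar> powr p))"

definition Hhat :: "'a measure \<Rightarrow> ('i \<Rightarrow> 'a \<Rightarrow> 'v::topological_space) \<Rightarrow> ('v \<Rightarrow> 'v \<Rightarrow> real) \<Rightarrow> 'i \<Rightarrow> 'v \<Rightarrow> real" where
  "Hhat M X H k x = (\<integral>\<omega>. H (X k \<omega>) x \<partial>M)"

definition theta :: "'a measure \<Rightarrow> ('i \<Rightarrow> 'a \<Rightarrow> 'v::topological_space) \<Rightarrow> ('v \<Rightarrow> 'v \<Rightarrow> real) \<Rightarrow> 'i \<Rightarrow> 'i \<Rightarrow> real" where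
  "theta M X H i k = (\<integral>\<omega>. Hhat M X H k (X i \<omega>) \<partial>M)"

definition hproj :: "'a measure \<Rightarrow> 'i set \<Rightarrow> ('i \<Rightarrow> 'a \<Rightarrow> 'v::topological_space) \<Rightarrow> ('v \<Rightarrow> 'v \<Rightarrow> real) \<Rightarrow> 'i \<Rightarrow> 'a \<Rightarrow> real" where
  "hproj M I X H i \<omega> = (1 / (real (card I) - 1)) * (\<Sum>k\<in>I - {i}. Hhat M X H k (X i \<omega>) - theta M X H i k)"

definition nu :: "'a measure \<Rightarrow> 'i set \<Rightarrow> ('i \<Rightarrow> 'a \<Rightarrow> 'v::topological_space) \<Rightarrow> ('v \<Rightarrow> 'v \<Rightarrow> real) \<Rightarrow> real" where
  "nu M I X H = sqrt (prob_space.variance M (\<lambda>\<omega>. \<Sum>i\<in>I. hproj M I X H i \<omega>))"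

definition Ustat :: "'i set \<Rightarrow> ('i \<Rightarrow> 'a \<Rightarrow> 'v) \<Rightarrow> ('v \<Rightarrow> 'v \<Rightarrow> real) \<Rightarrow> 'a \<Rightarrow> real" where
  "Ustat I X H \<omega> = (\<Sum>i\<in>I. \<Sum>k\<in>I - {i}. H (X i \<omega>) (X k \<omega>))"

definition Wstat :: "'a measure \<Rightarrow> 'i set \<Rightarrow> ('i \<Rightarrow> 'a \<Rightarrow> 'v::topological_space) \<Rightarrow> ('v \<Rightarrow> 'v \<Rightarrow> real) \<Rightarrow> 'a \<Rightarrow> real" where
  "Wstat M I X H \<omega> =
     (Ustat I X H \<omega> - (\<Sum>i\<in>I. \<Sum>k\<in>I - {i}. theta M X H i k))
       / (2 * (real (card I) - 1) * nu M I X H)"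

definition dW_normal :: "'a measure \<Rightarrow> ('a \<Rightarrow> real) \<Rightarrow> real" where
  "dW_normal M W =
     (SUP g \<in> {g :: real \<Rightarrow> real. 1-lipschitz_on UNIV g}.
        \<bar>(\<integral>\<omega>. g (W \<omega>) \<partial>M) - (\<integral>z. g z \<partial>(density lborel std_normal_density))\<bar>)"

end

theory Submission
  imports Defs "HOL-Real_Asymp.Real_Asymp"
begin

text \<open>
  By the Hoeffding decomposition \<open>W\<close> is the sum \<open>T\<close> of the \<open>h_i / \<nu>\<close> plus a multiple of a
  degenerate U-statistic \<open>U\<close>. If one of the four indices of a product of two degenerate kernels is at
  distance more than \<open>m\<close> from the others, replacing its variable by an independent copy
  annihilates the expectation, at a cost controlled by \<open>\<beta>(1,3,m)\<close>; the remaining index tuples have profile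
  (4) or (2,2). This bounds \<open>E U^2\<close>. For \<open>T\<close>, Stein's equation \<open>f' - x f = g - E g(Z)\<close> reduces the
  distance to \<open>E (f'(T) - T f(T))\<close>. Removing from \<open>T\<close> the summands near \<open>i\<close>, and then those near
  \<open>i\<close> or \<open>j\<close>, leaves covariances of separated variables (the terms with \<open>\<beta>\<close>) and third-order
  Taylor remainders over connected triples (the term with \<open>\<tau>_3\<close>).
  In every case the \<open>\<beta>\<close>-mixing coefficient bounds the total variation distance between a joint law and
  the product law, and truncation extends this to functions with \<open>p\<close>-th moments.
\<close>

subsection \<open>Stein's equation\<close>

text \<open>The obstacle is that \<open>beta_mix\<close> speaks of pairs of finite partitions only,
  while a degenerate kernel couples the isolated index with the remaining ones, so a covariance
  inequality for products u(x) v(y) would not suffice. The comparison is therefore made on the whole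
  product \<sigma>-algebra and for arbitrary functions of two blocks, with
  \<open>M \<Otimes>\<^sub>M M\<close> supplying the independent copy. Truncation of a function with
  p moments leaves the exponent 1 - 1/p: products of two variables with 2 + \<delta> moments have p
  = 1 + \<delta>/2, whence \<delta>/(2 + \<delta>), and single summands with p = 1 + \<delta> give
  \<delta>/(1 + \<delta>). The Stein solution and its derivative both solve u' = x u + F, so one
  comparison argument bounds f, f' and f'' without formulas for Gaussian tails. As f'' involves g',
  a Lipschitz g is first smoothed. Blocks count as separated at distances > m, the exact negation of
  the relation behind m-connectedness, so a tuple is either handled by mixing or counted by some
  \<open>tau\<close>.\<close>

lemma ode_bound_right:
  fixes u F :: "real \<Rightarrow> real"
  assumes ode: "\<And>x. (u has_real_derivative x * u x + F x) (at x)"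
    and F: "\<And>t. x \<le> t \<Longrightarrow> \<bar>F t\<bar> \<le> K * t"
    and lim: "((\<lambda>x. u x * exp (- x\<^sup>2 / 2)) \<longlongrightarrow> 0) at_top"
  shows "\<bar>u x\<bar> \<le> K"
proof -
  have *: "s * u x \<le> K" if s: "\<bar>s\<bar> = 1" for s :: real
  proof -
    \<comment> \<open>The Gaussian weight is the integrating factor: the derivative of
      \<open>w\<close> no longer contains \<open>u\<close> and is nonpositive beyond
      \<open>x\<close>. So \<open>w\<close> decreases there to its limit 0, which makes
      \<open>w x\<close> nonnegative; the two signs of \<open>s\<close> give the absolute
      value.\<close>
    define w where "w = (\<lambda>t. (K - s * u t) * exp (- t\<^sup>2 / 2))"
    have dw: "(w has_real_derivative (- s * F t - K * t) * exp (- t\<^sup>2 / 2)) (at t)" for t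
      unfolding w_def by (rule derivative_eq_intros ode refl | simp add: algebra_simps)+
    have neg: "(- s * F t - K * t) * exp (- t\<^sup>2 / 2) \<le> 0" if "x \<le> t" for t
    proof -
      have "\<bar>s * F t\<bar> \<le> K * t" using F[OF that] s by (simp add: abs_mult)
      then show ?thesis by (intro mult_nonpos_nonneg) auto
    qed
    have "w y \<le> w x" if "x \<le> y" for y
      using that
    proof (rule DERIV_nonpos_imp_nonincreasing)
      fix t assume "x \<le> t" "t \<le> y"
      then show "\<exists>y. (w has_real_derivative y) (at t) \<and> y \<le> 0"
        using dw neg by blast
    qed
    then have ev: "eventually (\<lambda>y. w y \<le> w x) at_top"
      using eventually_ge_at_top by (rule eventually_mono[rotated])
    have "((\<lambda>t. K * exp (- t\<^sup>2 / 2) - s * (u t * exp (- t\<^sup>2 / 2))) \<longlongrightarrow> K * 0 - s * 0) at_top"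
      by (intro tendsto_intros lim) real_asymp
    then have "(w \<longlongrightarrow> 0) at_top"
      unfolding w_def by (simp add: algebra_simps)
    then have "0 \<le> w x"
      using ev by (rule tendsto_upperbound) simp
    then show ?thesis
      by (simp add: w_def zero_le_mult_iff)
  qed
  from *[of 1] *[of "-1"] show ?thesis by simp
qed

text \<open>The reflection of \<open>u\<close> at the origin solves an equation of the same form and
  moves the behaviour at \<open>at_bot\<close> to \<open>at_top\<close>, so estimates are needed on
  the right half-line only.\<close>

lemma ode_reflect:
  fixes u F :: "real \<Rightarrow> real"
  assumes ode: "\<And>x. (u has_real_derivative x * u x + F x) (at x)"
    and lim: "((\<lambda>x. u x * exp (- x\<^sup>2 / 2)) \<longlongrightarrow> 0) at_bot"
  shows "((\<lambda>x. - u (- x)) has_real_derivative x * (- u (- x)) + F (- x)) (at x)"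
    and "((\<lambda>x. - u (- x) * exp (- x\<^sup>2 / 2)) \<longlongrightarrow> 0) at_top"
proof -
  show "((\<lambda>x. - u (- x)) has_real_derivative x * (- u (- x)) + F (- x)) (at x)"
    using ode[of "- x"] unfolding DERIV_mirror
    by (auto intro!: derivative_eq_intros)
  have "((\<lambda>x. u (- x) * exp (- (- x)\<^sup>2 / 2)) \<longlongrightarrow> 0) at_top"
    using lim filterlim_uminus_at_bot_at_top by (rule filterlim_compose)
  then show "((\<lambda>x. - u (- x) * exp (- x\<^sup>2 / 2)) \<longlongrightarrow> 0) at_top"
    using tendsto_minus[of "\<lambda>x. u (- x) * exp (- x\<^sup>2 / 2)" 0] by simp
qed

text \<open>At x > 0, a source bounded by \<open>K\<close> is at most (K / x) t for all t \<ge> x,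
  so the comparison gives K / x. The gained factor 1 / x is what controls the term x f'(x) in the
  second derivative of the Stein solution.\<close>

lemma ode_decay:
  fixes u F :: "real \<Rightarrow> real"
  assumes ode: "\<And>x. (u has_real_derivative x * u x + F x) (at x)"
    and F: "\<And>t. \<bar>F t\<bar> \<le> K"
    and lim: "((\<lambda>x. u x * exp (- x\<^sup>2 / 2)) \<longlongrightarrow> 0) at_top"
             "((\<lambda>x. u x * exp (- x\<^sup>2 / 2)) \<longlongrightarrow> 0) at_bot"
  shows "\<bar>x * u x\<bar> \<le> K"
proof -
  have K: "0 \<le> K" using F[of 0] by simp
  have *: "\<bar>v x\<bar> \<le> K / x"
    if "\<And>x. (v has_real_derivative x * v x + F' x) (at x)" "\<And>t. \<bar>F' t\<bar> \<le> K"
      "((\<lambda>x. v x * exp (- x\<^sup>2 / 2)) \<longlongrightarrow> 0) at_top" "0 < x" for v F' x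
  proof (rule ode_bound_right[OF that(1) _ that(3)])
    fix t assume "x \<le> t"
    then have "K \<le> K / x * t" using K that(4) by (simp add: field_simps mult_left_mono)
    then show "\<bar>F' t\<bar> \<le> K / x * t" using that(2)[of t] by linarith
  qed
  consider "x = 0" | "0 < x" | "x < 0" by linarith
  then show ?thesis
  proof cases
    case 2
    then show ?thesis using *[OF ode F lim(1)] by (simp add: abs_mult field_simps)
  next
    case 3
    then show ?thesis
      using *[OF ode_reflect(1)[OF ode lim(2)] F ode_reflect(2)[OF ode lim(2)], of "- x"] by (simp add: abs_mult field_simps)
  qed (use K in simp)
qed

text \<open>For x \<ge> 1 the estimate 1 + t \<le> 2 t yields 2 K by comparison, and reflection
  covers x \<le> -1. In between, t is too small for the comparison, and the mean value theorem
  carries the bound at 1 inward.\<close>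

lemma ode_bounded:
  fixes u F :: "real \<Rightarrow> real"
  assumes ode: "\<And>x. (u has_real_derivative x * u x + F x) (at x)"
    and F: "\<And>t. \<bar>F t\<bar> \<le> K * (1 + \<bar>t\<bar>)"
    and lim: "((\<lambda>x. u x * exp (- x\<^sup>2 / 2)) \<longlongrightarrow> 0) at_top"
             "((\<lambda>x. u x * exp (- x\<^sup>2 / 2)) \<longlongrightarrow> 0) at_bot"
  shows "\<bar>u x\<bar> \<le> 12 * K"
proof -
  have K: "0 \<le> K" using F[of 0] by simp
  have *: "\<bar>v x\<bar> \<le> 2 * K"
    if "\<And>x. (v has_real_derivative x * v x + F' x) (at x)" "\<And>t. \<bar>F' t\<bar> \<le> K * (1 + \<bar>t\<bar>)"
      "((\<lambda>x. v x * exp (- x\<^sup>2 / 2)) \<longlongrightarrow> 0) at_top" "1 \<le> x" for v F' x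
  proof (rule ode_bound_right[OF that(1) _ that(3)])
    fix t assume "x \<le> t"
    then have "K * (1 + \<bar>t\<bar>) \<le> 2 * K * t" 
      using K that(4) mult_left_mono[of "1 + \<bar>t\<bar>" "2 * t" K] by simp
    then show "\<bar>F' t\<bar> \<le> 2 * K * t" using that(2)[of t] by linarith
  qed
  consider "1 \<le> x" | "x \<le> -1" | "-1 < x" "x < 1" by linarith
  then show ?thesis
  proof cases
    case 1
    then show ?thesis using *[OF ode F lim(1)] K by fastforce
  next
    case 2
    then have "\<bar>u x\<bar> \<le> 2 * K"
      using *[OF ode_reflect(1)[OF ode lim(2)] _ ode_reflect(2)[OF ode lim(2)], of "- x"] F[of "- _"] by simp
    then show ?thesis using K by linarith
  next
    case 3
    define v where "v = (\<lambda>t. u t * exp (- t\<^sup>2 / 2))"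
    have dv: "(v has_real_derivative F t * exp (- t\<^sup>2 / 2)) (at t)" for t
      unfolding v_def by (rule derivative_eq_intros ode refl | simp add: algebra_simps)+
    obtain z where z: "x < z" "z < 1" "v 1 - v x = (1 - x) * (F z * exp (- z\<^sup>2 / 2))"
      using MVT2[of x 1 v, OF 3(2) dv] by blast
    have "\<bar>F z * exp (- z\<^sup>2 / 2)\<bar> \<le> 2 * K"
    proof -
      have "\<bar>F z\<bar> \<le> K * (1 + \<bar>z\<bar>)" by (rule F)
      also have "\<dots> \<le> K * 2" using z 3 K by (intro mult_left_mono) auto
      finally have "\<bar>F z\<bar> * exp (- z\<^sup>2 / 2) \<le> (2 * K) * 1"
        using K by (intro mult_mono) auto
      then show ?thesis by (simp add: abs_mult)
    qed
    then have "\<bar>(1 - x) * (F z * exp (- z\<^sup>2 / 2))\<bar> \<le> 2 * (2 * K)"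
      unfolding abs_mult[of "1 - x"] using 3 by (intro mult_mono) auto
    moreover have "\<bar>v 1\<bar> \<le> 2 * K"
    proof -
      have "\<bar>u 1\<bar> * exp (- 1\<^sup>2 / 2) \<le> (2 * K) * 1"
        using *[OF ode F lim(1), of 1] by (intro mult_mono) auto
      then show ?thesis by (simp add: v_def abs_mult)
    qed
    \<comment> \<open>The value at 1 contributes 2 K, and an interval of length below 2 with slope
      at most 2 K another 4 K. Removing the weight costs a factor 2, whence 12.\<close>
    ultimately have v: "\<bar>v x\<bar> \<le> 6 * K" using z(3) by linarith
    have "exp (x\<^sup>2 / 2) \<le> exp (1 / 2 :: real)"
      using 3 abs_square_le_1[of x] by simp
    then have e: "exp (x\<^sup>2 / 2) \<le> 2" using exp_half_le2 by linarith
    have "u x = v x * exp (x\<^sup>2 / 2)"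
      by (simp add: v_def mult_exp_exp)
    then have "\<bar>u x\<bar> = \<bar>v x\<bar> * exp (x\<^sup>2 / 2)" by (simp add: abs_mult)
    also have "\<dots> \<le> (6 * K) * 2" using v e by (intro mult_mono) auto
    finally show ?thesis by simp
  qed
qed

section \<open>Primitives of functions with integral zero\<close>

lemma antiderivative_exists:
  fixes g :: "real \<Rightarrow> real"
  assumes "continuous_on UNIV g"
  shows "\<exists>G. \<forall>x. (G has_real_derivative g x) (at x)"
proof -
  have "\<exists>F. \<forall>x::real. -\<infinity> < ereal x \<longrightarrow> ereal x < \<infinity> \<longrightarrow> (F has_vector_derivative g x) (at x)"
    using assms by (intro einterval_antiderivative) (auto simp: continuous_on_eq_continuous_at)
  then show ?thesis
    by (simp add: has_real_derivative_iff_has_vector_derivative)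
qed

text \<open>The Stein solution is a primitive of \<open>q\<close> times exp(x^2 / 2), which can be
  bounded only if the primitive vanishes at both ends. The integral over \<open>{..x}\<close> does
  so because the total integral is 0, and it differs from any antiderivative by a constant.\<close>

lemma antiderivative_vanishing_at_infinity:
  fixes q :: "real \<Rightarrow> real"
  assumes q: "continuous_on UNIV q" and int: "integrable lborel q" and z: "(\<integral>x. q x \<partial>lborel) = 0"
  shows "\<exists>G. (\<forall>x. (G has_real_derivative q x) (at x)) \<and> (G \<longlongrightarrow> 0) at_top \<and> (G \<longlongrightarrow> 0) at_bot"
proof -
  obtain A where A: "\<And>x. (A has_real_derivative q x) (at x)"
    using antiderivative_exists[OF q] by blast
  define G where "G = (\<lambda>x. \<integral>t. indicator {..x} t *\<^sub>R q t \<partial>lborel)"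
  have top: "(G \<longlongrightarrow> 0) at_top"
    unfolding G_def using tendsto_integral_at_top[OF sets_lborel int] z by simp
  have int': "integrable lborel (\<lambda>x. q (- x))"
    using lborel_integrable_real_affine[OF int, of "-1" 0] by simp
  have iz: "(\<integral>x. q (- x) \<partial>lborel) = 0"
    using lborel_integral_real_affine[of "-1" q 0] z by simp
  have G': "G x = (\<integral>t. indicator {- x..} t *\<^sub>R q (- t) \<partial>lborel)" for x
  proof -
    have "G x = (\<integral>t. indicator {..x} (- t) *\<^sub>R q (- t) \<partial>lborel)"
      unfolding G_def using lborel_integral_real_affine[of "-1" "\<lambda>t. indicator {..x} t *\<^sub>R q t" 0] by simp
    also have "\<dots> = (\<integral>t. indicator {- x..} t *\<^sub>R q (- t) \<partial>lborel)"
      by (intro Bochner_Integration.integral_cong) (auto simp: indicator_def)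
    finally show ?thesis .
  qed
  \<comment> \<open>The limit of the truncated integral is available at \<open>at_top\<close>, so it
    is taken for the reflected integrand. The half-lines \<open>{..y}\<close> and
    \<open>{y..}\<close> overlap in one point, a null set.\<close>
  have bot: "(G \<longlongrightarrow> 0) at_bot"
  proof -
    have "((\<lambda>y. \<integral>t. indicator {..y} t *\<^sub>R q (- t) \<partial>lborel) \<longlongrightarrow> 0) at_top"
      using tendsto_integral_at_top[OF sets_lborel int'] iz by simp
    moreover have "(\<integral>t. indicator {..y} t *\<^sub>R q (- t) \<partial>lborel) = - G (- y)" for y
    proof -
      have i1: "integrable lborel (\<lambda>t. indicator {..y} t *\<^sub>R q (- t))"
        and i2: "integrable lborel (\<lambda>t. indicator {y..} t *\<^sub>R q (- t))"
        by (intro integrable_mult_indicator int'; simp)+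
      have "(\<integral>t. indicator {..y} t *\<^sub>R q (- t) \<partial>lborel) + G (- y)
           = (\<integral>t. indicator {..y} t *\<^sub>R q (- t) + indicator {y..} t *\<^sub>R q (- t) \<partial>lborel)"
        unfolding G' using i1 i2 by (simp add: Bochner_Integration.integral_add)
      also have "\<dots> = (\<integral>t. q (- t) \<partial>lborel)"
      proof (rule integral_cong_AE)
        show "AE t in lborel. indicator {..y} t *\<^sub>R q (- t) + indicator {y..} t *\<^sub>R q (- t) = q (- t)"
          using AE_lborel_singleton[of y] by eventually_elim (auto simp: indicator_def)
        show "(\<lambda>t. indicator {..y} t *\<^sub>R q (- t) + indicator {y..} t *\<^sub>R q (- t)) \<in> borel_measurable lborel"
          using Bochner_Integration.integrable_add[OF i1 i2] by (rule borel_measurable_integrable)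
      qed (rule borel_measurable_integrable[OF int'])
      finally show ?thesis using iz by simp
    qed
    ultimately have "((\<lambda>y. - G (- y)) \<longlongrightarrow> 0) at_top" by simp
    then have "((\<lambda>y. G (- y)) \<longlongrightarrow> 0) at_top" using tendsto_minus by fastforce
    then have "((\<lambda>y. G (- (- y))) \<longlongrightarrow> 0) at_bot"
      by (rule filterlim_compose[OF _ filterlim_uminus_at_top_at_bot])
    then show ?thesis by simp
  qed
  have diff: "G b - G a = A b - A a" if "a \<le> b" for a b
  proof -
    have i: "integrable lborel (\<lambda>t. indicator {..x} t *\<^sub>R q t)" for x
      by (intro integrable_mult_indicator int) simp
    have "G b - G a = (\<integral>t. indicator {..b} t *\<^sub>R q t - indicator {..a} t *\<^sub>R q t \<partial>lborel)"
      unfolding G_def using i by (simp add: Bochner_Integration.integral_diff)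
    also have "\<dots> = (\<integral>t. q t * indicator {a..b} t \<partial>lborel)"
    proof (rule integral_cong_AE)
      show "AE t in lborel. indicator {..b} t *\<^sub>R q t - indicator {..a} t *\<^sub>R q t = q t * indicator {a..b} t"
        using AE_lborel_singleton[of a] by eventually_elim (use that in \<open>auto simp: indicator_def\<close>)
      show "(\<lambda>t. indicator {..b} t *\<^sub>R q t - indicator {..a} t *\<^sub>R q t) \<in> borel_measurable lborel"
        using Bochner_Integration.integrable_diff[OF i i] by (rule borel_measurable_integrable)
      show "(\<lambda>t. q t * indicator {a..b} t) \<in> borel_measurable lborel"
        using int by measurable
    qed
    also have "\<dots> = A b - A a"
      using that A q by (intro integral_FTC_Icc_real) (auto simp: continuous_on_eq_continuous_at)
    finally show ?thesis .
  qed
  have GA: "G = (\<lambda>x. A x + (G 0 - A 0))"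
  proof
    fix x show "G x = A x + (G 0 - A 0)" using diff[of 0 x] diff[of x 0] by linarith
  qed
  have "(G has_real_derivative q x) (at x)" for x
    by (subst GA) (auto intro!: derivative_eq_intros A)
  with top bot show ?thesis by blast
qed


section \<open>Solving Stein's equation for the normal law\<close>

lemma lipschitz_integrable:
  fixes g :: "real \<Rightarrow> real"
  assumes "1-lipschitz_on UNIV g" "finite_measure M" "integrable M X"
  shows "integrable M (\<lambda>x. g (X x))"
proof -
  interpret finite_measure M by fact
  have [measurable]: "g \<in> borel_measurable borel"
    using lipschitz_on_continuous_on[OF assms(1)] by (rule borel_measurable_continuous_onI)
  have [measurable]: "X \<in> borel_measurable M" using assms(3) by auto
  have bd: "\<bar>g y\<bar> \<le> \<bar>g 0\<bar> + \<bar>y\<bar>" for y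
    using lipschitz_onD[OF assms(1), of y 0] by (simp add: dist_real_def)
  show ?thesis
    by (rule Bochner_Integration.integrable_bound[of M "\<lambda>x. \<bar>g 0\<bar> + \<bar>X x\<bar>"])
       (use assms bd in \<open>auto intro: order_trans[OF bd]\<close>)
qed

abbreviation std_gauss :: "real measure"
  where "std_gauss \<equiv> density lborel (\<lambda>x. ennreal (std_normal_density x))"

lemma std_gauss_abs_moment:
  shows "integrable std_gauss (\<lambda>z. z)" and "(\<integral>z. \<bar>z\<bar> \<partial>std_gauss) \<le> 1"
proof -
  have i1: "integrable lborel (\<lambda>x. std_normal_density x * \<bar>x\<bar>)"
    using integrable_std_normal_moment_abs[of 1] by simp
  have "integrable lborel (\<lambda>x. std_normal_density x * x)"
    using integrable_std_normal_moment[of 1] by simp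
  then show "integrable std_gauss (\<lambda>z. z)"
    by (subst integrable_density) auto
  have "sqrt (2 / pi) \<le> sqrt 1"
    using pi_gt3 by (intro real_sqrt_le_mono) (simp add: field_simps)
  then show "(\<integral>z. \<bar>z\<bar> \<partial>std_gauss) \<le> 1"
    using integral_std_normal_moment_abs_odd[of 0] by (subst integral_density) auto
qed

text \<open>The constants are not optimal: only their independence of \<open>g\<close> matters.\<close>

lemma stein_solution:
  fixes g g' :: "real \<Rightarrow> real"
  assumes g: "\<And>x. (g has_real_derivative g' x) (at x)" and g': "\<And>x. \<bar>g' x\<bar> \<le> 1"
  shows "\<exists>f f' f''. (\<forall>x. (f has_real_derivative f' x) (at x)) \<and>
    (\<forall>x. (f' has_real_derivative f'' x) (at x)) \<and>
    (\<forall>x. \<bar>f x\<bar> \<le> 12) \<and> (\<forall>x. \<bar>f' x\<bar> \<le> 156) \<and> (\<forall>x. \<bar>f'' x\<bar> \<le> 26) \<and>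
    (\<forall>x. f' x - x * f x = g x - (\<integral>z. g z \<partial>std_gauss))"
proof -
  interpret N: prob_space std_gauss
    by (rule prob_space_normal_density) simp
  have lip: "1-lipschitz_on UNIV g"
  proof (rule lipschitz_onI)
    fix x y :: real
    show "dist (g x) (g y) \<le> 1 * dist x y"
      using field_differentiable_bound[of UNIV g g' 1 x y] g g'
      by (auto simp: dist_norm has_field_derivative_at_within)
  qed simp
  have gcont: "continuous_on UNIV g"
    using g by (meson DERIV_continuous_on has_field_derivative_at_within)
  then have gm[measurable]: "g \<in> borel_measurable borel"
    by (rule borel_measurable_continuous_onI)
  define \<mu> where "\<mu> = (\<integral>z. g z \<partial>std_gauss)"
  have gi: "integrable std_gauss g"
    using lipschitz_integrable[OF lip _ std_gauss_abs_moment(1)] N.finite_measure_axioms by simp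
  \<comment> \<open>Replacing the mean by a value of g costs E |Z| \<le> 1. This linear growth is
    the hypothesis of \<open>ode_bounded\<close> with constant 1.\<close>
  have dev: "\<bar>g t - \<mu>\<bar> \<le> 1 + \<bar>t\<bar>" for t
  proof -
    have "g t - \<mu> = (\<integral>z. g t - g z \<partial>std_gauss)"
      using gi by (simp add: \<mu>_def N.prob_space[simplified])
    also have "\<bar>\<dots>\<bar> \<le> (\<integral>z. \<bar>t\<bar> + \<bar>z\<bar> \<partial>std_gauss)"
    proof (rule order_trans[OF integral_abs_bound], rule integral_mono)
      fix z show "\<bar>g t - g z\<bar> \<le> \<bar>t\<bar> + \<bar>z\<bar>"
        using lipschitz_onD[OF lip, of t z] by (simp add: dist_real_def)
    qed (use gi std_gauss_abs_moment(1) in auto)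
    also have "\<dots> = \<bar>t\<bar> + (\<integral>z. \<bar>z\<bar> \<partial>std_gauss)"
      using std_gauss_abs_moment(1) by (simp add: N.prob_space[simplified])
    finally show ?thesis using std_gauss_abs_moment(2) by linarith
  qed
  \<comment> \<open>With the weight as integrating factor, Stein's equation becomes G' = q; centring
    at \<open>\<mu>\<close> makes the integral of \<open>q\<close> vanish.\<close>
  define q where "q = (\<lambda>t. (g t - \<mu>) * exp (- t\<^sup>2 / 2))"
  have q_dens: "q t = sqrt (2 * pi) * (std_normal_density t * (g t - \<mu>))" for t
    by (simp add: q_def std_normal_density_def)
  have di: "integrable std_gauss (\<lambda>t. g t - \<mu>)" using gi by auto
  have dz: "(\<integral>t. g t - \<mu> \<partial>std_gauss) = 0" using gi by (simp add: \<mu>_def N.prob_space[simplified])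
  have qc: "continuous_on UNIV q"
    unfolding q_def by (intro continuous_intros gcont) simp_all
  have qi: "integrable lborel q"
  proof -
    have "integrable lborel (\<lambda>t. std_normal_density t * (g t - \<mu>))"
      using di integrable_real_density[where M=lborel and f=std_normal_density and g="\<lambda>t. g t - \<mu>"] by simp
    then show ?thesis
      unfolding q_dens[abs_def] by simp
  qed
  have qz: "(\<integral>t. q t \<partial>lborel) = 0"
  proof -
    have "(\<integral>t. std_normal_density t * (g t - \<mu>) \<partial>lborel) = 0"
      using dz integral_real_density[where M=lborel and f=std_normal_density and g="\<lambda>t. g t - \<mu>"] by simp
    then show ?thesis
      unfolding q_dens[abs_def] by simp
  qed
  obtain G where G: "\<And>x. (G has_real_derivative q x) (at x)" "(G \<longlongrightarrow> 0) at_top" "(G \<longlongrightarrow> 0) at_bot"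
    using antiderivative_vanishing_at_infinity[OF qc qi qz] by blast
  define f where "f = (\<lambda>x. G x * exp (x\<^sup>2 / 2))"
  define f' where "f' = (\<lambda>x. x * f x + (g x - \<mu>))"
  \<comment> \<open>Differentiating the equation shows that \<open>f'\<close> solves the same
    equation with source \<open>f x + g' x\<close>, bounded by 12 + 1. Hence 12 * 13 = 156 for f',
    13 for x f', and 13 + 13 = 26 for f''.\<close>
  define f'' where "f'' = (\<lambda>x. x * f' x + (f x + g' x))"
  have df: "(f has_real_derivative x * f x + (g x - \<mu>)) (at x)" for x
    unfolding f_def
    by (rule derivative_eq_intros G(1) refl | simp add: q_def mult_exp_exp algebra_simps)+
  have df': "(f' has_real_derivative x * f' x + (f x + g' x)) (at x)" for x
    unfolding f'_def by (rule derivative_eq_intros df g refl | simp add: algebra_simps)+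
  have fG: "f x * exp (- x\<^sup>2 / 2) = G x" for x
    by (simp add: f_def mult_exp_exp)
  have fb: "\<bar>f x\<bar> \<le> 12" for x
    using ode_bounded[of f "\<lambda>x. g x - \<mu>" 1 x] df dev G(2,3) fG by simp
  \<comment> \<open>A crude bound that serves to show that \<open>f'\<close> times the weight
    vanishes at both ends; the comparison lemmas then improve it to a constant.\<close>
  have f'b: "\<bar>f' x\<bar> \<le> 13 * \<bar>x\<bar> + 1" for x
  proof -
    have "\<bar>x * f x\<bar> \<le> 12 * \<bar>x\<bar>"
      using mult_left_mono[OF fb[of x], of "\<bar>x\<bar>"] by (simp add: abs_mult)
    then show ?thesis using dev[of x] unfolding f'_def by linarith
  qed
  have lim': "((\<lambda>x. f' x * exp (- x\<^sup>2 / 2)) \<longlongrightarrow> 0) F"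
    if "((\<lambda>x. (13 * \<bar>x\<bar> + 1) * exp (- x\<^sup>2 / 2)) \<longlongrightarrow> 0) F" for F
    using _ that by (rule Lim_null_comparison) (auto simp: abs_mult f'b)
  have F1: "\<bar>f x + g' x\<bar> \<le> 13" for x
    using fb[of x] g'[of x] by linarith
  have lt: "((\<lambda>x. f' x * exp (- x\<^sup>2 / 2)) \<longlongrightarrow> 0) at_top"
    by (rule lim') real_asymp
  have lb: "((\<lambda>x. f' x * exp (- x\<^sup>2 / 2)) \<longlongrightarrow> 0) at_bot"
    by (rule lim') real_asymp
  have f'b1: "\<bar>f' x\<bar> \<le> 12 * 13" for x
  proof (rule ode_bounded[OF df' _ lt lb])
    fix t :: real show "\<bar>f t + g' t\<bar> \<le> 13 * (1 + \<bar>t\<bar>)" using F1[of t] by simp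
  qed
  have f'b2: "\<bar>f' x\<bar> \<le> 156" for x using f'b1[of x] by linarith
  have xf': "\<bar>x * f' x\<bar> \<le> 13" for x
    by (rule ode_decay[OF df' F1 lt lb])
  have f''b: "\<bar>f'' x\<bar> \<le> 26" for x
    using F1[of x] xf'[of x] abs_triangle_ineq[of "x * f' x" "f x + g' x"] unfolding f''_def by linarith
  have eq: "f' x - x * f x = g x - (\<integral>z. g z \<partial>std_gauss)" for x
    by (simp add: f'_def \<mu>_def)
  show ?thesis
  proof (intro exI conjI allI)
    show "(f has_real_derivative f' x) (at x)" for x using df unfolding f'_def .
    show "(f' has_real_derivative f'' x) (at x)" for x using df' unfolding f''_def .
  qed (rule fb f'b2 f''b eq)+
qed

text \<open>The moving average of \<open>g\<close> over an interval of length \<open>e\<close>: its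
  derivative is a difference quotient of \<open>g\<close>, and by the mean value theorem each of its
  values is some \<open>g z\<close> with z within \<open>e\<close> of x.\<close>

lemma lipschitz_smoothing:
  fixes g :: "real \<Rightarrow> real"
  assumes lip: "1-lipschitz_on UNIV g" and e: "0 < e"
  shows "\<exists>k k'. (\<forall>x. (k has_real_derivative k' x) (at x)) \<and> (\<forall>x. \<bar>k' x\<bar> \<le> 1) \<and>
    (\<forall>x. \<bar>k x - g x\<bar> \<le> e)"
proof -
  obtain G where G: "\<And>x. (G has_real_derivative g x) (at x)"
    using antiderivative_exists[OF lipschitz_on_continuous_on[OF lip]] by blast
  have L: "\<bar>g x - g y\<bar> \<le> \<bar>x - y\<bar>" for x y
    using lipschitz_onD[OF lip, of x y] by (simp add: dist_real_def)
  define k where "k = (\<lambda>x. (G (x + e) - G x) / e)"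
  show ?thesis
  proof (rule exI[of _ k], rule exI[of _ "\<lambda>x. (g (x + e) - g x) / e"], intro conjI allI)
    fix x
    show "(k has_real_derivative (g (x + e) - g x) / e) (at x)"
      unfolding k_def using G[of "x + e"] e
      by (auto intro!: derivative_eq_intros G simp: DERIV_shift)
  next
    fix x
    show "\<bar>(g (x + e) - g x) / e\<bar> \<le> 1"
      using L[of "x + e" x] e by simp
  next
    fix x
    obtain z where z: "x < z" "z < x + e" "G (x + e) - G x = (x + e - x) * g z"
      using MVT2[of x "x + e" G g] G e by auto
    then have "k x = g z" using e by (simp add: k_def)
    then show "\<bar>k x - g x\<bar> \<le> e" using L[of z x] z by simp
  qed
qed

subsection \<open>Moment bounds\<close>

text \<open>A predicate with an upper bound instead of the norm: the Bochner integral of a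
  nonintegrable function is 0, so a bound on the integral alone would say nothing, and integrability
  must travel with it.\<close>

definition Lp_bound :: "'a measure \<Rightarrow> real \<Rightarrow> ('a \<Rightarrow> real) \<Rightarrow> real \<Rightarrow> bool" where
  "Lp_bound M p f K \<longleftrightarrow> f \<in> borel_measurable M \<and> integrable M (\<lambda>x. \<bar>f x\<bar> powr p) \<and>
     (\<integral>x. \<bar>f x\<bar> powr p \<partial>M) \<le> K powr p \<and> 0 \<le> K"

text \<open>The tangent at c of a convex function, obtained from Young's inequality with exponents p
  and p / (p - 1). The Jensen inequalities for expectations and for averages both rest on
  it.\<close>

lemma powr_tangent:
  fixes c y p :: real
  assumes p: "1 < p" and c: "0 \<le> c" and y: "0 \<le> y"
  shows "c powr p + p * c powr (p - 1) * (y - c) \<le> y powr p"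
proof (cases "c = 0")
  case False
  define q where "q = p / (p - 1)"
  have q: "1 < q" "1 / p + 1 / q = 1" using p by (auto simp: q_def field_simps)
  have "y * c powr (p - 1) \<le> y powr p / p + (c powr (p - 1)) powr q / q"
    using p q y by (intro Youngs_inequality) auto
  also have "(c powr (p - 1)) powr q = c powr p" using p by (simp add: powr_powr q_def)
  finally have "y * c powr (p - 1) \<le> y powr p / p + c powr p * ((p - 1) / p)"
    by (simp add: q_def)
  then have "p * (y * c powr (p - 1)) \<le> p * (y powr p / p + c powr p * ((p - 1) / p))"
    using p by (intro mult_left_mono) auto
  also have "\<dots> = y powr p + (p - 1) * c powr p" using p by (simp add: field_simps)
  finally have "p * y * c powr (p - 1) \<le> y powr p + (p - 1) * c powr p" by simp
  moreover have "c powr (p - 1) * c = c powr p"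
    using c False by (simp add: powr_mult_base mult.commute)
  ultimately show ?thesis by (simp add: algebra_simps)
qed simp

lemma powr_le_imp_le:
  fixes x y p :: real
  assumes "0 < p" "0 \<le> y" "x powr p \<le> y powr p"
  shows "x \<le> y"
proof (rule ccontr)
  assume "\<not> x \<le> y"
  then have "y powr p < x powr p" using assms(1,2) by (intro powr_less_mono2) auto
  with assms(3) show False by simp
qed

lemma Lp_boundD:
  assumes "Lp_bound M p f K"
  shows "f \<in> borel_measurable M" "integrable M (\<lambda>x. \<bar>f x\<bar> powr p)"
    "(\<integral>x. \<bar>f x\<bar> powr p \<partial>M) \<le> K powr p" "0 \<le> K"
  using assms by (auto simp: Lp_bound_def)

lemma Lp_boundI:
  assumes f: "f \<in> borel_measurable M" and g: "integrable M g"
    and le: "\<And>x. x \<in> space M \<Longrightarrow> \<bar>f x\<bar> powr p \<le> g x" and K: "(\<integral>x. g x \<partial>M) \<le> K powr p" "0 \<le> K"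
  shows "Lp_bound M p f K"
proof -
  have i: "integrable M (\<lambda>x. \<bar>f x\<bar> powr p)"
  proof (rule Bochner_Integration.integrable_bound[OF g])
    show "AE x in M. norm (\<bar>f x\<bar> powr p) \<le> norm (g x)"
      using le by (intro AE_I2) (fastforce intro: order_trans)
  qed (use f in measurable)
  have "(\<integral>x. \<bar>f x\<bar> powr p \<partial>M) \<le> (\<integral>x. g x \<partial>M)"
    using i g le by (rule integral_mono)
  then show ?thesis using f i K by (simp add: Lp_bound_def)
qed

lemma Lp_bound_mono:
  assumes "Lp_bound M p f K" "K \<le> K'" "0 \<le> p"
  shows "Lp_bound M p f K'"
  using assms powr_mono2[of p K K'] by (auto simp: Lp_bound_def)

lemma Lp_bound_integrable:
  assumes "finite_measure M" "Lp_bound M p f K" "1 \<le> p"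
  shows "integrable M f"
proof -
  interpret finite_measure M by fact
  have *: "\<bar>y\<bar> \<le> 1 + \<bar>y\<bar> powr p" for y :: real
  proof (cases "\<bar>y\<bar> \<le> 1")
    case False
    then have "\<bar>y\<bar> powr 1 \<le> \<bar>y\<bar> powr p" using assms(3) by (intro powr_mono) auto
    then show ?thesis by simp
  qed (simp add: add_increasing2)
  show ?thesis
  proof (rule Bochner_Integration.integrable_bound)
    show "integrable M (\<lambda>x. 1 + \<bar>f x\<bar> powr p)"
      using Lp_boundD(2)[OF assms(2)] by auto
    show "AE x in M. norm (f x) \<le> norm (1 + \<bar>f x\<bar> powr p)"
      using * by (simp add: add_nonneg_nonneg)
  qed (rule Lp_boundD(1)[OF assms(2)])
qed

lemma Lp_bound_distr:
  assumes g: "g \<in> M \<rightarrow>\<^sub>M N" and f: "f \<in> borel_measurable N"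
  shows "Lp_bound (distr M N g) p f K \<longleftrightarrow> Lp_bound M p (\<lambda>x. f (g x)) K"
proof -
  have [measurable]: "(\<lambda>x. \<bar>f x\<bar> powr p) \<in> borel_measurable N" using f by measurable
  show ?thesis
    using f measurable_compose[OF g f] integrable_distr_eq[OF g, of "\<lambda>x. \<bar>f x\<bar> powr p"]
      integral_distr[OF g, of "\<lambda>x. \<bar>f x\<bar> powr p"]
    unfolding Lp_bound_def by simp
qed

text \<open>A substitute for Minkowski's inequality: 2^p comes from |f + g| \<le> 2 max(|f|, |g|),
  and the two summands cost a further 2 \<le> 2^p, so the norm bound grows by 4.\<close>

lemma Lp_bound_add:
  assumes p: "1 \<le> p" and f: "Lp_bound M p f K" and g: "Lp_bound M p g K"
  shows "Lp_bound M p (\<lambda>x. f x + g x) (4 * K)"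
proof (rule Lp_boundI)
  have K: "0 \<le> K" using f by (rule Lp_boundD)
  show "(\<lambda>x. f x + g x) \<in> borel_measurable M"
    using Lp_boundD(1)[OF f] Lp_boundD(1)[OF g] by measurable
  show "integrable M (\<lambda>x. 2 powr p * (\<bar>f x\<bar> powr p + \<bar>g x\<bar> powr p))"
    using Lp_boundD(2)[OF f] Lp_boundD(2)[OF g] by auto
  show "\<bar>f x + g x\<bar> powr p \<le> 2 powr p * (\<bar>f x\<bar> powr p + \<bar>g x\<bar> powr p)" for x
  proof -
    let ?m = "max \<bar>f x\<bar> \<bar>g x\<bar>"
    have "\<bar>f x + g x\<bar> powr p \<le> (2 * ?m) powr p"
      using p by (intro powr_mono2) auto
    also have "\<dots> = 2 powr p * ?m powr p" by (simp add: powr_mult)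
    also have "?m powr p \<le> \<bar>f x\<bar> powr p + \<bar>g x\<bar> powr p" by (simp add: max_def)
    finally show ?thesis by simp
  qed
  have "(2::real) powr 1 \<le> 2 powr p" using p by (intro powr_mono) auto
  then have 2: "(2::real) \<le> 2 powr p" by simp
  have "(\<integral>x. 2 powr p * (\<bar>f x\<bar> powr p + \<bar>g x\<bar> powr p) \<partial>M)
      = 2 powr p * ((\<integral>x. \<bar>f x\<bar> powr p \<partial>M) + (\<integral>x. \<bar>g x\<bar> powr p \<partial>M))"
    using Lp_boundD(2)[OF f] Lp_boundD(2)[OF g] by simp
  also have "\<dots> \<le> 2 powr p * (2 * K powr p)"
    using Lp_boundD(3)[OF f] Lp_boundD(3)[OF g] by (intro mult_left_mono) auto
  also have "\<dots> \<le> 2 powr p * (2 powr p * K powr p)"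
    using 2 by (intro mult_left_mono mult_right_mono) auto
  also have "\<dots> = (4 * K) powr p"
    using K by (simp add: powr_mult[symmetric])
  finally show "(\<integral>x. 2 powr p * (\<bar>f x\<bar> powr p + \<bar>g x\<bar> powr p) \<partial>M) \<le> (4 * K) powr p" .
  show "0 \<le> 4 * K" using K by simp
qed

lemma Lp_bound_mult_bounded:
  assumes f: "Lp_bound M p f K" and h: "h \<in> borel_measurable M" "\<And>x. \<bar>h x\<bar> \<le> c" and p: "0 \<le> p"
  shows "Lp_bound M p (\<lambda>x. f x * h x) (c * K)"
proof (rule Lp_boundI)
  have c: "0 \<le> c" using h(2) order_trans[OF abs_ge_zero] by blast
  have K: "0 \<le> K" using f by (rule Lp_boundD)
  show "(\<lambda>x. f x * h x) \<in> borel_measurable M" using Lp_boundD(1)[OF f] h(1) by measurable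
  show "integrable M (\<lambda>x. c powr p * \<bar>f x\<bar> powr p)" using Lp_boundD(2)[OF f] by auto
  show "\<bar>f x * h x\<bar> powr p \<le> c powr p * \<bar>f x\<bar> powr p" for x
  proof -
    have "\<bar>h x\<bar> powr p \<le> c powr p" using h(2)[of x] p by (intro powr_mono2) auto
    then have "\<bar>f x\<bar> powr p * \<bar>h x\<bar> powr p \<le> \<bar>f x\<bar> powr p * c powr p" by (intro mult_left_mono) auto
    then show ?thesis by (simp add: abs_mult powr_mult mult.commute)
  qed
  show "(\<integral>x. c powr p * \<bar>f x\<bar> powr p \<partial>M) \<le> (c * K) powr p"
    using Lp_boundD(3)[OF f] c K by (simp add: powr_mult mult_left_mono)
  show "0 \<le> c * K" using c K by simp
qed

lemma Lp_bound_cmult: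
  assumes "Lp_bound M p f K" "0 \<le> p"
  shows "Lp_bound M p (\<lambda>x. c * f x) (\<bar>c\<bar> * K)"
  using Lp_bound_mult_bounded[OF assms(1), of "\<lambda>_. c" "\<bar>c\<bar>"] assms(2) by (simp add: mult.commute)

lemma Lp_bound_diff:
  assumes p: "1 \<le> p" and f: "Lp_bound M p f K" and g: "Lp_bound M p g K"
  shows "Lp_bound M p (\<lambda>x. f x - g x) (4 * K)"
  using Lp_bound_add[OF p f Lp_bound_cmult[OF g, of "-1", simplified]] p by simp

lemma Lp_bound_const:
  assumes "prob_space M" "\<bar>c\<bar> \<le> K" "0 \<le> p"
  shows "Lp_bound M p (\<lambda>x. c) K"
proof -
  interpret prob_space M by fact
  show ?thesis
    using assms by (intro Lp_boundI[where g = "\<lambda>_. \<bar>c\<bar> powr p"]) (auto simp: prob_space powr_mono2)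
qed

text \<open>The inequality a b \<le> (a^2 + b^2) / 2 with a = |f|^(p/2). For p = 2 + \<delta> the
  product keeps 1 + \<delta>/2 moments, still above 1 as the mixing estimate requires.\<close>

lemma Lp_bound_mult:
  assumes f: "Lp_bound M p f K" and g: "Lp_bound M p g K"
  shows "Lp_bound M (p / 2) (\<lambda>x. f x * g x) (K\<^sup>2)"
proof (rule Lp_boundI)
  show "(\<lambda>x. f x * g x) \<in> borel_measurable M" using Lp_boundD(1)[OF f] Lp_boundD(1)[OF g] by measurable
  show "integrable M (\<lambda>x. (\<bar>f x\<bar> powr p + \<bar>g x\<bar> powr p) / 2)"
    using Lp_boundD(2)[OF f] Lp_boundD(2)[OF g] by auto
  show "\<bar>f x * g x\<bar> powr (p / 2) \<le> (\<bar>f x\<bar> powr p + \<bar>g x\<bar> powr p) / 2" for x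
  proof -
    let ?a = "\<bar>f x\<bar> powr (p / 2)" and ?b = "\<bar>g x\<bar> powr (p / 2)"
    have "0 \<le> (?a - ?b)\<^sup>2" by simp
    then have "?a * ?b \<le> (?a * ?a + ?b * ?b) / 2" by (simp add: power2_eq_square algebra_simps)
    then show ?thesis by (simp add: abs_mult powr_mult powr_add[symmetric])
  qed
  have "(\<integral>x. (\<bar>f x\<bar> powr p + \<bar>g x\<bar> powr p) / 2 \<partial>M) \<le> K powr p"
    using Lp_boundD(2,3)[OF f] Lp_boundD(2,3)[OF g] by simp
  also have "K powr p = (K\<^sup>2) powr (p / 2)"
    using Lp_boundD(4)[OF f] by (simp add: powr_power[symmetric] powr_numeral[symmetric] powr_powr del: powr_numeral)
  finally show "(\<integral>x. (\<bar>f x\<bar> powr p + \<bar>g x\<bar> powr p) / 2 \<partial>M) \<le> (K\<^sup>2) powr (p / 2)" .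
qed simp

lemma Lp_bound_abs_expectation:
  assumes M: "prob_space M" and f: "Lp_bound M p f K" and p: "1 < p"
  shows "(\<integral>x. \<bar>f x\<bar> \<partial>M) powr p \<le> (\<integral>x. \<bar>f x\<bar> powr p \<partial>M)" "\<bar>\<integral>x. f x \<partial>M\<bar> \<le> K"
proof -
  interpret prob_space M by fact
  have i: "integrable M f"
    using Lp_bound_integrable[OF _ f] p finite_measure_axioms by simp
  define m where "m = (\<integral>x. \<bar>f x\<bar> \<partial>M)"
  have m: "0 \<le> m" by (simp add: m_def)
  \<comment> \<open>The tangent is taken at the mean of |f|, so its linear term has expectation
    zero.\<close>
  have "m powr p = (\<integral>x. m powr p + p * m powr (p - 1) * (\<bar>f x\<bar> - m) \<partial>M)"
    using i by (simp add: prob_space m_def)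
  also have "\<dots> \<le> (\<integral>x. \<bar>f x\<bar> powr p \<partial>M)"
    using i Lp_boundD(2)[OF f] powr_tangent[OF p m] by (intro integral_mono) auto
  finally show *: "(\<integral>x. \<bar>f x\<bar> \<partial>M) powr p \<le> (\<integral>x. \<bar>f x\<bar> powr p \<partial>M)" by (simp add: m_def)
  have "m \<le> K"
  proof (rule powr_le_imp_le[of p])
    show "m powr p \<le> K powr p"
      using * Lp_boundD(3)[OF f] unfolding m_def by (rule order_trans)
  qed (use p Lp_boundD(4)[OF f] in auto)
  then show "\<bar>\<integral>x. f x \<partial>M\<bar> \<le> K"
    unfolding m_def by (rule order_trans[OF integral_abs_bound])
qed

text \<open>Convexity instead of repeated addition keeps the bound independent of the number of
  terms; this matters because \<open>hproj\<close> averages over n - 1 indices.\<close>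

lemma Lp_bound_average:
  assumes p: "1 < p" and S: "finite S" "S \<noteq> {}" and f: "\<And>k. k \<in> S \<Longrightarrow> Lp_bound M p (f k) K"
  shows "Lp_bound M p (\<lambda>x. (1 / real (card S)) * (\<Sum>k\<in>S. f k x)) K"
proof (rule Lp_boundI)
  have n: "0 < real (card S)" using S by (simp add: card_gt_0_iff)
  show "(\<lambda>x. (1 / real (card S)) * (\<Sum>k\<in>S. f k x)) \<in> borel_measurable M"
    using Lp_boundD(1)[OF f] by (intro borel_measurable_times borel_measurable_sum) auto
  show "integrable M (\<lambda>x. (1 / real (card S)) * (\<Sum>k\<in>S. \<bar>f k x\<bar> powr p))"
    using Lp_boundD(2)[OF f] by auto
  show "\<bar>(1 / real (card S)) * (\<Sum>k\<in>S. f k x)\<bar> powr p \<le> (1 / real (card S)) * (\<Sum>k\<in>S. \<bar>f k x\<bar> powr p)" for x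
  proof -
    define m where "m = (1 / real (card S)) * (\<Sum>k\<in>S. \<bar>f k x\<bar>)"
    have m: "0 \<le> m" by (simp add: m_def sum_nonneg)
    have sm: "(\<Sum>k\<in>S. \<bar>f k x\<bar>) = real (card S) * m" using n by (simp add: m_def)
    have "\<bar>(1 / real (card S)) * (\<Sum>k\<in>S. f k x)\<bar> \<le> m"
      unfolding m_def abs_mult by (intro mult_mono) auto
    then have "\<bar>(1 / real (card S)) * (\<Sum>k\<in>S. f k x)\<bar> powr p \<le> m powr p"
      using p by (intro powr_mono2) auto
    also have "\<dots> = (1 / real (card S)) * (\<Sum>k\<in>S. m powr p + p * m powr (p - 1) * (\<bar>f k x\<bar> - m))"
      using n by (simp add: sum.distrib sum_distrib_left[symmetric] sum_subtractf sm)
    also have "\<dots> \<le> (1 / real (card S)) * (\<Sum>k\<in>S. \<bar>f k x\<bar> powr p)"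
      using powr_tangent[OF p m] n by (intro mult_left_mono sum_mono) auto
    finally show ?thesis .
  qed
  have "(\<integral>x. (1 / real (card S)) * (\<Sum>k\<in>S. \<bar>f k x\<bar> powr p) \<partial>M)
      = (1 / real (card S)) * (\<Sum>k\<in>S. \<integral>x. \<bar>f k x\<bar> powr p \<partial>M)"
    using Lp_boundD(2)[OF f] by simp
  also have "\<dots> \<le> (1 / real (card S)) * (\<Sum>k\<in>S. K powr p)"
    using Lp_boundD(3)[OF f] by (intro mult_left_mono sum_mono) auto
  also have "\<dots> = K powr p" using n by simp
  finally show "(\<integral>x. (1 / real (card S)) * (\<Sum>k\<in>S. \<bar>f k x\<bar> powr p) \<partial>M) \<le> K powr p" .
  show "0 \<le> K" using Lp_boundD(4)[OF f] S by auto
qed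

lemma Lp_bound_fst:
  assumes "prob_space M" "prob_space N" "Lp_bound M p f K"
  shows "Lp_bound (M \<Otimes>\<^sub>M N) p (\<lambda>z. f (fst z)) K"
proof -
  interpret M: prob_space M by fact
  interpret N: prob_space N by fact
  have "distr (M \<Otimes>\<^sub>M N) M fst = M" by (rule N.distr_pair_fst)
  then show ?thesis
    using Lp_bound_distr[of fst "M \<Otimes>\<^sub>M N" M f p K] assms(3) Lp_boundD(1)[OF assms(3)] by simp
qed

lemma Lp_bound_snd:
  assumes "prob_space M" "prob_space N" "Lp_bound N p f K"
  shows "Lp_bound (M \<Otimes>\<^sub>M N) p (\<lambda>z. f (snd z)) K"
proof -
  interpret M: prob_space M by fact
  interpret N: prob_space N by fact
  interpret P: pair_prob_space N M ..
  have [measurable]: "f \<in> borel_measurable N" using assms(3) by (rule Lp_boundD)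
  have "Lp_bound (N \<Otimes>\<^sub>M M) p (\<lambda>z. f (fst z)) K" by (rule Lp_bound_fst) fact+
  moreover have "N \<Otimes>\<^sub>M M = distr (M \<Otimes>\<^sub>M N) (N \<Otimes>\<^sub>M M) (\<lambda>(x, y). (y, x))"
    by (rule P.distr_pair_swap)
  ultimately show ?thesis
    using Lp_bound_distr[of "\<lambda>(x, y). (y, x)" "M \<Otimes>\<^sub>M N" "N \<Otimes>\<^sub>M M" "\<lambda>z. f (fst z)" p K]
    by (simp add: case_prod_unfold)
qed

text \<open>Jensen's inequality on each slice followed by Fubini. Slices are integrable almost
  everywhere only, hence the almost sure form of the pointwise estimate.\<close>

lemma Lp_bound_partial_expectation:
  assumes M: "prob_space M" and N: "prob_space N" and f: "Lp_bound (M \<Otimes>\<^sub>M N) p (\<lambda>(x, y). f x y) K" and p: "1 < p"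
  shows "Lp_bound N p (\<lambda>y. \<integral>x. f x y \<partial>M) K"
proof -
  interpret M: prob_space M by fact
  interpret N: prob_space N by fact
  interpret P: pair_prob_space M N ..
  have fm[measurable]: "(\<lambda>(x, y). f x y) \<in> borel_measurable (M \<Otimes>\<^sub>M N)" using f by (rule Lp_boundD)
  have fi: "integrable (M \<Otimes>\<^sub>M N) (\<lambda>(x, y). \<bar>f x y\<bar> powr p)"
    using Lp_boundD(2)[OF f] by (simp add: case_prod_unfold)
  have m[measurable]: "(\<lambda>y. \<integral>x. f x y \<partial>M) \<in> borel_measurable N"
  proof (rule M.borel_measurable_lebesgue_integral)
    have "(\<lambda>z. case (snd z, fst z) of (x, y) \<Rightarrow> f x y) \<in> borel_measurable (N \<Otimes>\<^sub>M M)"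
      by (rule measurable_compose[OF _ fm]) simp
    then show "(\<lambda>(y, x). f x y) \<in> borel_measurable (N \<Otimes>\<^sub>M M)" by (simp add: case_prod_unfold)
  qed
  have gi: "integrable N (\<lambda>y. \<integral>x. \<bar>f x y\<bar> powr p \<partial>M)"
    using P.integrable_snd[OF fi] .
  have ae: "AE y in N. \<bar>\<integral>x. f x y \<partial>M\<bar> powr p \<le> (\<integral>x. \<bar>f x y\<bar> powr p \<partial>M)"
    using P.AE_integrable_snd[OF fi] AE_space
  proof eventually_elim
    case (elim y)
    have "Lp_bound M p (\<lambda>x. f x y) ((\<integral>x. \<bar>f x y\<bar> powr p \<partial>M) powr (1 / p))"
      using elim p fm by (auto simp: Lp_bound_def powr_powr integral_nonneg_AE)
    from Lp_bound_abs_expectation(1)[OF M this p]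
    have "(\<integral>x. \<bar>f x y\<bar> \<partial>M) powr p \<le> (\<integral>x. \<bar>f x y\<bar> powr p \<partial>M)" .
    moreover have "\<bar>\<integral>x. f x y \<partial>M\<bar> powr p \<le> (\<integral>x. \<bar>f x y\<bar> \<partial>M) powr p"
      using p by (intro powr_mono2 integral_abs_bound) auto
    ultimately show ?case by linarith
  qed
  have i: "integrable N (\<lambda>y. \<bar>\<integral>x. f x y \<partial>M\<bar> powr p)"
    by (rule Bochner_Integration.integrable_bound[OF gi]) (use ae in \<open>auto elim: eventually_mono\<close>)
  have "(\<integral>y. \<bar>\<integral>x. f x y \<partial>M\<bar> powr p \<partial>N) \<le> (\<integral>y. \<integral>x. \<bar>f x y\<bar> powr p \<partial>M \<partial>N)"
    using i gi ae by (rule integral_mono_AE)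
  also have "\<dots> = (\<integral>z. \<bar>case z of (x, y) \<Rightarrow> f x y\<bar> powr p \<partial>(M \<Otimes>\<^sub>M N))"
    using P.integral_snd[OF fi] by (simp add: case_prod_unfold)
  also have "\<dots> \<le> K powr p" using f by (rule Lp_boundD)
  finally show ?thesis using i m Lp_boundD(4)[OF f] by (simp add: Lp_bound_def)
qed

subsection \<open>Total variation and mixing\<close>

text \<open>Finite unions of measurable rectangles. The label maps take values in \<open>nat\<close> so that two of them
  can be refined to one by \<open>prod_encode\<close>; hence these sets form an algebra.\<close>

definition grid_sets :: "'a measure \<Rightarrow> 'b measure \<Rightarrow> ('a \<times> 'b) set set" where
  "grid_sets N1 N2 = {G. \<exists>(s1 :: 'a \<Rightarrow> nat) (s2 :: 'b \<Rightarrow> nat) P.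
     s1 \<in> N1 \<rightarrow>\<^sub>M count_space UNIV \<and> finite (s1 ` space N1) \<and>
     s2 \<in> N2 \<rightarrow>\<^sub>M count_space UNIV \<and> finite (s2 ` space N2) \<and>
     G = {z \<in> space N1 \<times> space N2. P (s1 (fst z)) (s2 (snd z))}}"

lemma grid_setsI:
  fixes s1 :: "'a \<Rightarrow> nat" and s2 :: "'b \<Rightarrow> nat"
  assumes "s1 \<in> N1 \<rightarrow>\<^sub>M count_space UNIV" "finite (s1 ` space N1)"
    "s2 \<in> N2 \<rightarrow>\<^sub>M count_space UNIV" "finite (s2 ` space N2)"
  shows "{z \<in> space N1 \<times> space N2. P (s1 (fst z)) (s2 (snd z))} \<in> grid_sets N1 N2"
  unfolding grid_sets_def mem_Collect_eq
  by (rule exI[of _ s1], rule exI[of _ s2], rule exI[of _ P]) (intro conjI assms refl)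

lemma grid_sets_measurable: "G \<in> grid_sets N1 N2 \<Longrightarrow> G \<in> sets (N1 \<Otimes>\<^sub>M N2)"
proof -
  assume "G \<in> grid_sets N1 N2"
  then obtain s1 s2 P where [measurable]: "s1 \<in> N1 \<rightarrow>\<^sub>M count_space (UNIV :: nat set)"
      "s2 \<in> N2 \<rightarrow>\<^sub>M count_space (UNIV :: nat set)"
    and G: "G = {z \<in> space N1 \<times> space N2. P (s1 (fst z)) (s2 (snd z))}"
    unfolding grid_sets_def by blast
  have "G = (\<lambda>z. (s1 (fst z), s2 (snd z))) -` {p. P (fst p) (snd p)} \<inter> space (N1 \<Otimes>\<^sub>M N2)"
    by (auto simp: G space_pair_measure)
  also have "\<dots> \<in> sets (N1 \<Otimes>\<^sub>M N2)"
  proof (rule measurable_sets)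
    show "(\<lambda>z. (s1 (fst z), s2 (snd z))) \<in> N1 \<Otimes>\<^sub>M N2 \<rightarrow>\<^sub>M count_space UNIV"
      by (subst pair_measure_countable[symmetric, of UNIV UNIV, simplified]) auto
  qed simp
  finally show ?thesis .
qed

lemma grid_sets_Times:
  assumes "a \<in> sets N1" "b \<in> sets N2"
  shows "a \<times> b \<in> grid_sets N1 N2"
proof -
  have "a \<times> b = {z \<in> space N1 \<times> space N2.
      (if fst z \<in> a then 1 else 0) = (1::nat) \<and> (if snd z \<in> b then 1 else 0) = (1::nat)}"
    using assms[THEN sets.sets_into_space] by (auto split: if_splits)
  also have "\<dots> \<in> grid_sets N1 N2"
    using assms by (intro grid_setsI[where P = "\<lambda>k l. k = 1 \<and> l = 1"])
      (auto intro: finite_subset[of _ "{0, 1}"])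
  finally show ?thesis .
qed

lemma grid_sets_Compl:
  assumes "G \<in> grid_sets N1 N2"
  shows "space N1 \<times> space N2 - G \<in> grid_sets N1 N2"
proof -
  obtain s1 s2 P where s: "s1 \<in> N1 \<rightarrow>\<^sub>M count_space (UNIV :: nat set)" "finite (s1 ` space N1)"
      "s2 \<in> N2 \<rightarrow>\<^sub>M count_space (UNIV :: nat set)" "finite (s2 ` space N2)"
    and G: "G = {z \<in> space N1 \<times> space N2. P (s1 (fst z)) (s2 (snd z))}"
    using assms unfolding grid_sets_def by blast
  have "space N1 \<times> space N2 - G = {z \<in> space N1 \<times> space N2. \<not> P (s1 (fst z)) (s2 (snd z))}"
    by (auto simp: G)
  then show ?thesis using grid_setsI[OF s, of "\<lambda>k l. \<not> P k l"] by simp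
qed

lemma grid_sets_Un:
  assumes "G \<in> grid_sets N1 N2" "G' \<in> grid_sets N1 N2"
  shows "G \<union> G' \<in> grid_sets N1 N2"
proof -
  obtain s1 s2 P where s: "s1 \<in> N1 \<rightarrow>\<^sub>M count_space (UNIV :: nat set)" "finite (s1 ` space N1)"
      "s2 \<in> N2 \<rightarrow>\<^sub>M count_space (UNIV :: nat set)" "finite (s2 ` space N2)"
    and G: "G = {z \<in> space N1 \<times> space N2. P (s1 (fst z)) (s2 (snd z))}"
    using assms(1) unfolding grid_sets_def by blast
  obtain t1 t2 P' where t: "t1 \<in> N1 \<rightarrow>\<^sub>M count_space (UNIV :: nat set)" "finite (t1 ` space N1)"
      "t2 \<in> N2 \<rightarrow>\<^sub>M count_space (UNIV :: nat set)" "finite (t2 ` space N2)"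
    and G': "G' = {z \<in> space N1 \<times> space N2. P' (t1 (fst z)) (t2 (snd z))}"
    using assms(2) unfolding grid_sets_def by blast
  have pm: "(\<lambda>x. prod_encode (u x, v x)) \<in> N \<rightarrow>\<^sub>M count_space UNIV"
      "finite ((\<lambda>x. prod_encode (u x, v x)) ` space N)"
    if [measurable]: "u \<in> N \<rightarrow>\<^sub>M count_space UNIV" "v \<in> N \<rightarrow>\<^sub>M count_space UNIV"
      and "finite (u ` space N)" "finite (v ` space N)" for u v :: "'c \<Rightarrow> nat" and N
  proof -
    have "(\<lambda>x. (u x, v x)) \<in> N \<rightarrow>\<^sub>M count_space UNIV"
      by (subst pair_measure_countable[symmetric, of UNIV UNIV, simplified]) auto
    then show "(\<lambda>x. prod_encode (u x, v x)) \<in> N \<rightarrow>\<^sub>M count_space UNIV"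
      by (rule measurable_compose) simp
    have "(\<lambda>x. prod_encode (u x, v x)) ` space N \<subseteq> prod_encode ` (u ` space N \<times> v ` space N)"
      by auto
    then show "finite ((\<lambda>x. prod_encode (u x, v x)) ` space N)"
      using that(3,4) by (meson finite_SigmaI finite_imageI finite_subset)
  qed
  have "G \<union> G' = {z \<in> space N1 \<times> space N2.
      (\<lambda>k l. P (fst (prod_decode k)) (fst (prod_decode l)) \<or> P' (snd (prod_decode k)) (snd (prod_decode l)))
        (prod_encode (s1 (fst z), t1 (fst z))) (prod_encode (s2 (snd z), t2 (snd z)))}"
    by (auto simp: G G')
  also have "\<dots> \<in> grid_sets N1 N2"
    by (rule grid_setsI[where ?s1.0 = "\<lambda>x. prod_encode (s1 x, t1 x)"
          and ?s2.0 = "\<lambda>x. prod_encode (s2 x, t2 x)"])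
      (intro pm s t)+
  finally show ?thesis .
qed

text \<open>One G has to serve both measures, since the mixing coefficient compares them only on the
  same grid set. The approximable sets contain the rectangles and are closed under complements and
  disjoint countable unions; rectangles being stable under intersection, this reaches the whole
  product \<sigma>-algebra.\<close>

lemma grid_sets_approximation:
  assumes "finite_measure Q1" "finite_measure Q2"
    and sQ: "sets Q1 = sets (N1 \<Otimes>\<^sub>M N2)" "sets Q2 = sets (N1 \<Otimes>\<^sub>M N2)"
    and E: "E \<in> sets (N1 \<Otimes>\<^sub>M N2)" and e: "0 < (e::real)"
  shows "\<exists>G\<in>grid_sets N1 N2. measure Q1 (sym_diff E G) < e \<and> measure Q2 (sym_diff E G) < e"
proof -
  interpret Q1: finite_measure Q1 by fact
  interpret Q2: finite_measure Q2 by fact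
  let ?gen = "{a \<times> b | a b. a \<in> sets N1 \<and> b \<in> sets N2}" and ?\<Omega> = "space N1 \<times> space N2"
  define ap where "ap = (\<lambda>E. \<forall>e>0. \<exists>G\<in>grid_sets N1 N2.
      measure Q1 (sym_diff E G) < e \<and> measure Q2 (sym_diff E G) < (e::real))"
  have gm: "G \<in> sets Q1" "G \<in> sets Q2" if "G \<in> grid_sets N1 N2" for G
    using grid_sets_measurable[OF that] sQ by auto
  have apG: "ap G" if "G \<in> grid_sets N1 N2" for G
    unfolding ap_def using that by (auto intro!: bexI[of _ G])
  have apU: "ap (E \<union> F)"
    if "ap E" "ap F" "E \<in> sets (N1 \<Otimes>\<^sub>M N2)" "F \<in> sets (N1 \<Otimes>\<^sub>M N2)" for E F
    unfolding ap_def
  proof (intro allI impI)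
    fix e :: real assume "0 < e"
    then have e2: "0 < e / 2" by simp
    obtain G where G: "G \<in> grid_sets N1 N2" "measure Q1 (sym_diff E G) < e / 2" "measure Q2 (sym_diff E G) < e / 2"
      using \<open>ap E\<close> e2 unfolding ap_def by blast
    obtain G' where G': "G' \<in> grid_sets N1 N2" "measure Q1 (sym_diff F G') < e / 2" "measure Q2 (sym_diff F G') < e / 2"
      using \<open>ap F\<close> e2 unfolding ap_def by blast
    have *: "measure Q (sym_diff (E \<union> F) (G \<union> G')) < e"
      if "finite_measure Q" "sets Q = sets (N1 \<Otimes>\<^sub>M N2)"
        "measure Q (sym_diff E G) < e / 2" "measure Q (sym_diff F G') < e / 2" for Q
    proof -
      interpret finite_measure Q by fact
      have m: "E \<in> sets Q" "F \<in> sets Q" "G \<in> sets Q" "G' \<in> sets Q"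
        using \<open>E \<in> _\<close> \<open>F \<in> _\<close> grid_sets_measurable[OF G(1)] grid_sets_measurable[OF G'(1)] that(2) by auto
      have "measure Q (sym_diff (E \<union> F) (G \<union> G')) \<le> measure Q (sym_diff E G \<union> sym_diff F G')"
        using m by (intro finite_measure_mono) auto
      also have "\<dots> \<le> measure Q (sym_diff E G) + measure Q (sym_diff F G')"
        using m by (intro measure_subadditive) auto
      finally show ?thesis using that by linarith
    qed
    show "\<exists>G\<in>grid_sets N1 N2. measure Q1 (sym_diff (E \<union> F) G) < e \<and> measure Q2 (sym_diff (E \<union> F) G) < e"
      using *[OF Q1.finite_measure_axioms sQ(1) G(2) G'(2)] *[OF Q2.finite_measure_axioms sQ(2) G(3) G'(3)]
      by (intro bexI[of _ "G \<union> G'"] grid_sets_Un G G') auto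
  qed
  have Es: "E \<in> sigma_sets ?\<Omega> ?gen"
    using E by (simp add: sets_pair_measure)
  have "ap E"
    using Int_stable_pair_measure_generator[of N1 N2] pair_measure_closed[of N1 N2] Es
  proof (induction rule: sigma_sets_induct_disjoint)
    case (basic A)
    then show ?case using apG grid_sets_Times by blast
  next
    case empty
    have "({} :: 'a set) \<times> ({} :: 'b set) \<in> grid_sets N1 N2"
      by (rule grid_sets_Times) auto
    then show ?case using apG by simp
  next
    case (compl A)
    have A: "A \<subseteq> ?\<Omega>"
      using compl(1) sets.sets_into_space[of A "N1 \<Otimes>\<^sub>M N2"]
      by (simp add: sets_pair_measure space_pair_measure)
    show ?case unfolding ap_def
    proof (intro allI impI)
      fix e :: real assume "0 < e"
      then obtain G where G: "G \<in> grid_sets N1 N2" "measure Q1 (sym_diff A G) < e" "measure Q2 (sym_diff A G) < e"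
        using compl(2) unfolding ap_def by blast
      have "G \<subseteq> ?\<Omega>" using G(1) unfolding grid_sets_def by auto
      then have "sym_diff (?\<Omega> - A) (?\<Omega> - G) = sym_diff A G" using A by blast
      then show "\<exists>G\<in>grid_sets N1 N2. measure Q1 (sym_diff (?\<Omega> - A) G) < e \<and> measure Q2 (sym_diff (?\<Omega> - A) G) < e"
        using G grid_sets_Compl[OF G(1)] by (intro bexI[of _ "?\<Omega> - G"]) auto
    qed
  next
    case (union A)
    have Am: "A i \<in> sets (N1 \<Otimes>\<^sub>M N2)" for i
      using union(2) by (auto simp: sets_pair_measure)
    have fin: "ap (\<Union>i<n. A i)" for n
    proof (induction n)
      case 0
      have "({} :: 'a set) \<times> ({} :: 'b set) \<in> grid_sets N1 N2"
        by (rule grid_sets_Times) auto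
      then show ?case using apG by simp
    next
      case (Suc n)
      have "(\<Union>i<Suc n. A i) = (\<Union>i<n. A i) \<union> A n" by (auto simp: less_Suc_eq)
      then show ?case using apU[OF Suc union(3)[of n]] Am by auto
    qed
    show ?case unfolding ap_def
    proof (intro allI impI)
      fix e :: real assume e: "0 < e"
      \<comment> \<open>Continuity from above: the remainders decrease to the empty set, so finitely
        many sets suffice up to half of the error, with a common \<open>n\<close> for both
        measures.\<close>
      have tail: "\<forall>\<^sub>F n in sequentially. measure Q ((\<Union>i. A i) - (\<Union>i<n. A i)) < e / 2"
        if "finite_measure Q" "sets Q = sets (N1 \<Otimes>\<^sub>M N2)" for Q
      proof -
        interpret finite_measure Q by fact
        have "(\<lambda>n. measure Q ((\<Union>i. A i) - (\<Union>i<n. A i))) \<longlonglongrightarrow> measure Q (\<Inter>n. (\<Union>i. A i) - (\<Union>i<n. A i))"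
          using Am that(2) by (intro finite_Lim_measure_decseq) (auto simp: decseq_def)
        moreover have "(\<Inter>n. (\<Union>i. A i) - (\<Union>i<n. A i)) = {}" by auto
        ultimately have "(\<lambda>n. measure Q ((\<Union>i. A i) - (\<Union>i<n. A i))) \<longlonglongrightarrow> 0"
          by (metis measure_empty)
        then show ?thesis using e by (intro order_tendstoD(2)) auto
      qed
      obtain n where n: "measure Q1 ((\<Union>i. A i) - (\<Union>i<n. A i)) < e / 2"
          "measure Q2 ((\<Union>i. A i) - (\<Union>i<n. A i)) < e / 2"
        using eventually_happens[OF eventually_conj[OF tail[OF Q1.finite_measure_axioms sQ(1)]
              tail[OF Q2.finite_measure_axioms sQ(2)]]] by auto
      obtain G where G: "G \<in> grid_sets N1 N2" "measure Q1 (sym_diff (\<Union>i<n. A i) G) < e / 2"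
          "measure Q2 (sym_diff (\<Union>i<n. A i) G) < e / 2"
        using fin[of n] e unfolding ap_def by (meson half_gt_zero)
      have *: "measure Q (sym_diff (\<Union>i. A i) G) < e"
        if "finite_measure Q" "sets Q = sets (N1 \<Otimes>\<^sub>M N2)"
          "measure Q ((\<Union>i. A i) - (\<Union>i<n. A i)) < e / 2" "measure Q (sym_diff (\<Union>i<n. A i) G) < e / 2" for Q
      proof -
        interpret finite_measure Q by fact
        have m: "(\<Union>i. A i) \<in> sets Q" "(\<Union>i<n. A i) \<in> sets Q" "G \<in> sets Q"
          using Am grid_sets_measurable[OF G(1)] that(2) by auto
        have "measure Q (sym_diff (\<Union>i. A i) G)
            \<le> measure Q (((\<Union>i. A i) - (\<Union>i<n. A i)) \<union> sym_diff (\<Union>i<n. A i) G)"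
          using m by (intro finite_measure_mono) auto
        also have "\<dots> \<le> measure Q ((\<Union>i. A i) - (\<Union>i<n. A i)) + measure Q (sym_diff (\<Union>i<n. A i) G)"
          using m by (intro measure_subadditive) auto
        finally show ?thesis using that by linarith
      qed
      show "\<exists>G\<in>grid_sets N1 N2. measure Q1 (sym_diff (\<Union>(range A)) G) < e \<and> measure Q2 (sym_diff (\<Union>(range A)) G) < e"
        using *[OF Q1.finite_measure_axioms sQ(1) n(1) G(2)] *[OF Q2.finite_measure_axioms sQ(2) n(2) G(3)] G(1)
        by blast
    qed
  qed
  then show ?thesis using e unfolding ap_def by blast
qed

section \<open>From finite partitions to total variation\<close>

lemma beta_mix_ge_partition:
  assumes "prob_space M" "F1 \<subseteq> sets M" "F2 \<subseteq> sets M"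
    and "finite_partition M F1 A" "finite_partition M F2 B"
  shows "(\<Sum>a\<in>A. \<Sum>b\<in>B. \<bar>measure M (a \<inter> b) - measure M a * measure M b\<bar>) \<le> 2 * beta_mix M F1 F2"
proof -
  interpret prob_space M by fact
  have sub: "(\<Sum>b\<in>B. measure M (a \<inter> b)) \<le> 1"
    if "finite_partition M F2 B" "a \<in> sets M" for a B
  proof -
    have B: "finite B" "B \<subseteq> sets M" "disjoint B"
      using that assms(3) by (auto simp: finite_partition_def)
    have "(\<Sum>b\<in>B. measure M (a \<inter> b)) = measure M (\<Union>b\<in>B. a \<inter> b)"
      using B that(2) by (intro finite_measure_finite_Union[symmetric])
        (auto simp: disjoint_family_on_def disjoint_def)
    also have "\<dots> \<le> 1" by simp
    finally show ?thesis .
  qed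
  \<comment> \<open>The supremum in \<open>beta_mix\<close> is taken in the reals, so a bound over
    all pairs of partitions is required before a single pair can be compared with it.\<close>
  have sub1: "(\<Sum>a\<in>A. \<Sum>b\<in>B. \<bar>measure M (a \<inter> b) - measure M a * measure M b\<bar>) \<le> 2"
    if A: "finite_partition M F1 A" and B: "finite_partition M F2 B" for A B
  proof -
    have Am: "finite A" "A \<subseteq> sets M" "disjoint A"
      using A assms(2) by (auto simp: finite_partition_def)
    have Bm: "finite B" "B \<subseteq> sets M" "disjoint B" "\<Union>B = space M"
      using B assms(3) by (auto simp: finite_partition_def)
    have "(\<Sum>b\<in>B. \<bar>measure M (a \<inter> b) - measure M a * measure M b\<bar>) \<le> 2 * measure M a" if "a \<in> A" for a
    proof -
      have a: "a \<in> sets M" using that Am by auto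
      have "(\<Sum>b\<in>B. \<bar>measure M (a \<inter> b) - measure M a * measure M b\<bar>)
          \<le> (\<Sum>b\<in>B. measure M (a \<inter> b) + measure M a * measure M b)"
        by (intro sum_mono) (simp add: abs_le_iff)
      also have "\<dots> = measure M (\<Union>b\<in>B. a \<inter> b) + measure M a * (\<Sum>b\<in>B. measure M (space M \<inter> b))"
        using Bm a
        by (subst finite_measure_finite_Union)
          (auto simp: disjoint_family_on_def disjoint_def sum.distrib sum_distrib_left
                intro!: sum.cong arg_cong2[where f = "(*)"] arg_cong[where f = "measure M"] dest: sets.sets_into_space)
      also have "\<dots> \<le> measure M a + measure M a * 1"
        using sub[OF B, of "space M"] a Bm by (intro add_mono mult_left_mono finite_measure_mono) auto
      finally show ?thesis by simp
    qed
    then have "(\<Sum>a\<in>A. \<Sum>b\<in>B. \<bar>measure M (a \<inter> b) - measure M a * measure M b\<bar>) \<le> (\<Sum>a\<in>A. 2 * measure M a)"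
      by (rule sum_mono)
    also have "\<dots> = 2 * measure M (\<Union>a\<in>A. a)"
      using Am by (subst finite_measure_finite_Union)
        (auto simp: disjoint_family_on_def disjoint_def sum_distrib_left)
    also have "\<dots> \<le> 2" by simp
    finally show ?thesis .
  qed
  have "1 / 2 * (\<Sum>a\<in>A. \<Sum>b\<in>B. \<bar>measure M (a \<inter> b) - measure M a * measure M b\<bar>) \<le> beta_mix M F1 F2"
    unfolding beta_mix_def
  proof (rule cSUP_upper2[where x = "(A, B)"])
    show "bdd_above ((\<lambda>AB. 1 / 2 * (\<Sum>a\<in>fst AB. \<Sum>b\<in>snd AB. \<bar>measure M (a \<inter> b) - measure M a * measure M b\<bar>)) `
        {(A, B). finite_partition M F1 A \<and> finite_partition M F2 B})"
      using sub1 by (intro bdd_aboveI2[where M = 1]) fastforce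
  qed (use assms in auto)
  then show ?thesis by simp
qed

lemma beta_mix_nonneg:
  assumes "prob_space M" "F1 \<subseteq> sets M" "F2 \<subseteq> sets M" "space M \<in> F1" "space M \<in> F2"
  shows "0 \<le> beta_mix M F1 F2"
proof -
  interpret prob_space M by fact
  have "finite_partition M F1 {space M}" "finite_partition M F2 {space M}"
    using assms by (auto simp: finite_partition_def)
  from beta_mix_ge_partition[OF assms(1-3) this] show ?thesis by (simp add: prob_space)
qed

text \<open>The level sets of the two labels form finite partitions. Along the diagonal G is a
  disjoint union of intersections of cells, in the product space the union of the corresponding
  rectangles. Both measures are thus sums over the same label pairs, and their difference is part of
  the sum in \<open>beta_mix\<close>.\<close>

lemma beta_mix_grid:
  assumes M: "prob_space M" and sub: "sets N1 \<subseteq> sets M" "sets N2 \<subseteq> sets M"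
    and sp: "space N1 = space M" "space N2 = space M"
    and G: "G \<in> grid_sets N1 N2"
  shows "\<bar>measure M {\<omega>\<in>space M. (\<omega>, \<omega>) \<in> G} - measure (M \<Otimes>\<^sub>M M) G\<bar>
      \<le> 2 * beta_mix M (sets N1) (sets N2)"
proof -
  interpret prob_space M by fact
  interpret PP: pair_prob_space M M ..
  obtain s1 s2 P where s: "s1 \<in> N1 \<rightarrow>\<^sub>M count_space (UNIV :: nat set)" "finite (s1 ` space N1)"
      "s2 \<in> N2 \<rightarrow>\<^sub>M count_space (UNIV :: nat set)" "finite (s2 ` space N2)"
    and G: "G = {z \<in> space N1 \<times> space N2. P (s1 (fst z)) (s2 (snd z))}"
    using G unfolding grid_sets_def by blast
  define R1 where "R1 = s1 ` space M"
  define R2 where "R2 = s2 ` space M"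
  have fR: "finite R1" "finite R2" using s sp by (simp_all add: R1_def R2_def)
  define A where "A = (\<lambda>k. s1 -` {k} \<inter> space M)"
  define B where "B = (\<lambda>k. s2 -` {k} \<inter> space M)"
  have A1: "A k \<in> sets N1" and B1: "B k \<in> sets N2" for k
    using measurable_sets[OF s(1), of "{k}"] measurable_sets[OF s(3), of "{k}"] sp by (simp_all add: A_def B_def)
  have Am[measurable]: "A k \<in> sets M" and Bm[measurable]: "B k \<in> sets M" for k
    using A1 B1 sub by auto
  have pA: "finite_partition M (sets N1) (A ` R1)"
    unfolding finite_partition_def using A1 fR by (auto simp: disjoint_def A_def R1_def)
  have pB: "finite_partition M (sets N2) (B ` R2)"
    unfolding finite_partition_def using B1 fR by (auto simp: disjoint_def B_def R2_def)
  \<comment> \<open>Only attained labels occur in \<open>R1\<close> and \<open>R2\<close>, so cells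
    are nonempty and distinct labels have distinct cells; sums over labels can be reindexed by
    cells.\<close>
  have iA: "inj_on A R1" and iB: "inj_on B R2"
    by (auto simp: inj_on_def A_def R1_def B_def R2_def)
  define S where "S = {(k, l) \<in> R1 \<times> R2. P k l}"
  have fS: "finite S" using fR unfolding S_def by (rule_tac finite_subset[of _ "R1 \<times> R2"]) auto
  have "{\<omega>\<in>space M. (\<omega>, \<omega>) \<in> G} = (\<Union>(k, l)\<in>S. A k \<inter> B l)"
    by (auto simp: G sp S_def A_def B_def R1_def R2_def)
  also have "measure M \<dots> = (\<Sum>(k, l)\<in>S. measure M (A k \<inter> B l))"
    unfolding case_prod_unfold
  proof (rule finite_measure_finite_Union)
    show "disjoint_family_on (\<lambda>p. A (fst p) \<inter> B (snd p)) S"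
      by (auto simp: disjoint_family_on_def A_def B_def)
  qed (use fS in auto)
  finally have m1: "measure M {\<omega>\<in>space M. (\<omega>, \<omega>) \<in> G} = (\<Sum>(k, l)\<in>S. measure M (A k \<inter> B l))" .
  have "G = (\<Union>(k, l)\<in>S. A k \<times> B l)"
    by (fastforce simp: G sp S_def A_def B_def R1_def R2_def)
  also have "measure (M \<Otimes>\<^sub>M M) \<dots> = (\<Sum>(k, l)\<in>S. measure (M \<Otimes>\<^sub>M M) (A k \<times> B l))"
    unfolding case_prod_unfold
  proof (rule PP.finite_measure_finite_Union)
    show "disjoint_family_on (\<lambda>p. A (fst p) \<times> B (snd p)) S"
      by (auto simp: disjoint_family_on_def A_def B_def)
  qed (use fS in auto)
  also have "\<dots> = (\<Sum>(k, l)\<in>S. measure M (A k) * measure M (B l))"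
    by (intro sum.cong refl) (auto simp: measure_def emeasure_pair_measure_Times enn2real_mult)
  finally have m2: "measure (M \<Otimes>\<^sub>M M) G = (\<Sum>(k, l)\<in>S. measure M (A k) * measure M (B l))" .
  have "\<bar>measure M {\<omega>\<in>space M. (\<omega>, \<omega>) \<in> G} - measure (M \<Otimes>\<^sub>M M) G\<bar>
      \<le> (\<Sum>(k, l)\<in>S. \<bar>measure M (A k \<inter> B l) - measure M (A k) * measure M (B l)\<bar>)"
    unfolding m1 m2 case_prod_unfold sum_subtractf[symmetric] by (rule sum_abs)
  also have "\<dots> \<le> (\<Sum>(k, l)\<in>R1 \<times> R2. \<bar>measure M (A k \<inter> B l) - measure M (A k) * measure M (B l)\<bar>)"
    using fR by (intro sum_mono2) (auto simp: S_def)
  also have "\<dots> = (\<Sum>a\<in>A ` R1. \<Sum>b\<in>B ` R2. \<bar>measure M (a \<inter> b) - measure M a * measure M b\<bar>)"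
    by (simp add: sum.cartesian_product[symmetric] sum.reindex[OF iA] sum.reindex[OF iB])
  also have "\<dots> \<le> 2 * beta_mix M (sets N1) (sets N2)"
    by (rule beta_mix_ge_partition[OF M sub pA pB])
  finally show ?thesis .
qed

text \<open>The diagonal image of \<open>M\<close> in \<open>N1 \<Otimes>\<^sub>M N2\<close> plays the role of the joint law, so that below a
  function of both blocks of variables need not be a product.\<close>

lemma beta_mix_total_variation:
  assumes M: "prob_space M" and sub: "sets N1 \<subseteq> sets M" "sets N2 \<subseteq> sets M"
    and sp: "space N1 = space M" "space N2 = space M"
    and E: "E \<in> sets (N1 \<Otimes>\<^sub>M N2)"
  shows "\<bar>measure (distr M (N1 \<Otimes>\<^sub>M N2) (\<lambda>\<omega>. (\<omega>, \<omega>))) E - measure (distr (M \<Otimes>\<^sub>M M) (N1 \<Otimes>\<^sub>M N2) (\<lambda>z. z)) E\<bar>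
      \<le> 2 * beta_mix M (sets N1) (sets N2)"
proof (rule field_le_epsilon)
  fix e :: real assume "0 < e"
  then have e2: "0 < e / 2" by simp
  interpret prob_space M by fact
  interpret PP: pair_prob_space M M ..
  have id1: "(\<lambda>x. x) \<in> M \<rightarrow>\<^sub>M N1" and id2: "(\<lambda>x. x) \<in> M \<rightarrow>\<^sub>M N2"
    using sub sp by (auto simp: measurable_def intro: sets.Int_space_eq2[THEN ssubst])
  have dm[measurable]: "(\<lambda>\<omega>. (\<omega>, \<omega>)) \<in> M \<rightarrow>\<^sub>M N1 \<Otimes>\<^sub>M N2"
    using id1 id2 by (rule measurable_Pair)
  have pm[measurable]: "(\<lambda>z. z) \<in> M \<Otimes>\<^sub>M M \<rightarrow>\<^sub>M N1 \<Otimes>\<^sub>M N2"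
    using measurable_Pair[OF measurable_compose[OF measurable_fst id1] measurable_compose[OF measurable_snd id2]]
    by simp
  let ?Q1 = "distr M (N1 \<Otimes>\<^sub>M N2) (\<lambda>\<omega>. (\<omega>, \<omega>))"
  let ?Q2 = "distr (M \<Otimes>\<^sub>M M) (N1 \<Otimes>\<^sub>M N2) (\<lambda>z. z)"
  interpret Q1: prob_space ?Q1 by (rule prob_space_distr) (rule dm)
  interpret Q2: prob_space ?Q2 by (rule PP.prob_space_distr) (rule pm)
  obtain G where G: "G \<in> grid_sets N1 N2" "measure ?Q1 (sym_diff E G) < e / 2" "measure ?Q2 (sym_diff E G) < e / 2"
    using grid_sets_approximation[OF Q1.finite_measure_axioms Q2.finite_measure_axioms _ _ E e2] by auto
  have Gm: "G \<in> sets (N1 \<Otimes>\<^sub>M N2)" by (rule grid_sets_measurable) (rule G)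
  have *: "\<bar>measure Q E - measure Q G\<bar> \<le> measure Q (sym_diff E G)"
    if "finite_measure Q" "sets Q = sets (N1 \<Otimes>\<^sub>M N2)" for Q
  proof -
    interpret finite_measure Q by fact
    have m: "E \<in> sets Q" "G \<in> sets Q" using E Gm that by auto
    have "measure Q E \<le> measure Q (G \<union> sym_diff E G)" "measure Q G \<le> measure Q (E \<union> sym_diff E G)"
      using m by (auto intro!: finite_measure_mono)
    moreover have "measure Q (G \<union> sym_diff E G) \<le> measure Q G + measure Q (sym_diff E G)"
        "measure Q (E \<union> sym_diff E G) \<le> measure Q E + measure Q (sym_diff E G)"
      using m by (auto intro!: measure_subadditive)
    ultimately show ?thesis by linarith
  qed
  have "(\<lambda>\<omega>. (\<omega>, \<omega>)) -` G \<inter> space M = {\<omega>\<in>space M. (\<omega>, \<omega>) \<in> G}" by auto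
  then have 1: "measure ?Q1 G = measure M {\<omega>\<in>space M. (\<omega>, \<omega>) \<in> G}"
    using Gm by (simp add: measure_distr)
  have "G \<subseteq> space (M \<Otimes>\<^sub>M M)"
    using sets.sets_into_space[OF Gm] sp by (simp add: space_pair_measure)
  then have 2: "measure ?Q2 G = measure (M \<Otimes>\<^sub>M M) G"
    using Gm by (simp add: measure_distr Int_absorb2)
  show "\<bar>measure ?Q1 E - measure ?Q2 E\<bar> \<le> 2 * beta_mix M (sets N1) (sets N2) + e"
    using beta_mix_grid[OF M sub sp G(1)] *[OF Q1.finite_measure_axioms] *[OF Q2.finite_measure_axioms] G(2,3)
    unfolding 1 2 by auto
qed

text \<open>A function with values in \<open>[0, 1]\<close> is uniformly close to an average of indicators of its level sets.\<close>

lemma total_variation_integral_unit: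
  fixes f :: "'a \<Rightarrow> real"
  assumes Q: "prob_space Q1" "prob_space Q2" and sQ: "sets Q1 = sets Q2"
    and tv: "\<And>E. E \<in> sets Q1 \<Longrightarrow> \<bar>measure Q1 E - measure Q2 E\<bar> \<le> t"
    and f: "f \<in> borel_measurable Q1" and b: "\<And>x. 0 \<le> f x" "\<And>x. f x \<le> 1"
  shows "\<bar>(\<integral>x. f x \<partial>Q1) - (\<integral>x. f x \<partial>Q2)\<bar> \<le> t"
proof (rule field_le_epsilon)
  fix e :: real assume e: "0 < e"
  obtain k :: nat where k: "1 / (e / 2) < real k" using reals_Archimedean2 by blast
  then have k0: "0 < real k" using e by (smt (verit) divide_pos_pos half_gt_zero)
  then have ke: "1 / real k < e / 2" using k e by (simp add: field_simps)
  \<comment> \<open>The number of j in 1..k with j \<le> k f(x) is the floor of k f(x). So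
    \<open>s\<close> is f rounded down to a multiple of 1 / k, and its integral is an average of
    measures of the sets \<open>D j\<close>.\<close>
  define D where "D = (\<lambda>j::nat. {x \<in> space Q1. real j \<le> real k * f x})"
  have D[measurable]: "D j \<in> sets Q1" for j unfolding D_def using f by measurable
  have sp: "space Q1 = space Q2" using sQ by (rule sets_eq_imp_space_eq)
  define s where "s = (\<lambda>x. (1 / real k) * (\<Sum>j = 1..k. indicator (D j) x :: real))"
  have s: "0 \<le> f x - s x" "f x - s x \<le> 1 / real k" if "x \<in> space Q1" for x
  proof -
    have y: "0 \<le> real k * f x" "real k * f x \<le> real k"
      using b[of x] k0 by (auto simp: mult_left_le)
    have "(\<Sum>j = 1..k. indicator (D j) x :: real) = real (card {j \<in> {1..k}. real j \<le> real k * f x})"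
      using that by (simp add: D_def indicator_def sum.If_cases Int_def)
    also have "{j \<in> {1..k}. real j \<le> real k * f x} = {1..nat \<lfloor>real k * f x\<rfloor>}"
      using y by (auto simp: le_nat_floor le_nat_iff le_floor_iff)
    finally have eq: "(\<Sum>j = 1..k. indicator (D j) x :: real) = of_int \<lfloor>real k * f x\<rfloor>"
      using y by simp
    have "real k * (f x - s x) = real k * f x - of_int \<lfloor>real k * f x\<rfloor>"
      unfolding s_def eq using k0 by (simp add: field_simps)
    then have "0 \<le> real k * (f x - s x)" "real k * (f x - s x) \<le> 1"
      by linarith+
    then show "0 \<le> f x - s x" "f x - s x \<le> 1 / real k"
      using k0 by (simp_all add: zero_le_mult_iff field_simps)
  qed
  have *: "\<bar>(\<integral>x. f x \<partial>Q) - (1 / real k) * (\<Sum>j = 1..k. measure Q (D j))\<bar> \<le> e / 2"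
    if "prob_space Q" "sets Q = sets Q1" for Q
  proof -
    interpret prob_space Q by fact
    have [measurable]: "D j \<in> sets Q" for j using D that(2) by simp
    have [measurable]: "f \<in> borel_measurable Q" using f that(2) by (simp cong: measurable_cong_sets)
    have spQ: "space Q = space Q1" using that(2) by (rule sets_eq_imp_space_eq)
    have fi: "integrable Q f"
      using b by (intro integrable_const_bound[of _ 1]) auto
    have ii: "integrable Q (indicat_real (D j))" "(\<integral>x. indicat_real (D j) x \<partial>Q) = measure Q (D j)" for j
      using sets.sets_into_space[of "D j" Q] by (auto simp: emeasure_eq_measure Int_absorb2)
    have si: "integrable Q s"
      unfolding s_def by (intro integrable_mult_right Bochner_Integration.integrable_sum ii)
    have "(\<integral>x. s x \<partial>Q) = (1 / real k) * (\<Sum>j = 1..k. measure Q (D j))"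
      unfolding s_def integral_mult_right_zero by (simp add: Bochner_Integration.integral_sum ii)
    moreover have "\<bar>(\<integral>x. f x - s x \<partial>Q)\<bar> \<le> (\<integral>x. 1 / real k \<partial>Q)"
      using fi si s spQ by (intro order_trans[OF integral_abs_bound] integral_mono) auto
    ultimately show ?thesis using fi si ke by (simp add: prob_space)
  qed
  have "\<bar>(1 / real k) * (\<Sum>j = 1..k. measure Q1 (D j)) - (1 / real k) * (\<Sum>j = 1..k. measure Q2 (D j))\<bar>
      = (1 / real k) * \<bar>\<Sum>j = 1..k. measure Q1 (D j) - measure Q2 (D j)\<bar>"
    unfolding sum_subtractf right_diff_distrib[symmetric] abs_mult using k0 by simp
  also have "\<dots> \<le> (1 / real k) * (\<Sum>j = 1..k. t)"
    using tv[OF D] by (intro mult_left_mono order_trans[OF sum_abs] sum_mono) auto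
  also have "\<dots> = t" using k0 by simp
  finally show "\<bar>(\<integral>x. f x \<partial>Q1) - (\<integral>x. f x \<partial>Q2)\<bar> \<le> t + e"
    using *[OF Q(1) refl] *[OF Q(2) sQ[symmetric]] by linarith
qed

text \<open>An affine map carries [-L, L] to the unit interval; undoing it costs the length 2
  L.\<close>

lemma total_variation_integral_bounded:
  fixes f :: "'a \<Rightarrow> real"
  assumes Q: "prob_space Q1" "prob_space Q2" and sQ: "sets Q1 = sets Q2"
    and tv: "\<And>E. E \<in> sets Q1 \<Longrightarrow> \<bar>measure Q1 E - measure Q2 E\<bar> \<le> t"
    and f[measurable]: "f \<in> borel_measurable Q1" and b: "\<And>x. \<bar>f x\<bar> \<le> L" and L: "0 < L"
  shows "\<bar>(\<integral>x. f x \<partial>Q1) - (\<integral>x. f x \<partial>Q2)\<bar> \<le> 2 * L * t"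
proof -
  interpret Q1: prob_space Q1 by fact
  interpret Q2: prob_space Q2 by fact
  have f2[measurable]: "f \<in> borel_measurable Q2" using f sQ by (simp cong: measurable_cong_sets)
  have i: "integrable Q1 f" "integrable Q2 f"
    using b by (auto intro!: Q1.integrable_const_bound[of _ L] Q2.integrable_const_bound[of _ L])
  have "\<bar>(\<integral>x. (f x + L) / (2 * L) \<partial>Q1) - (\<integral>x. (f x + L) / (2 * L) \<partial>Q2)\<bar> \<le> t"
  proof (rule total_variation_integral_unit[OF Q sQ tv])
    fix x show "0 \<le> (f x + L) / (2 * L)" "(f x + L) / (2 * L) \<le> 1"
      using b[of x] L by (auto simp: abs_le_iff)
  qed auto
  moreover have "(\<integral>x. (f x + L) / (2 * L) \<partial>Q1) - (\<integral>x. (f x + L) / (2 * L) \<partial>Q2)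
      = ((\<integral>x. f x \<partial>Q1) - (\<integral>x. f x \<partial>Q2)) / (2 * L)"
    using i by (simp add: Q1.prob_space[simplified] Q2.prob_space[simplified] diff_divide_distrib add_divide_distrib)
  ultimately have "\<bar>((\<integral>x. f x \<partial>Q1) - (\<integral>x. f x \<partial>Q2)) / (2 * L)\<bar> \<le> t" by simp
  then show ?thesis using L by (simp add: abs_divide field_simps)
qed

text \<open>Beyond L the error is at most |y| = |y|^(1 - p) |y|^p, and the exponent 1 - p is
  negative.\<close>

lemma truncation_error:
  fixes y L p :: real
  assumes p: "1 < p" and L: "0 < L"
  shows "\<bar>y - max (- L) (min L y)\<bar> \<le> L powr (1 - p) * \<bar>y\<bar> powr p"
proof (cases "\<bar>y\<bar> \<le> L")
  case True
  then have "max (- L) (min L y) = y" by (auto simp: abs_le_iff)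
  then show ?thesis by simp
next
  case False
  have "\<bar>y - max (- L) (min L y)\<bar> \<le> \<bar>y\<bar>" using L by (auto simp: max_def min_def)
  also have "\<dots> = \<bar>y\<bar> powr (1 - p) * \<bar>y\<bar> powr p"
    using False L by (simp add: powr_add[symmetric])
  also have "\<dots> \<le> L powr (1 - p) * \<bar>y\<bar> powr p"
    using False L p by (intro mult_right_mono powr_mono2') auto
  finally show ?thesis .
qed

lemma total_variation_integral_Lp:
  fixes f :: "'a \<Rightarrow> real"
  assumes Q: "prob_space Q1" "prob_space Q2" and sQ: "sets Q1 = sets Q2"
    and tv: "\<And>E. E \<in> sets Q1 \<Longrightarrow> \<bar>measure Q1 E - measure Q2 E\<bar> \<le> t"
    and p: "1 < p" and f: "Lp_bound Q1 p f K" "Lp_bound Q2 p f K"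
  shows "\<bar>(\<integral>x. f x \<partial>Q1) - (\<integral>x. f x \<partial>Q2)\<bar> \<le> 4 * K * t powr (1 - 1 / p)"
proof -
  interpret Q1: prob_space Q1 by fact
  interpret Q2: prob_space Q2 by fact
  have t: "0 \<le> t" using tv[of "{}"] by simp
  have K: "0 \<le> K" using f(1) by (rule Lp_boundD)
  have fm[measurable]: "f \<in> borel_measurable Q1" "f \<in> borel_measurable Q2"
    using f by (auto dest: Lp_boundD)
  have fi: "integrable Q1 f" "integrable Q2 f"
    using Lp_bound_integrable[OF Q1.finite_measure_axioms f(1)]
      Lp_bound_integrable[OF Q2.finite_measure_axioms f(2)] p by auto
  have pos: "\<bar>(\<integral>x. f x \<partial>Q1) - (\<integral>x. f x \<partial>Q2)\<bar> \<le> 4 * K' * t' powr (1 - 1 / p)"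
    if K': "0 < K'" "K \<le> K'" and t': "0 < t'" "t \<le> t'" for K' t'
  proof -
    \<comment> \<open>This level balances the two errors: the bounded part and the tails each
      contribute 2 K' t'^(1 - 1/p). It presupposes positive \<open>K'\<close> and \<open>t'\<close>;
      the general case follows by letting e decrease to 0 in K + e and t + e, where positivity of 1
      - 1/p gives continuity even at t = 0.\<close>
    define L where "L = K' * t' powr (- 1 / p)"
    have L: "0 < L" using K' t' by (simp add: L_def)
    let ?T = "\<lambda>x. max (- L) (min L (f x))"
    have tr: "\<bar>(\<integral>x. f x \<partial>N) - (\<integral>x. ?T x \<partial>N)\<bar> \<le> L powr (1 - p) * K' powr p"
      if "prob_space N" "Lp_bound N p f K" "integrable N f" for N
    proof -
      interpret prob_space N by fact
      have [measurable]: "f \<in> borel_measurable N" using that(2) by (rule Lp_boundD)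
      have Ti: "integrable N ?T"
        using L by (intro integrable_const_bound[of _ L]) (auto simp: abs_le_iff)
      have "\<bar>(\<integral>x. f x \<partial>N) - (\<integral>x. ?T x \<partial>N)\<bar> = \<bar>\<integral>x. f x - ?T x \<partial>N\<bar>"
        using that(3) Ti by simp
      also have "\<dots> \<le> (\<integral>x. L powr (1 - p) * \<bar>f x\<bar> powr p \<partial>N)"
        using that(3) Ti Lp_boundD(2)[OF that(2)] truncation_error[OF p L]
        by (intro order_trans[OF integral_abs_bound] integral_mono) auto
      also have "\<dots> = L powr (1 - p) * (\<integral>x. \<bar>f x\<bar> powr p \<partial>N)" by simp
      also have "\<dots> \<le> L powr (1 - p) * K' powr p"
        using Lp_boundD(3)[OF Lp_bound_mono[OF that(2) K'(2)]] p by (intro mult_left_mono) auto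
      finally show ?thesis .
    qed
    have "\<bar>(\<integral>x. ?T x \<partial>Q1) - (\<integral>x. ?T x \<partial>Q2)\<bar> \<le> 2 * L * t"
      using L by (intro total_variation_integral_bounded[OF Q sQ tv]) auto
    also have "\<dots> \<le> 2 * L * t'" using L t' by (intro mult_left_mono) auto
    finally have "\<bar>(\<integral>x. f x \<partial>Q1) - (\<integral>x. f x \<partial>Q2)\<bar> \<le> 2 * (L * t') + 2 * (L powr (1 - p) * K' powr p)"
      using tr[OF Q(1) f(1) fi(1)] tr[OF Q(2) f(2) fi(2)] by linarith
    moreover have "L * t' = K' * t' powr (1 - 1 / p)"
      using t' by (simp add: L_def powr_mult_base mult.assoc mult.commute[of _ t'])
    moreover have "L powr (1 - p) * K' powr p = K' * t' powr (1 - 1 / p)"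
    proof -
      have e: "- 1 / p * (1 - p) = 1 - 1 / p" using p by (simp add: field_simps)
      have "L powr (1 - p) = K' powr (1 - p) * t' powr (- 1 / p * (1 - p))"
        using K' t' by (simp add: L_def powr_mult powr_powr)
      then have "L powr (1 - p) = K' powr (1 - p) * t' powr (1 - 1 / p)"
        unfolding e .
      moreover have "K' powr (1 - p) * K' powr p = K'"
        using K' by (simp add: powr_add[symmetric])
      ultimately show ?thesis by (simp add: mult.commute mult.left_commute)
    qed
    ultimately show ?thesis by linarith
  qed
  have ev: "\<forall>\<^sub>F e in at_right 0. 0 \<le> t + (e::real)"
    using t unfolding eventually_at_filter by (auto intro!: always_eventually)
  have id: "((\<lambda>e. a + e) \<longlongrightarrow> a + 0) (at_right 0)" for a :: real
    by (intro tendsto_intros)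
  have "((\<lambda>e. (t + e) powr (1 - 1 / p)) \<longlongrightarrow> (t + 0) powr (1 - 1 / p)) (at_right 0)"
    by (rule tendsto_powr'[OF id tendsto_const]) (use ev p in auto)
  then have "((\<lambda>e. 4 * (K + e) * (t + e) powr (1 - 1 / p)) \<longlongrightarrow> 4 * (K + 0) * (t + 0) powr (1 - 1 / p)) (at_right 0)"
    by (intro tendsto_mult tendsto_const id)
  moreover have "\<forall>\<^sub>F e in at_right 0. \<bar>(\<integral>x. f x \<partial>Q1) - (\<integral>x. f x \<partial>Q2)\<bar> \<le> 4 * (K + e) * (t + e) powr (1 - 1 / p)"
    unfolding eventually_at_filter
  proof (intro always_eventually allI impI)
    fix e :: real assume "e \<in> {0<..}"
    then show "\<bar>(\<integral>x. f x \<partial>Q1) - (\<integral>x. f x \<partial>Q2)\<bar> \<le> 4 * (K + e) * (t + e) powr (1 - 1 / p)"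
      using K t by (intro pos) auto
  qed
  ultimately have "\<bar>(\<integral>x. f x \<partial>Q1) - (\<integral>x. f x \<partial>Q2)\<bar> \<le> 4 * (K + 0) * (t + 0) powr (1 - 1 / p)"
    by (rule tendsto_lowerbound) simp
  then show ?thesis by simp
qed

text \<open>Under \<open>M\<close> both arguments of f are the same \<omega>, under
  \<open>M \<Otimes>\<^sub>M M\<close> they are independent. The total variation distance is at most
  2 b, and 2^(1 - 1/p) \<le> 2 turns the factor 4 into 8.\<close>

lemma beta_mix_covariance:
  fixes f :: "'a \<times> 'a \<Rightarrow> real"
  assumes M: "prob_space M" and sub: "sets N1 \<subseteq> sets M" "sets N2 \<subseteq> sets M"
    and sp: "space N1 = space M" "space N2 = space M"
    and b: "beta_mix M (sets N1) (sets N2) \<le> b" and p: "1 < p"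
    and fm: "f \<in> borel_measurable (N1 \<Otimes>\<^sub>M N2)"
    and f: "Lp_bound M p (\<lambda>\<omega>. f (\<omega>, \<omega>)) K" "Lp_bound (M \<Otimes>\<^sub>M M) p f K"
  shows "\<bar>(\<integral>\<omega>. f (\<omega>, \<omega>) \<partial>M) - (\<integral>z. f z \<partial>(M \<Otimes>\<^sub>M M))\<bar> \<le> 8 * K * b powr (1 - 1 / p)"
proof -
  interpret prob_space M by fact
  interpret PP: pair_prob_space M M ..
  have id1: "(\<lambda>x. x) \<in> M \<rightarrow>\<^sub>M N1" and id2: "(\<lambda>x. x) \<in> M \<rightarrow>\<^sub>M N2"
    using sub sp by (auto simp: measurable_def intro: sets.Int_space_eq2[THEN ssubst])
  have dm: "(\<lambda>\<omega>. (\<omega>, \<omega>)) \<in> M \<rightarrow>\<^sub>M N1 \<Otimes>\<^sub>M N2"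
    using id1 id2 by (rule measurable_Pair)
  have pm: "(\<lambda>z. z) \<in> M \<Otimes>\<^sub>M M \<rightarrow>\<^sub>M N1 \<Otimes>\<^sub>M N2"
    using measurable_Pair[OF measurable_compose[OF measurable_fst id1] measurable_compose[OF measurable_snd id2]]
    by simp
  let ?Q1 = "distr M (N1 \<Otimes>\<^sub>M N2) (\<lambda>\<omega>. (\<omega>, \<omega>))"
  let ?Q2 = "distr (M \<Otimes>\<^sub>M M) (N1 \<Otimes>\<^sub>M N2) (\<lambda>z. z)"
  have K: "0 \<le> K" using f(1) by (rule Lp_boundD)
  have b0: "0 \<le> beta_mix M (sets N1) (sets N2)"
    using sets.top[of N1] sets.top[of N2] sp by (intro beta_mix_nonneg M sub) auto
  have "\<bar>(\<integral>x. f x \<partial>?Q1) - (\<integral>x. f x \<partial>?Q2)\<bar> \<le> 4 * K * (2 * b) powr (1 - 1 / p)"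
  proof (rule total_variation_integral_Lp)
    show "\<bar>measure ?Q1 E - measure ?Q2 E\<bar> \<le> 2 * b" if "E \<in> sets ?Q1" for E
      using beta_mix_total_variation[OF M sub sp, of E] that b by simp
  qed (use f p fm dm pm in \<open>auto simp: Lp_bound_distr intro: prob_space_distr PP.prob_space_distr\<close>)
  also have "(\<integral>x. f x \<partial>?Q1) = (\<integral>\<omega>. f (\<omega>, \<omega>) \<partial>M)" by (rule integral_distr[OF dm fm])
  also have "(\<integral>x. f x \<partial>?Q2) = (\<integral>z. f z \<partial>(M \<Otimes>\<^sub>M M))" by (rule integral_distr[OF pm fm])
  also have "4 * K * (2 * b) powr (1 - 1 / p) \<le> 4 * K * (2 * b powr (1 - 1 / p))"
  proof (intro mult_left_mono)
    have "(2::real) powr (1 - 1 / p) \<le> 2 powr 1" using p by (intro powr_mono) auto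
    then show "(2 * b) powr (1 - 1 / p) \<le> 2 * b powr (1 - 1 / p)"
      using b b0 by (simp add: powr_mult mult_right_mono)
  qed (use K in auto)
  finally show ?thesis by simp
qed

text \<open>The hypothesis on f ranges over all \<sigma>-algebras that make the relevant
  \<open>X i\<close> measurable, so that it can be verified by composing measurable maps; it is
  instantiated at the \<sigma>-algebras generated by the two blocks.\<close>

lemma beta_mix_covariance_gen_sigma:
  fixes f :: "'a \<times> 'a \<Rightarrow> real" and X :: "'i \<Rightarrow> 'a \<Rightarrow> 'v::topological_space"
  assumes M: "prob_space M" and X: "\<And>i. i \<in> J1 \<union> J2 \<Longrightarrow> X i \<in> borel_measurable M"
    and b: "beta_mix M (gen_sigma M X J1) (gen_sigma M X J2) \<le> b" and p: "1 < p"
    and fm: "\<And>N1 N2. (\<And>i. i \<in> J1 \<Longrightarrow> X i \<in> borel_measurable N1) \<Longrightarrow>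
        (\<And>i. i \<in> J2 \<Longrightarrow> X i \<in> borel_measurable N2) \<Longrightarrow> f \<in> borel_measurable (N1 \<Otimes>\<^sub>M N2)"
    and f: "Lp_bound M p (\<lambda>\<omega>. f (\<omega>, \<omega>)) K" "Lp_bound (M \<Otimes>\<^sub>M M) p f K"
  shows "\<bar>(\<integral>\<omega>. f (\<omega>, \<omega>) \<partial>M) - (\<integral>z. f z \<partial>(M \<Otimes>\<^sub>M M))\<bar> \<le> 8 * K * b powr (1 - 1 / p)"
proof -
  define N where "N = (\<lambda>J. sigma (space M) (\<Union>i\<in>J. {X i -` B \<inter> space M | B. B \<in> sets borel}))"
  have sub: "(\<Union>i\<in>J. {X i -` B \<inter> space M | B. B \<in> sets borel}) \<subseteq> Pow (space M)" for J by auto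
  have sN: "sets (N J) = gen_sigma M X J" "space (N J) = space M" for J
    using sub[of J] by (auto simp: N_def gen_sigma_def)
  have NM: "sets (N J) \<subseteq> sets M" if "J \<subseteq> J1 \<union> J2" for J
    unfolding sN gen_sigma_def using X that by (intro sets.sigma_sets_subset) (auto intro: measurable_sets)
  have XN: "X i \<in> borel_measurable (N J)" if "i \<in> J" for i J
    using that unfolding N_def by (intro measurableI) (auto simp: sub intro!: sigma_sets.Basic)
  show ?thesis
    by (rule beta_mix_covariance[OF M NM NM sN(2) sN(2) _ p fm f, of J1 J2])
      (use b sN XN in auto)
qed

subsection \<open>Counting index tuples by their profile\<close>

lemma m_conn_sym:
  assumes "\<And>i j. i \<in> set xs \<Longrightarrow> j \<in> set xs \<Longrightarrow> d i j = d j i" "(a, b) \<in> m_conn d m xs"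
  shows "(b, a) \<in> m_conn d m xs"
proof -
  have "sym {(a, b). a < length xs \<and> b < length xs \<and> d (xs ! a) (xs ! b) \<le> ennreal m}"
    using assms(1) by (auto simp: sym_def)
  then have "sym (m_conn d m xs)"
    unfolding m_conn_def by (rule sym_rtrancl)
  then show ?thesis using assms(2) by (rule symD)
qed

lemma m_connI:
  assumes "a < length xs" "b < length xs" "d (xs ! a) (xs ! b) \<le> ennreal m"
  shows "(a, b) \<in> m_conn d m xs"
  using assms unfolding m_conn_def by blast

lemma m_conn_trans: "(a, b) \<in> m_conn d m xs \<Longrightarrow> (b, c) \<in> m_conn d m xs \<Longrightarrow> (a, c) \<in> m_conn d m xs"
  unfolding m_conn_def by (rule rtrancl_trans)

lemma m_conn_refl: "(a, a) \<in> m_conn d m xs"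
  unfolding m_conn_def by simp

lemma m_classes_class_eq:
  assumes sym: "\<And>i j. i \<in> set xs \<Longrightarrow> j \<in> set xs \<Longrightarrow> d i j = d j i"
    and "(a, c) \<in> m_conn d m xs" "(b, c) \<in> m_conn d m xs"
  shows "{x. x < length xs \<and> (a, x) \<in> m_conn d m xs} = {x. x < length xs \<and> (b, x) \<in> m_conn d m xs}"
proof -
  have "(c, b) \<in> m_conn d m xs" "(c, a) \<in> m_conn d m xs"
    using assms by (auto intro: m_conn_sym)
  then have "(a, b) \<in> m_conn d m xs" "(b, a) \<in> m_conn d m xs"
    using assms(2,3) by (auto intro: m_conn_trans)
  then show ?thesis by (auto intro: m_conn_trans)
qed

lemma m_classes_disjoint:
  assumes sym: "\<And>i j. i \<in> set xs \<Longrightarrow> j \<in> set xs \<Longrightarrow> d i j = d j i"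
  shows "disjoint (m_classes d m xs)"
proof (rule disjointI)
  fix A B assume "A \<in> m_classes d m xs" "B \<in> m_classes d m xs" and ne: "A \<noteq> B"
  then obtain a b where A: "A = {x. x < length xs \<and> (a, x) \<in> m_conn d m xs}"
    and B: "B = {x. x < length xs \<and> (b, x) \<in> m_conn d m xs}"
    unfolding m_classes_def by auto
  show "A \<inter> B = {}"
  proof (rule ccontr)
    assume "A \<inter> B \<noteq> {}"
    then obtain c where "(a, c) \<in> m_conn d m xs" "(b, c) \<in> m_conn d m xs" unfolding A B by auto
    from m_classes_class_eq[OF sym this] ne show False by (simp add: A B)
  qed
qed

lemma m_classes_Union: "\<Union>(m_classes d m xs) = {..<length xs}"
  unfolding m_classes_def by (auto intro: m_conn_refl)

lemma m_profile_connected: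
  assumes sym: "\<And>i j. i \<in> set xs \<Longrightarrow> j \<in> set xs \<Longrightarrow> d i j = d j i"
    and "xs \<noteq> []" and c: "\<And>a. a < length xs \<Longrightarrow> (0, a) \<in> m_conn d m xs"
  shows "m_profile d m xs = [length xs]"
proof -
  have "{b. b < length xs \<and> (a, b) \<in> m_conn d m xs} = {..<length xs}" if "a < length xs" for a
    using c m_conn_trans[OF m_conn_sym[OF sym c[OF that]]] by auto
  then have "m_classes d m xs = {{..<length xs}}"
    using assms(2) unfolding m_classes_def by (auto simp: image_constant_conv)
  then show ?thesis unfolding m_profile_def by simp
qed

lemma m_profile_pair:
  assumes "d i j = d j i" "d i j \<le> ennreal m"
  shows "m_profile d m [i, j] = [2]"
proof -
  have "(0, 1) \<in> m_conn d m [i, j]" using assms by (intro m_connI) auto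
  then have "(0, a) \<in> m_conn d m [i, j]" if "a < length [i, j]" for a
    using that by (auto simp: less_Suc_eq m_conn_refl)
  moreover have "d x y = d y x" if "x \<in> set [i, j]" "y \<in> set [i, j]" for x y
    using that assms(1) by auto
  ultimately have "m_profile d m [i, j] = [length [i, j]]"
    by (intro m_profile_connected) auto
  then show ?thesis by simp
qed

lemma m_profile_triple:
  assumes sym: "\<And>x y. x \<in> {i, j, k} \<Longrightarrow> y \<in> {i, j, k} \<Longrightarrow> d x y = d y x"
    and "d i j \<le> ennreal m" "d i k \<le> ennreal m \<or> d j k \<le> ennreal m"
  shows "m_profile d m [i, j, k] = [3]"
proof -
  have 1: "(0, 1) \<in> m_conn d m [i, j, k]" using assms by (intro m_connI) auto
  have 2: "(0, 2) \<in> m_conn d m [i, j, k]"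
    using assms(3)
  proof
    assume "d i k \<le> ennreal m" then show ?thesis by (intro m_connI) auto
  next
    assume "d j k \<le> ennreal m"
    then have "(1, 2) \<in> m_conn d m [i, j, k]" by (intro m_connI) auto
    with 1 show ?thesis by (rule m_conn_trans)
  qed
  have "(0, a) \<in> m_conn d m [i, j, k]" if "a < length [i, j, k]" for a
    using that 1 2 by (auto simp: less_Suc_eq m_conn_refl numeral_2_eq_2)
  then show ?thesis using m_profile_connected[of "[i, j, k]" d m] sym by (auto simp: numeral_3_eq_3)
qed

text \<open>No position is alone in its class, so each class has at least two of the four positions:
  either one class of size 4 or two of size 2.\<close>

lemma m_profile_four:
  assumes sym: "\<And>i j. i \<in> set xs \<Longrightarrow> j \<in> set xs \<Longrightarrow> d i j = d j i"
    and len: "length xs = 4"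
    and ni: "\<And>a. a < 4 \<Longrightarrow> \<exists>b<4. b \<noteq> a \<and> d (xs ! a) (xs ! b) \<le> ennreal m"
  shows "m_profile d m xs \<in> {[4], [2, 2]}"
proof -
  let ?C = "m_classes d m xs"
  have fin: "finite ?C" unfolding m_classes_def by simp
  have finA: "finite A" if "A \<in> ?C" for A using that unfolding m_classes_def by auto
  have ge2: "2 \<le> card A" if AC: "A \<in> ?C" for A
  proof -
    obtain a where a: "a < 4" "A = {x. x < length xs \<and> (a, x) \<in> m_conn d m xs}"
      using AC len unfolding m_classes_def by auto
    obtain b where b: "b < 4" "b \<noteq> a" "d (xs ! a) (xs ! b) \<le> ennreal m" using ni[OF a(1)] by blast
    have "{a, b} \<subseteq> A" using a b len m_conn_refl[of a d m xs] m_connI[of a xs b d m] by auto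
    then have "card {a, b} \<le> card A" by (rule card_mono[OF finA[OF AC]])
    then show ?thesis using b(2) by simp
  qed
  have s4: "(\<Sum>A\<in>?C. card A) = 4"
  proof -
    have "card (\<Union>?C) = (\<Sum>A\<in>?C. card A)"
      using m_classes_disjoint[of xs d m] sym finA
      by (intro card_Union_disjoint) (auto simp: disjoint_def pairwise_def disjnt_def)
    then show ?thesis by (simp add: m_classes_Union len)
  qed
  have "(\<Sum>A\<in>?C. 2) \<le> (\<Sum>A\<in>?C. card A)" by (rule sum_mono) (rule ge2)
  then have c2: "card ?C \<le> 2" using s4 by simp
  have "?C \<noteq> {}" using s4 by auto
  then have "card ?C \<noteq> 0" using fin by simp
  then consider "card ?C = 1" | "card ?C = 2" using c2 by linarith
  then show ?thesis
  proof cases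
    case 1
    then obtain A where A: "?C = {A}" by (auto simp: card_1_singleton_iff)
    then show ?thesis using s4 unfolding m_profile_def A by simp
  next
    case 2
    then obtain A B where AB: "?C = {A, B}" "A \<noteq> B" by (auto simp: card_2_iff)
    then have "card A = 2" "card B = 2" using s4 ge2[of A] ge2[of B] by auto
    then show ?thesis using AB unfolding m_profile_def AB(1) by simp
  qed
qed

lemma tau_finite:
  assumes "finite I"
  shows "finite {xs. set xs \<subseteq> I \<and> length xs = sum_list qs \<and> m_profile d m xs = qs}"
  by (rule finite_subset[OF _ finite_lists_length_eq[OF assms, of "sum_list qs"]]) auto

lemma card_le_tau:
  assumes "finite I" "inj_on f S"
    and "\<And>s. s \<in> S \<Longrightarrow> set (f s) \<subseteq> I \<and> length (f s) = sum_list qs \<and> m_profile d m (f s) = qs"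
  shows "card S \<le> tau I d m qs"
  unfolding tau_def using assms by (intro card_inj_on_le[OF _ _ tau_finite]) auto

lemma card_pairs_le_tau:
  assumes "finite I" and sym: "\<And>i j. i \<in> I \<Longrightarrow> j \<in> I \<Longrightarrow> d i j = d j i"
  shows "card {(i, j). i \<in> I \<and> j \<in> I \<and> d i j \<le> ennreal m} \<le> tau I d m [2]"
  using m_profile_pair[of d] sym
  by (intro card_le_tau[OF assms(1), of "\<lambda>(i, j). [i, j]"]) (auto simp: inj_on_def)

text \<open>The alternative for k says that it is near i or near j: these are the indices removed in
  the expansion around a pair.\<close>

lemma card_triples_le_tau:
  assumes "finite I" and sym: "\<And>i j. i \<in> I \<Longrightarrow> j \<in> I \<Longrightarrow> d i j = d j i"
  shows "card {(i, j, k). i \<in> I \<and> j \<in> I \<and> k \<in> I \<and> d i j \<le> ennreal m \<and>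
      (d i k \<le> ennreal m \<or> d j k \<le> ennreal m)} \<le> tau I d m [3]"
proof (intro card_le_tau[OF assms(1), of "\<lambda>(i, j, k). [i, j, k]"])
  fix s assume s: "s \<in> {(i, j, k). i \<in> I \<and> j \<in> I \<and> k \<in> I \<and> d i j \<le> ennreal m \<and>
      (d i k \<le> ennreal m \<or> d j k \<le> ennreal m)}"
  obtain i j k where ijk: "s = (i, j, k)" by (cases s)
  have "m_profile d m [i, j, k] = [3]"
    using s sym unfolding ijk by (intro m_profile_triple) auto
  then show "set (case s of (i, j, k) \<Rightarrow> [i, j, k]) \<subseteq> I \<and> length (case s of (i, j, k) \<Rightarrow> [i, j, k]) = sum_list [3] \<and>
      m_profile d m (case s of (i, j, k) \<Rightarrow> [i, j, k]) = [3]"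
    using s by (simp add: ijk)
qed (auto simp: inj_on_def)

text \<open>For a metric, an index that occurs again in J is never isolated, so tuples with
  coinciding indices fall on the side counted by \<open>tau\<close>.\<close>

definition isolated :: "('i \<Rightarrow> 'i \<Rightarrow> ennreal) \<Rightarrow> real \<Rightarrow> 'i \<Rightarrow> 'i set \<Rightarrow> bool" where
  "isolated d m i J \<longleftrightarrow> (\<forall>j\<in>J. \<not> d i j \<le> ennreal m)"

text \<open>Each of the four positions has a neighbour at another position, which leaves two
  profiles. The set is split accordingly because \<open>tau\<close> counts one profile at a
  time.\<close>

lemma card_quadruples_le_tau:
  fixes I :: "'i set"
  assumes "finite I" and sym: "\<And>i j. i \<in> I \<Longrightarrow> j \<in> I \<Longrightarrow> d i j = d j i"
  shows "card {(i, k, j, l). i \<in> I \<and> k \<in> I \<and> j \<in> I \<and> l \<in> I \<and>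
      \<not> isolated d m i {k, j, l} \<and> \<not> isolated d m k {i, j, l} \<and>
      \<not> isolated d m j {i, k, l} \<and> \<not> isolated d m l {i, k, j}}
    \<le> tau I d m [4] + tau I d m [2, 2]" (is "card ?S \<le> _")
proof -
  define f where "f = (\<lambda>(i, k, j, l). [i, k, j, l] :: 'i list)"
  have prof: "set (f s) \<subseteq> I \<and> length (f s) = 4 \<and> m_profile d m (f s) \<in> {[4], [2, 2]}" if s: "s \<in> ?S" for s
  proof -
    obtain i k j l where e: "s = (i, k, j, l)" by (cases s)
    have I: "i \<in> I" "k \<in> I" "j \<in> I" "l \<in> I" using s by (auto simp: e)
    have "m_profile d m [i, k, j, l] \<in> {[4], [2, 2]}"
    proof (rule m_profile_four)
      fix a :: nat assume "a < 4"
      then consider "a = 0" | "a = 1" | "a = 2" | "a = 3" by linarith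
      then show "\<exists>b<4. b \<noteq> a \<and> d ([i, k, j, l] ! a) ([i, k, j, l] ! b) \<le> ennreal m"
      proof cases
        case 1
        then show ?thesis using s unfolding e isolated_def
          by (auto intro: exI[of _ 1] exI[of _ 2] exI[of _ 3])
      next
        case 2
        then show ?thesis using s unfolding e isolated_def
          by (auto intro: exI[of _ 0] exI[of _ 2] exI[of _ 3])
      next
        case 3
        then show ?thesis using s unfolding e isolated_def
          by (auto intro: exI[of _ 0] exI[of _ 1] exI[of _ 3])
      next
        case 4
        then show ?thesis using s unfolding e isolated_def
          by (auto intro: exI[of _ 0] exI[of _ 1] exI[of _ 2])
      qed
    qed (use I sym in auto)
    then show ?thesis using I by (simp add: e f_def)
  qed
  have inj: "inj_on f S" for S by (auto simp: inj_on_def f_def)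
  define A where "A = {s \<in> ?S. m_profile d m (f s) = [4]}"
  define B where "B = {s \<in> ?S. m_profile d m (f s) = [2, 2]}"
  have "?S = A \<union> B" using prof unfolding A_def B_def by blast
  then have "card ?S \<le> card A + card B" using card_Un_le[of A B] by simp
  also have "card A \<le> tau I d m [4]"
    using prof by (intro card_le_tau[OF assms(1) inj]) (auto simp: A_def)
  also have "card B \<le> tau I d m [2, 2]"
    using prof by (intro card_le_tau[OF assms(1) inj]) (auto simp: B_def)
  finally show ?thesis by simp
qed

subsection \<open>Stein's method for a mixing array\<close>

lemma derivative_bound_imp_lipschitz:
  fixes f f' :: "real \<Rightarrow> real"
  assumes f: "\<And>x. (f has_real_derivative f' x) (at x)" and b: "\<And>x. \<bar>f' x\<bar> \<le> c"
  shows "\<bar>f y - f x\<bar> \<le> c * \<bar>y - x\<bar>"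
  using field_differentiable_bound[of UNIV f f' c y x] f b
  by (simp add: has_field_derivative_at_within)

text \<open>The derivative is taken at \<open>y\<close>, the full sum in the application, because
  Stein's equation involves f' at that point. The mean value theorem and the Lipschitz bound of f'
  replace Taylor's formula at the price of a factor 2.\<close>

lemma second_order_bound:
  fixes f f' f'' :: "real \<Rightarrow> real"
  assumes f: "\<And>x. (f has_real_derivative f' x) (at x)" "\<And>x. (f' has_real_derivative f'' x) (at x)"
    and b: "\<And>x. \<bar>f'' x\<bar> \<le> c"
  shows "\<bar>f y - f x - f' y * (y - x)\<bar> \<le> c * (y - x)\<^sup>2"
proof -
  have c: "0 \<le> c" using b[of 0] by simp
  obtain z where z: "\<bar>z - y\<bar> \<le> \<bar>y - x\<bar>" "f y - f x = (y - x) * f' z"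
  proof (cases "x = y")
    case False
    then consider "x < y" | "y < x" by linarith
    then show ?thesis
    proof cases
      case 1
      obtain z where "x < z" "z < y" "f y - f x = (y - x) * f' z" using MVT2[OF 1 f(1)] by blast
      then show ?thesis by (intro that[of z]) auto
    next
      case 2
      obtain z where z: "y < z" "z < x" "f x - f y = (x - y) * f' z" using MVT2[OF 2 f(1)] by blast
      then have "f y - f x = (y - x) * f' z" by (simp add: algebra_simps)
      with z show ?thesis by (intro that[of z]) auto
    qed
  qed (auto intro: that[of y])
  have "f y - f x - f' y * (y - x) = (y - x) * (f' z - f' y)"
    using z(2) by (simp add: algebra_simps)
  also have "\<bar>\<dots>\<bar> \<le> \<bar>y - x\<bar> * (c * \<bar>y - x\<bar>)"
    unfolding abs_mult
    using order_trans[OF derivative_bound_imp_lipschitz[OF f(2) b] mult_left_mono[OF z(1) c]]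
    by (intro mult_left_mono) auto
  finally show ?thesis by (simp add: power2_eq_square abs_mult_self_eq mult.assoc mult.left_commute)
qed

text \<open>A substitute for Hoelder's inequality: the product is at most the cube of the largest
  factor. In expectation this costs a factor 3.\<close>

lemma abs_triple_product_le:
  fixes x y z :: real
  shows "\<bar>x\<bar> * \<bar>y\<bar> * \<bar>z\<bar> \<le> \<bar>x\<bar> ^ 3 + \<bar>y\<bar> ^ 3 + \<bar>z\<bar> ^ 3"
proof -
  let ?m = "max \<bar>x\<bar> (max \<bar>y\<bar> \<bar>z\<bar>)"
  have "\<bar>x\<bar> * \<bar>y\<bar> * \<bar>z\<bar> \<le> ?m * ?m * ?m" by (intro mult_mono) auto
  also have "\<dots> = ?m ^ 3" by (simp add: power3_eq_cube)
  also have "\<dots> \<le> \<bar>x\<bar> ^ 3 + \<bar>y\<bar> ^ 3 + \<bar>z\<bar> ^ 3" by (auto simp: max_def)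
  finally show ?thesis .
qed

lemma Lp_bound_three:
  assumes "Lp_bound M 3 f K"
  shows "integrable M (\<lambda>x. \<bar>f x\<bar> ^ 3)" "(\<integral>x. \<bar>f x\<bar> ^ 3 \<partial>M) \<le> K ^ 3"
  using assms powr_numeral[of K "num.Bit1 num.One"] unfolding Lp_bound_def by auto

lemma triple_product_expectation:
  fixes x y z :: "'a \<Rightarrow> real"
  assumes "Lp_bound M 3 x K" "Lp_bound M 3 y K" "Lp_bound M 3 z K"
  shows "integrable M (\<lambda>\<omega>. \<bar>x \<omega>\<bar> * \<bar>y \<omega>\<bar> * \<bar>z \<omega>\<bar>)"
    "(\<integral>\<omega>. \<bar>x \<omega>\<bar> * \<bar>y \<omega>\<bar> * \<bar>z \<omega>\<bar> \<partial>M) \<le> 3 * K ^ 3"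
proof -
  have [measurable]: "x \<in> borel_measurable M" "y \<in> borel_measurable M" "z \<in> borel_measurable M"
    using assms by (auto dest: Lp_boundD)
  have s: "integrable M (\<lambda>\<omega>. \<bar>x \<omega>\<bar> ^ 3 + \<bar>y \<omega>\<bar> ^ 3 + \<bar>z \<omega>\<bar> ^ 3)"
    using assms by (intro Bochner_Integration.integrable_add Lp_bound_three)
  show i: "integrable M (\<lambda>\<omega>. \<bar>x \<omega>\<bar> * \<bar>y \<omega>\<bar> * \<bar>z \<omega>\<bar>)"
    by (rule Bochner_Integration.integrable_bound[OF s])
      (auto simp: abs_mult abs_triple_product_le intro!: AE_I2 order_trans[OF abs_triple_product_le])
  have "(\<integral>\<omega>. \<bar>x \<omega>\<bar> * \<bar>y \<omega>\<bar> * \<bar>z \<omega>\<bar> \<partial>M) \<le> (\<integral>\<omega>. \<bar>x \<omega>\<bar> ^ 3 + \<bar>y \<omega>\<bar> ^ 3 + \<bar>z \<omega>\<bar> ^ 3 \<partial>M)"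
    by (rule integral_mono[OF i s]) (rule abs_triple_product_le)
  also have "\<dots> \<le> 3 * K ^ 3"
    using assms[THEN Lp_bound_three(1)] assms[THEN Lp_bound_three(2)] by simp
  finally show "(\<integral>\<omega>. \<bar>x \<omega>\<bar> * \<bar>y \<omega>\<bar> * \<bar>z \<omega>\<bar> \<partial>M) \<le> 3 * K ^ 3" .
qed

text \<open>Needed for products of a variable with a covariance constant. The bound K * K^2 is
  enlarged to that of the coupled triple so that both kinds can be summed alike.\<close>

lemma triple_product_decoupled:
  fixes x y z :: "'a \<Rightarrow> real"
  assumes M: "prob_space M" and x: "Lp_bound M 3 x K" and yz: "Lp_bound M 3 y K" "Lp_bound M 3 z K"
  shows "(\<integral>\<omega>. \<bar>x \<omega>\<bar> \<partial>M) * \<bar>\<integral>\<omega>. y \<omega> * z \<omega> \<partial>M\<bar> \<le> 3 * K ^ 3"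
proof -
  interpret prob_space M by fact
  have xi: "integrable M x" using Lp_bound_integrable[OF finite_measure_axioms x] by simp
  have [measurable]: "y \<in> borel_measurable M" "z \<in> borel_measurable M"
    using yz by (auto dest: Lp_boundD)
  have L1: "Lp_bound M (3/2) (\<lambda>\<omega>. y \<omega> * z \<omega>) (K\<^sup>2)" by (rule Lp_bound_mult) fact+
  have 1: "\<bar>\<integral>\<omega>. y \<omega> * z \<omega> \<partial>M\<bar> \<le> K\<^sup>2"
    by (rule Lp_bound_abs_expectation(2)[OF M L1]) simp
  have "Lp_bound M 3 (\<lambda>\<omega>. \<bar>x \<omega>\<bar>) K" using x unfolding Lp_bound_def by auto
  from Lp_bound_abs_expectation(2)[OF M this] have 2: "(\<integral>\<omega>. \<bar>x \<omega>\<bar> \<partial>M) \<le> K" by simp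
  have K: "0 \<le> K" using x by (rule Lp_boundD)
  have "(\<integral>\<omega>. \<bar>x \<omega>\<bar> \<partial>M) * \<bar>\<integral>\<omega>. y \<omega> * z \<omega> \<partial>M\<bar> \<le> K * K\<^sup>2"
    using 1 2 K by (intro mult_mono) auto
  also have "\<dots> \<le> 3 * K ^ 3" using K by (simp add: power2_eq_square power3_eq_cube)
  finally show ?thesis .
qed

text \<open>One array at fixed n and m, with \<open>b\<close> standing for the mixing numbers at
  this m. All bounds proved inside have numeric constants and are therefore uniform in n and
  m.\<close>

locale mixing_array = prob_space M for M :: "'a measure" +
  fixes I :: "'i set" and d :: "'i \<Rightarrow> 'i \<Rightarrow> ennreal" and X :: "'i \<Rightarrow> 'a \<Rightarrow> 'v::euclidean_space"
    and m :: real and b :: "enat \<Rightarrow> enat \<Rightarrow> real"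
  assumes fin_I[simp, intro]: "finite I"
    and d_sym: "\<And>i j. i \<in> I \<Longrightarrow> j \<in> I \<Longrightarrow> d i j = d j i"
    and X_meas: "\<And>i. i \<in> I \<Longrightarrow> X i \<in> borel_measurable M"
    and mixing: "\<And>n1 n2 J1 J2. (J1, J2) \<in> pairs_P I d n1 n2 m \<Longrightarrow>
      beta_mix M (gen_sigma M X J1) (gen_sigma M X J2) \<le> b n1 n2"
begin

lemma mixing_covariance:
  fixes f :: "'a \<times> 'a \<Rightarrow> real"
  assumes J: "J1 \<subseteq> I" "J2 \<subseteq> I" "enat (card J1) \<le> n1" "enat (card J2) \<le> n2"
    and far: "\<And>i j. i \<in> J1 \<Longrightarrow> j \<in> J2 \<Longrightarrow> \<not> d i j \<le> ennreal m" and p: "1 < p"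
    and fm: "\<And>N1 N2. (\<And>i. i \<in> J1 \<Longrightarrow> X i \<in> borel_measurable N1) \<Longrightarrow>
        (\<And>i. i \<in> J2 \<Longrightarrow> X i \<in> borel_measurable N2) \<Longrightarrow> f \<in> borel_measurable (N1 \<Otimes>\<^sub>M N2)"
    and f: "Lp_bound M p (\<lambda>\<omega>. f (\<omega>, \<omega>)) K" "Lp_bound (M \<Otimes>\<^sub>M M) p f K"
    and z: "(\<integral>z. f z \<partial>(M \<Otimes>\<^sub>M M)) = 0"
  shows "\<bar>\<integral>\<omega>. f (\<omega>, \<omega>) \<partial>M\<bar> \<le> 8 * K * b n1 n2 powr (1 - 1 / p)"
proof -
  \<comment> \<open>Separation means distance beyond m, so the distance of the blocks is at least m;
    if a block is empty, the infimum is infinite.\<close>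
  have "ennreal m \<le> set_dist d J1 J2"
    unfolding set_dist_def using far by (intro INF_greatest) (meson linear)
  then have "(J1, J2) \<in> pairs_P I d n1 n2 m" using J by (simp add: pairs_P_def)
  then have bm: "beta_mix M (gen_sigma M X J1) (gen_sigma M X J2) \<le> b n1 n2" by (rule mixing)
  have "\<bar>(\<integral>\<omega>. f (\<omega>, \<omega>) \<partial>M) - (\<integral>z. f z \<partial>(M \<Otimes>\<^sub>M M))\<bar> \<le> 8 * K * b n1 n2 powr (1 - 1 / p)"
  proof (rule beta_mix_covariance_gen_sigma[OF prob_space_axioms _ bm p _ f])
    show "X i \<in> borel_measurable M" if "i \<in> J1 \<union> J2" for i
      using that J(1,2) X_meas by auto
  qed (use fm in auto)
  then show ?thesis using z by simp
qed

lemma expectation_decoupled_product: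
  fixes u v :: "'a \<Rightarrow> real"
  assumes "integrable (M \<Otimes>\<^sub>M M) (\<lambda>(x, y). u x * v y)"
  shows "(\<integral>z. u (fst z) * v (snd z) \<partial>(M \<Otimes>\<^sub>M M)) = (\<integral>x. u x \<partial>M) * (\<integral>y. v y \<partial>M)"
proof -
  interpret PP: pair_prob_space M M ..
  show ?thesis
    using PP.integral_fst'[of "\<lambda>(x, y). u x * v y"] assms by (simp add: case_prod_unfold)
qed

definition near :: "'i \<Rightarrow> 'i set" where "near i = {j \<in> I. d i j \<le> ennreal m}"

lemma near_subset: "near i \<subseteq> I" and finite_near[simp, intro]: "finite (near i)"
  by (auto simp: near_def)

end

text \<open>The linear statistic by itself: \<open>\<phi> i\<close> will be the projection for index
  i divided by \<nu>, which normalises the variance of the sum to 1. The three moment bounds keep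
  separate constants because they enter different terms of the result.\<close>

locale mixing_sum = mixing_array M I d X m b for M I d and X :: "'i \<Rightarrow> 'a \<Rightarrow> 'v::euclidean_space" and m b +
  fixes \<phi> :: "'i \<Rightarrow> 'v \<Rightarrow> real" and \<delta> K1 K2 K3 :: real
  assumes \<delta>: "0 < \<delta>"
    and \<phi>[measurable]: "\<And>i. \<phi> i \<in> borel_measurable borel"
    and L1: "\<And>i. i \<in> I \<Longrightarrow> Lp_bound M (1 + \<delta>) (\<lambda>\<omega>. \<phi> i (X i \<omega>)) K1"
    and L2: "\<And>i. i \<in> I \<Longrightarrow> Lp_bound M (2 + \<delta>) (\<lambda>\<omega>. \<phi> i (X i \<omega>)) K2"
    and L3: "\<And>i. i \<in> I \<Longrightarrow> Lp_bound M 3 (\<lambda>\<omega>. \<phi> i (X i \<omega>)) K3"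
    and centered: "\<And>i. i \<in> I \<Longrightarrow> (\<integral>\<omega>. \<phi> i (X i \<omega>) \<partial>M) = 0"
    and normalized: "(\<integral>\<omega>. (\<Sum>i\<in>I. \<phi> i (X i \<omega>))\<^sup>2 \<partial>M) = 1"
begin

definition \<xi> :: "'i \<Rightarrow> 'a \<Rightarrow> real" where "\<xi> i \<omega> = \<phi> i (X i \<omega>)"

definition \<sigma> :: "'i \<Rightarrow> 'i \<Rightarrow> real" where "\<sigma> i j = (\<integral>\<omega>. \<xi> i \<omega> * \<xi> j \<omega> \<partial>M)"

definition psum :: "'i set \<Rightarrow> 'a \<Rightarrow> real" where "psum J \<omega> = (\<Sum>j\<in>J. \<xi> j \<omega>)"

lemma \<xi>_L1: "i \<in> I \<Longrightarrow> Lp_bound M (1 + \<delta>) (\<xi> i) K1"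
  and \<xi>_L2: "i \<in> I \<Longrightarrow> Lp_bound M (2 + \<delta>) (\<xi> i) K2"
  and \<xi>_L3: "i \<in> I \<Longrightarrow> Lp_bound M 3 (\<xi> i) K3"
  and \<xi>_centered: "i \<in> I \<Longrightarrow> (\<integral>\<omega>. \<xi> i \<omega> \<partial>M) = 0"
  using L1 L2 L3 centered unfolding \<xi>_def[abs_def] by auto

lemma \<xi>_product_L: 
  assumes "i \<in> I" "j \<in> I"
  shows "Lp_bound M (1 + \<delta> / 2) (\<lambda>\<omega>. \<xi> i \<omega> * \<xi> j \<omega>) (K2\<^sup>2)" "\<bar>\<sigma> i j\<bar> \<le> K2\<^sup>2"
    "integrable M (\<lambda>\<omega>. \<xi> i \<omega> * \<xi> j \<omega>)"
proof -
  show L: "Lp_bound M (1 + \<delta> / 2) (\<lambda>\<omega>. \<xi> i \<omega> * \<xi> j \<omega>) (K2\<^sup>2)"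
    using Lp_bound_mult[OF \<xi>_L2[OF assms(1)] \<xi>_L2[OF assms(2)]] by (simp add: add_divide_distrib)
  show "\<bar>\<sigma> i j\<bar> \<le> K2\<^sup>2"
    unfolding \<sigma>_def using \<delta> by (intro Lp_bound_abs_expectation(2)[OF prob_space_axioms L]) auto
  show "integrable M (\<lambda>\<omega>. \<xi> i \<omega> * \<xi> j \<omega>)"
    using \<delta> by (intro Lp_bound_integrable[OF finite_measure_axioms L]) auto
qed

lemma \<xi>_measurable: "X i \<in> borel_measurable N \<Longrightarrow> \<xi> i \<in> borel_measurable N"
  unfolding \<xi>_def[abs_def] by measurable

lemma psum_measurable: "(\<And>i. i \<in> J \<Longrightarrow> X i \<in> borel_measurable N) \<Longrightarrow> psum J \<in> borel_measurable N"
  unfolding psum_def[abs_def] by (intro borel_measurable_sum \<xi>_measurable)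

lemma exponents: "1 - 1 / (1 + \<delta>) = \<delta> / (1 + \<delta>)" "1 - 1 / (1 + \<delta> / 2) = \<delta> / (2 + \<delta>)"
  using \<delta> by (auto simp: field_simps)

text \<open>For independent copies the expectation factorises and vanishes because u is centred, so
  only the mixing error remains. Boundedness of v preserves the moment exponent of u.\<close>

lemma separated_covariance:
  fixes u v :: "'a \<Rightarrow> real"
  assumes J: "J1 \<subseteq> I" "J2 \<subseteq> I" "enat (card J1) \<le> n1" "enat (card J2) \<le> n2"
    and far: "\<And>i j. i \<in> J1 \<Longrightarrow> j \<in> J2 \<Longrightarrow> \<not> d i j \<le> ennreal m" and p: "1 < p"
    and um: "\<And>N. (\<And>i. i \<in> J1 \<Longrightarrow> X i \<in> borel_measurable N) \<Longrightarrow> u \<in> borel_measurable N"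
    and vm: "\<And>N. (\<And>i. i \<in> J2 \<Longrightarrow> X i \<in> borel_measurable N) \<Longrightarrow> v \<in> borel_measurable N"
    and u: "Lp_bound M p u K" "(\<integral>\<omega>. u \<omega> \<partial>M) = 0" and v: "\<And>\<omega>. \<bar>v \<omega>\<bar> \<le> c"
  shows "\<bar>\<integral>\<omega>. u \<omega> * v \<omega> \<partial>M\<bar> \<le> 8 * (c * K) * b n1 n2 powr (1 - 1 / p)"
proof -
  interpret PP: pair_prob_space M M ..
  have vM[measurable]: "v \<in> borel_measurable M" using vm J X_meas by blast
  let ?f = "\<lambda>z. u (fst z) * v (snd z)"
  have 1: "Lp_bound M p (\<lambda>\<omega>. ?f (\<omega>, \<omega>)) (c * K)"
    using Lp_bound_mult_bounded[OF u(1) vM v] p by simp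
  have 2: "Lp_bound (M \<Otimes>\<^sub>M M) p ?f (c * K)"
    using p v by (intro Lp_bound_mult_bounded Lp_bound_fst[OF prob_space_axioms prob_space_axioms u(1)]) auto
  have "integrable (M \<Otimes>\<^sub>M M) ?f"
    using Lp_bound_integrable[OF PP.finite_measure_axioms 2] p by simp
  then have z: "(\<integral>z. ?f z \<partial>(M \<Otimes>\<^sub>M M)) = 0"
    using expectation_decoupled_product[of u v] u(2) by (simp add: case_prod_unfold)
  have fm: "?f \<in> borel_measurable (N1 \<Otimes>\<^sub>M N2)"
    if "\<And>i. i \<in> J1 \<Longrightarrow> X i \<in> borel_measurable N1" "\<And>i. i \<in> J2 \<Longrightarrow> X i \<in> borel_measurable N2" for N1 N2
    using measurable_compose[OF measurable_fst um[OF that(1)]] measurable_compose[OF measurable_snd vm[OF that(2)]]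
    by (rule borel_measurable_times)
  have "\<bar>\<integral>\<omega>. ?f (\<omega>, \<omega>) \<partial>M\<bar> \<le> 8 * (c * K) * b n1 n2 powr (1 - 1 / p)"
    by (rule mixing_covariance[OF J _ p _ 1 2 z]) (use far fm in auto)
  then show ?thesis by simp
qed

text \<open>Neither factor is bounded here, so the mixing estimate is fed with the 1 + \<delta>/2
  moments of the product, both for the coupled and for the decoupled pair.\<close>

lemma covariance_far:
  assumes "i \<in> I" "j \<in> I" "\<not> d i j \<le> ennreal m"
  shows "\<bar>\<sigma> i j\<bar> \<le> 8 * K2\<^sup>2 * b 1 1 powr (\<delta> / (2 + \<delta>))"
proof -
  interpret PP: pair_prob_space M M ..
  let ?f = "\<lambda>z. \<xi> i (fst z) * \<xi> j (snd z)"
  have p: "1 < 1 + \<delta> / 2" using \<delta> by simp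
  have 2: "Lp_bound (M \<Otimes>\<^sub>M M) (1 + \<delta> / 2) ?f (K2\<^sup>2)"
    using Lp_bound_mult[OF Lp_bound_fst[OF prob_space_axioms prob_space_axioms \<xi>_L2[OF assms(1)]]
        Lp_bound_snd[OF prob_space_axioms prob_space_axioms \<xi>_L2[OF assms(2)]]]
    by (simp add: add_divide_distrib)
  have "integrable (M \<Otimes>\<^sub>M M) ?f"
    using Lp_bound_integrable[OF PP.finite_measure_axioms 2] p by simp
  then have z: "(\<integral>z. ?f z \<partial>(M \<Otimes>\<^sub>M M)) = 0"
    using expectation_decoupled_product[of "\<xi> i" "\<xi> j"] \<xi>_centered assms by (simp add: case_prod_unfold)
  have fm: "?f \<in> borel_measurable (N1 \<Otimes>\<^sub>M N2)"
    if "\<And>k. k \<in> {i} \<Longrightarrow> X k \<in> borel_measurable N1" "\<And>k. k \<in> {j} \<Longrightarrow> X k \<in> borel_measurable N2" for N1 N2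
    using measurable_compose[OF measurable_fst \<xi>_measurable[OF that(1)]]
      measurable_compose[OF measurable_snd \<xi>_measurable[OF that(2)]]
    by (intro borel_measurable_times) auto
  have "\<bar>\<integral>\<omega>. ?f (\<omega>, \<omega>) \<partial>M\<bar> \<le> 8 * K2\<^sup>2 * b 1 1 powr (1 - 1 / (1 + \<delta> / 2))"
    by (rule mixing_covariance[where ?J1.0 = "{i}" and ?J2.0 = "{j}" and f = ?f, OF _ _ _ _ _ p fm _ 2 z])
      (use assms \<xi>_product_L in \<open>auto simp: one_enat_def\<close>)
  then show ?thesis by (simp add: \<sigma>_def exponents)
qed

end

section \<open>The individual terms of the Stein expansion\<close>

lemma integrable_mult_bounded:
  fixes u v :: "'a \<Rightarrow> real"
  assumes u: "integrable M u" and v[measurable]: "v \<in> borel_measurable M" and b: "\<And>x. \<bar>v x\<bar> \<le> c"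
  shows "integrable M (\<lambda>x. u x * v x)"
proof (rule Bochner_Integration.integrable_bound)
  show "integrable M (\<lambda>x. c * u x)" using u by simp
  have c: "0 \<le> c" using b order_trans[OF abs_ge_zero] by blast
  show "AE x in M. norm (u x * v x) \<le> norm (c * u x)"
  proof (rule AE_I2)
    fix x
    have "\<bar>u x\<bar> * \<bar>v x\<bar> \<le> \<bar>u x\<bar> * c" by (rule mult_left_mono[OF b]) simp
    then show "norm (u x * v x) \<le> norm (c * u x)" using c by (simp add: abs_mult mult.commute)
  qed
qed (use u in measurable)

lemma integral_sum_bound:
  fixes u :: "'i \<Rightarrow> 'a \<Rightarrow> real"
  assumes "\<And>i. i \<in> S \<Longrightarrow> integrable M (u i)" "\<And>i. i \<in> S \<Longrightarrow> \<bar>\<integral>x. u i x \<partial>M\<bar> \<le> c i"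
  shows "integrable M (\<lambda>x. \<Sum>i\<in>S. u i x)" "\<bar>\<integral>x. (\<Sum>i\<in>S. u i x) \<partial>M\<bar> \<le> (\<Sum>i\<in>S. c i)"
proof -
  show "integrable M (\<lambda>x. \<Sum>i\<in>S. u i x)" using assms(1) by (rule Bochner_Integration.integrable_sum)
  have "(\<integral>x. (\<Sum>i\<in>S. u i x) \<partial>M) = (\<Sum>i\<in>S. \<integral>x. u i x \<partial>M)"
    using assms(1) by (rule Bochner_Integration.integral_sum)
  also have "\<bar>\<dots>\<bar> \<le> (\<Sum>i\<in>S. c i)"
    using assms(2) by (intro order_trans[OF sum_abs] sum_mono)
  finally show "\<bar>\<integral>x. (\<Sum>i\<in>S. u i x) \<partial>M\<bar> \<le> (\<Sum>i\<in>S. c i)" .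
qed

lemma (in mixing_array) near_pairs_le_tau: "(\<Sum>i\<in>I. card (near i)) \<le> tau I d m [2]"
proof -
  have "(\<Sum>i\<in>I. card (near i)) = card (Sigma I near)" by (simp add: card_SigmaI)
  also have "Sigma I near = {(i, j). i \<in> I \<and> j \<in> I \<and> d i j \<le> ennreal m}" by (auto simp: near_def)
  also have "card \<dots> \<le> tau I d m [2]" using d_sym by (intro card_pairs_le_tau) auto
  finally show ?thesis .
qed

lemma (in mixing_array) near_triples_le_tau:
  "(\<Sum>i\<in>I. \<Sum>j\<in>near i. card (near i \<union> near j)) \<le> tau I d m [3]"
proof -
  have "(\<Sum>i\<in>I. \<Sum>j\<in>near i. card (near i \<union> near j)) = card (SIGMA i:I. SIGMA j:near i. near i \<union> near j)"
    by (simp add: card_SigmaI)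
  also have "(SIGMA i:I. SIGMA j:near i. near i \<union> near j) = {(i, j, k). i \<in> I \<and> j \<in> I \<and> k \<in> I \<and>
      d i j \<le> ennreal m \<and> (d i k \<le> ennreal m \<or> d j k \<le> ennreal m)}"
    by (auto simp: near_def)
  also have "card \<dots> \<le> tau I d m [3]" using d_sym by (intro card_triples_le_tau) auto
  finally show ?thesis .
qed

context mixing_sum
begin

lemma psum_diff: "J \<subseteq> I \<Longrightarrow> psum I \<omega> - psum (I - J) \<omega> = psum J \<omega>"
  unfolding psum_def using sum.subset_diff[of J I "\<lambda>j. \<xi> j \<omega>"] by simp

lemma abs_psum_le: "\<bar>psum J \<omega>\<bar> \<le> (\<Sum>j\<in>J. \<bar>\<xi> j \<omega>\<bar>)"
  unfolding psum_def by (rule sum_abs)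

lemma \<xi>_integrable: "i \<in> I \<Longrightarrow> integrable M (\<xi> i)"
  using Lp_bound_integrable[OF finite_measure_axioms \<xi>_L3] by simp

lemma psum_M[measurable]: "J \<subseteq> I \<Longrightarrow> psum J \<in> borel_measurable M"
  using X_meas by (intro psum_measurable) auto

lemma psum_integrable: "J \<subseteq> I \<Longrightarrow> integrable M (psum J)"
  unfolding psum_def[abs_def] using \<xi>_integrable by (intro Bochner_Integration.integrable_sum) auto

lemma \<sigma>_total: "(\<Sum>i\<in>I. \<Sum>j\<in>I. \<sigma> i j) = 1"
proof -
  have "(\<Sum>i\<in>I. \<Sum>j\<in>I. \<sigma> i j) = (\<integral>\<omega>. (\<Sum>i\<in>I. \<Sum>j\<in>I. \<xi> i \<omega> * \<xi> j \<omega>) \<partial>M)"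
    unfolding \<sigma>_def using \<xi>_product_L(3) by (simp add: Bochner_Integration.integral_sum)
  also have "(\<lambda>\<omega>. \<Sum>i\<in>I. \<Sum>j\<in>I. \<xi> i \<omega> * \<xi> j \<omega>) = (\<lambda>\<omega>. (\<Sum>i\<in>I. \<phi> i (X i \<omega>))\<^sup>2)"
    by (simp add: power2_eq_square sum_product \<xi>_def)
  finally show ?thesis using normalized by simp
qed

text \<open>The sum outside \<open>near i\<close> uses only indices separated from i, and \<xi> i is
  centred. That sum may involve arbitrarily many indices, hence the second argument
  \<infinity>.\<close>

lemma stein_term_isolated:
  fixes f :: "real \<Rightarrow> real"
  assumes i: "i \<in> I" and f[measurable]: "f \<in> borel_measurable borel" and b: "\<And>x. \<bar>f x\<bar> \<le> c"
  shows "\<bar>\<integral>\<omega>. \<xi> i \<omega> * f (psum (I - near i) \<omega>) \<partial>M\<bar> \<le> 8 * c * K1 * b 1 \<infinity> powr (\<delta> / (1 + \<delta>))"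
proof -
  have "\<bar>\<integral>\<omega>. \<xi> i \<omega> * f (psum (I - near i) \<omega>) \<partial>M\<bar> \<le> 8 * (c * K1) * b 1 \<infinity> powr (1 - 1 / (1 + \<delta>))"
  proof (rule separated_covariance[where ?J1.0 = "{i}" and ?J2.0 = "I - near i"])
    show "Lp_bound M (1 + \<delta>) (\<xi> i) K1" using i by (rule \<xi>_L1)
    show "(\<lambda>\<omega>. f (psum (I - near i) \<omega>)) \<in> borel_measurable N"
      if "\<And>k. k \<in> I - near i \<Longrightarrow> X k \<in> borel_measurable N" for N
      using psum_measurable[OF that] f by (rule measurable_compose)
  qed (use i b \<delta> \<xi>_measurable \<xi>_centered in \<open>auto simp: near_def one_enat_def\<close>)
  then show ?thesis by (simp add: exponents mult.assoc)
qed

text \<open>Removing both neighbourhoods separates the block {i, j} from the sum. Subtracting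
  \<sigma> i j centres the product at the price of a factor 4, whence 8 * 4 = 32; i = j is possible,
  so the block has at most two elements.\<close>

lemma stein_term_pair:
  fixes f :: "real \<Rightarrow> real"
  assumes i: "i \<in> I" and j: "j \<in> I" and f[measurable]: "f \<in> borel_measurable borel" and b: "\<And>x. \<bar>f x\<bar> \<le> c"
  shows "\<bar>\<integral>\<omega>. (\<xi> i \<omega> * \<xi> j \<omega> - \<sigma> i j) * f (psum (I - (near i \<union> near j)) \<omega>) \<partial>M\<bar>
    \<le> 32 * c * K2\<^sup>2 * b 2 \<infinity> powr (\<delta> / (2 + \<delta>))"
proof -
  have "\<bar>\<integral>\<omega>. (\<xi> i \<omega> * \<xi> j \<omega> - \<sigma> i j) * f (psum (I - (near i \<union> near j)) \<omega>) \<partial>M\<bar>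
      \<le> 8 * (c * (4 * K2\<^sup>2)) * b 2 \<infinity> powr (1 - 1 / (1 + \<delta> / 2))"
  proof (rule separated_covariance[where ?J1.0 = "{i, j}" and ?J2.0 = "I - (near i \<union> near j)"])
    show "Lp_bound M (1 + \<delta> / 2) (\<lambda>\<omega>. \<xi> i \<omega> * \<xi> j \<omega> - \<sigma> i j) (4 * K2\<^sup>2)"
      using \<delta> \<xi>_product_L[OF i j] by (intro Lp_bound_diff Lp_bound_const prob_space_axioms) auto
    show "(\<integral>\<omega>. \<xi> i \<omega> * \<xi> j \<omega> - \<sigma> i j \<partial>M) = 0"
      using \<xi>_product_L(3)[OF i j] by (simp add: \<sigma>_def prob_space)
    show "(\<lambda>\<omega>. \<xi> i \<omega> * \<xi> j \<omega> - \<sigma> i j) \<in> borel_measurable N"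
      if "\<And>k. k \<in> {i, j} \<Longrightarrow> X k \<in> borel_measurable N" for N
      using \<xi>_measurable[OF that[of i]] \<xi>_measurable[OF that[of j]] by simp
    show "(\<lambda>\<omega>. f (psum (I - (near i \<union> near j)) \<omega>)) \<in> borel_measurable N"
      if "\<And>k. k \<in> I - (near i \<union> near j) \<Longrightarrow> X k \<in> borel_measurable N" for N
      using psum_measurable[OF that] f by (rule measurable_compose)
    have "card {i, j} \<le> 2" by (simp add: card_insert_if)
    then show "enat (card {i, j}) \<le> 2" by (metis enat_ord_simps(1) numeral_eq_enat)
  qed (use i j b \<delta> in \<open>auto simp: near_def\<close>)
  then show ?thesis by (simp add: exponents mult.assoc mult.left_commute)
qed

text \<open>Squaring the sum over \<open>near i\<close> produces triples i, j, k with j and k near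
  i, each with an expected absolute product of at most \<open>3 * K3 ^ 3\<close>.\<close>

lemma stein_term_taylor:
  fixes e :: "'a \<Rightarrow> real"
  assumes i: "i \<in> I" and e[measurable]: "e \<in> borel_measurable M"
    and b: "\<And>\<omega>. \<bar>e \<omega>\<bar> \<le> c * (psum (near i) \<omega>)\<^sup>2" and c: "0 \<le> c"
  shows "integrable M (\<lambda>\<omega>. \<xi> i \<omega> * e \<omega>)"
    "\<bar>\<integral>\<omega>. \<xi> i \<omega> * e \<omega> \<partial>M\<bar> \<le> 3 * c * K3 ^ 3 * (real (card (near i)))\<^sup>2"
proof -
  have [measurable]: "\<xi> i \<in> borel_measurable M" using i X_meas \<xi>_measurable by blast
  let ?g = "\<lambda>\<omega>. c * (\<Sum>j\<in>near i. \<Sum>k\<in>near i. \<bar>\<xi> i \<omega>\<bar> * \<bar>\<xi> j \<omega>\<bar> * \<bar>\<xi> k \<omega>\<bar>)"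
  have le: "\<bar>\<xi> i \<omega> * e \<omega>\<bar> \<le> ?g \<omega>" for \<omega>
  proof -
    have "(psum (near i) \<omega>)\<^sup>2 \<le> (\<Sum>j\<in>near i. \<bar>\<xi> j \<omega>\<bar>)\<^sup>2"
      using abs_psum_le[of "near i" \<omega>] by (metis abs_ge_zero power2_abs power_mono)
    also have "\<dots> = (\<Sum>j\<in>near i. \<Sum>k\<in>near i. \<bar>\<xi> j \<omega>\<bar> * \<bar>\<xi> k \<omega>\<bar>)"
      by (simp add: power2_eq_square sum_product)
    finally have "\<bar>e \<omega>\<bar> \<le> c * (\<Sum>j\<in>near i. \<Sum>k\<in>near i. \<bar>\<xi> j \<omega>\<bar> * \<bar>\<xi> k \<omega>\<bar>)"
      using b[of \<omega>] c mult_left_mono order_trans by blast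
    then have "\<bar>\<xi> i \<omega>\<bar> * \<bar>e \<omega>\<bar> \<le> \<bar>\<xi> i \<omega>\<bar> * (c * (\<Sum>j\<in>near i. \<Sum>k\<in>near i. \<bar>\<xi> j \<omega>\<bar> * \<bar>\<xi> k \<omega>\<bar>))"
      by (rule mult_left_mono) simp
    then show ?thesis by (simp add: abs_mult sum_distrib_left mult.assoc mult.left_commute)
  qed
  have t: "integrable M (\<lambda>\<omega>. \<bar>\<xi> i \<omega>\<bar> * \<bar>\<xi> j \<omega>\<bar> * \<bar>\<xi> k \<omega>\<bar>)"
    "(\<integral>\<omega>. \<bar>\<xi> i \<omega>\<bar> * \<bar>\<xi> j \<omega>\<bar> * \<bar>\<xi> k \<omega>\<bar> \<partial>M) \<le> 3 * K3 ^ 3" if "j \<in> near i" "k \<in> near i" for j k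
    using that near_subset i by (auto intro!: triple_product_expectation \<xi>_L3)
  have gi: "integrable M ?g" using t(1) by (intro integrable_mult_right Bochner_Integration.integrable_sum) auto
  show i1: "integrable M (\<lambda>\<omega>. \<xi> i \<omega> * e \<omega>)"
    by (rule Bochner_Integration.integrable_bound[OF gi]) (auto intro!: AE_I2 order_trans[OF le])
  have "\<bar>\<integral>\<omega>. \<xi> i \<omega> * e \<omega> \<partial>M\<bar> \<le> (\<integral>\<omega>. ?g \<omega> \<partial>M)"
    using i1 gi le by (intro order_trans[OF integral_abs_bound] integral_mono) auto
  also have "\<dots> = c * (\<Sum>j\<in>near i. \<Sum>k\<in>near i. \<integral>\<omega>. \<bar>\<xi> i \<omega>\<bar> * \<bar>\<xi> j \<omega>\<bar> * \<bar>\<xi> k \<omega>\<bar> \<partial>M)"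
    using t(1) by (simp add: Bochner_Integration.integral_sum)
  also have "\<dots> \<le> c * (\<Sum>j\<in>near i. \<Sum>k\<in>near i. 3 * K3 ^ 3)"
    using t(2) c by (intro mult_left_mono sum_mono) auto
  finally show "\<bar>\<integral>\<omega>. \<xi> i \<omega> * e \<omega> \<partial>M\<bar> \<le> 3 * c * K3 ^ 3 * (real (card (near i)))\<^sup>2"
    by (simp add: power2_eq_square mult_ac)
qed

text \<open>Each k in J contributes a product of three variables and a product with the constant
  \<sigma> i j, both at most \<open>3 * K3 ^ 3\<close> in expectation, whence 6.\<close>

lemma stein_term_recentre:
  fixes e :: "'a \<Rightarrow> real"
  assumes i: "i \<in> I" and j: "j \<in> I" and J: "J \<subseteq> I" and e[measurable]: "e \<in> borel_measurable M"
    and b: "\<And>\<omega>. \<bar>e \<omega>\<bar> \<le> c * \<bar>psum J \<omega>\<bar>" and c: "0 \<le> c"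
  shows "integrable M (\<lambda>\<omega>. (\<xi> i \<omega> * \<xi> j \<omega> - \<sigma> i j) * e \<omega>)"
    "\<bar>\<integral>\<omega>. (\<xi> i \<omega> * \<xi> j \<omega> - \<sigma> i j) * e \<omega> \<partial>M\<bar> \<le> 6 * c * K3 ^ 3 * real (card J)"
proof -
  have [measurable]: "\<xi> i \<in> borel_measurable M" "\<xi> j \<in> borel_measurable M" using i j X_meas \<xi>_measurable by blast+
  let ?g = "\<lambda>\<omega>. c * (\<Sum>k\<in>J. \<bar>\<xi> k \<omega>\<bar> * \<bar>\<xi> i \<omega>\<bar> * \<bar>\<xi> j \<omega>\<bar> + \<bar>\<xi> k \<omega>\<bar> * \<bar>\<sigma> i j\<bar>)"
  have le: "\<bar>(\<xi> i \<omega> * \<xi> j \<omega> - \<sigma> i j) * e \<omega>\<bar> \<le> ?g \<omega>" for \<omega>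
  proof -
    have 1: "\<bar>e \<omega>\<bar> \<le> c * (\<Sum>k\<in>J. \<bar>\<xi> k \<omega>\<bar>)"
      using b[of \<omega>] c abs_psum_le mult_left_mono order_trans by blast
    have 2: "\<bar>\<xi> i \<omega> * \<xi> j \<omega> - \<sigma> i j\<bar> \<le> \<bar>\<xi> i \<omega>\<bar> * \<bar>\<xi> j \<omega>\<bar> + \<bar>\<sigma> i j\<bar>"
      by (metis abs_mult abs_triangle_ineq4)
    have "\<bar>\<xi> i \<omega> * \<xi> j \<omega> - \<sigma> i j\<bar> * \<bar>e \<omega>\<bar>
        \<le> (\<bar>\<xi> i \<omega>\<bar> * \<bar>\<xi> j \<omega>\<bar> + \<bar>\<sigma> i j\<bar>) * (c * (\<Sum>k\<in>J. \<bar>\<xi> k \<omega>\<bar>))"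
      using 1 2 by (intro mult_mono) auto
    also have "\<dots> = ?g \<omega>"
      by (simp add: sum_distrib_left sum_distrib_right sum.distrib algebra_simps)
    finally show ?thesis by (simp add: abs_mult)
  qed
  have t: "integrable M (\<lambda>\<omega>. \<bar>\<xi> k \<omega>\<bar> * \<bar>\<xi> i \<omega>\<bar> * \<bar>\<xi> j \<omega>\<bar>)" "integrable M (\<lambda>\<omega>. \<bar>\<xi> k \<omega>\<bar> * \<bar>\<sigma> i j\<bar>)"
    "(\<integral>\<omega>. \<bar>\<xi> k \<omega>\<bar> * \<bar>\<xi> i \<omega>\<bar> * \<bar>\<xi> j \<omega>\<bar> \<partial>M) + (\<integral>\<omega>. \<bar>\<xi> k \<omega>\<bar> * \<bar>\<sigma> i j\<bar> \<partial>M) \<le> 6 * K3 ^ 3"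
    if "k \<in> J" for k
  proof -
    have k: "k \<in> I" using that J by auto
    show "integrable M (\<lambda>\<omega>. \<bar>\<xi> k \<omega>\<bar> * \<bar>\<xi> i \<omega>\<bar> * \<bar>\<xi> j \<omega>\<bar>)" "integrable M (\<lambda>\<omega>. \<bar>\<xi> k \<omega>\<bar> * \<bar>\<sigma> i j\<bar>)"
      using \<xi>_integrable[OF k] by (auto intro!: triple_product_expectation \<xi>_L3 i j k)
    show "(\<integral>\<omega>. \<bar>\<xi> k \<omega>\<bar> * \<bar>\<xi> i \<omega>\<bar> * \<bar>\<xi> j \<omega>\<bar> \<partial>M) + (\<integral>\<omega>. \<bar>\<xi> k \<omega>\<bar> * \<bar>\<sigma> i j\<bar> \<partial>M) \<le> 6 * K3 ^ 3"
      using triple_product_expectation(2)[OF \<xi>_L3[OF k] \<xi>_L3[OF i] \<xi>_L3[OF j]]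
        triple_product_decoupled[OF prob_space_axioms \<xi>_L3[OF k] \<xi>_L3[OF i] \<xi>_L3[OF j]]
      by (simp add: \<sigma>_def)
  qed
  have gi: "integrable M ?g"
    using t by (intro integrable_mult_right Bochner_Integration.integrable_sum Bochner_Integration.integrable_add) auto
  show i1: "integrable M (\<lambda>\<omega>. (\<xi> i \<omega> * \<xi> j \<omega> - \<sigma> i j) * e \<omega>)"
    by (rule Bochner_Integration.integrable_bound[OF gi]) (auto intro!: AE_I2 order_trans[OF le])
  have "\<bar>\<integral>\<omega>. (\<xi> i \<omega> * \<xi> j \<omega> - \<sigma> i j) * e \<omega> \<partial>M\<bar> \<le> (\<integral>\<omega>. ?g \<omega> \<partial>M)"
    using i1 gi le by (intro order_trans[OF integral_abs_bound] integral_mono) auto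
  also have "\<dots> = c * (\<Sum>k\<in>J. (\<integral>\<omega>. \<bar>\<xi> k \<omega>\<bar> * \<bar>\<xi> i \<omega>\<bar> * \<bar>\<xi> j \<omega>\<bar> \<partial>M) + (\<integral>\<omega>. \<bar>\<xi> k \<omega>\<bar> * \<bar>\<sigma> i j\<bar> \<partial>M))"
    using t by (simp add: Bochner_Integration.integral_sum del: integral_mult_left_zero)
  also have "\<dots> \<le> c * (\<Sum>k\<in>J. 6 * K3 ^ 3)"
    using t(3) c by (intro mult_left_mono sum_mono) auto
  finally show "\<bar>\<integral>\<omega>. (\<xi> i \<omega> * \<xi> j \<omega> - \<sigma> i j) * e \<omega> \<partial>M\<bar> \<le> 6 * c * K3 ^ 3 * real (card J)"
    by (simp add: mult_ac)
qed

end

lemma borel_measurable_real_derivative: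
  fixes f f' :: "real \<Rightarrow> real"
  assumes "\<And>x. (f has_real_derivative f' x) (at x)"
  shows "f \<in> borel_measurable borel"
  using DERIV_continuous_on[of UNIV f f'] assms has_field_derivative_at_within
  by (intro borel_measurable_continuous_onI) blast

context mixing_sum
begin

text \<open>Stein's identity is expanded around \<open>psum (I - near i)\<close> in \<open>T f(T)\<close>, and around
  \<open>psum (I - (near i \<union> near j))\<close> in the resulting coefficients of \<open>f'(T)\<close>.\<close>

lemma stein_bound:
  fixes f f' f'' :: "real \<Rightarrow> real"
  assumes f: "\<And>x. (f has_real_derivative f' x) (at x)" "\<And>x. (f' has_real_derivative f'' x) (at x)"
    and b0: "\<And>x. \<bar>f x\<bar> \<le> 12" and b1: "\<And>x. \<bar>f' x\<bar> \<le> 156" and b2: "\<And>x. \<bar>f'' x\<bar> \<le> 26"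
  shows "\<bar>\<integral>\<omega>. f' (psum I \<omega>) - psum I \<omega> * f (psum I \<omega>) \<partial>M\<bar> \<le> 5000 * (
      real (card I) * K1 * b 1 \<infinity> powr (\<delta> / (1 + \<delta>))
      + (real (card I))\<^sup>2 * K2\<^sup>2 * b 1 1 powr (\<delta> / (2 + \<delta>))
      + real (tau I d m [2]) * K2\<^sup>2 * b 2 \<infinity> powr (\<delta> / (2 + \<delta>))
      + real (tau I d m [3]) * K3 ^ 3)"
proof -
  have [measurable]: "f \<in> borel_measurable borel" "f' \<in> borel_measurable borel"
    using f by (auto intro: borel_measurable_real_derivative)
  have nI: "near i \<subseteq> I" "near i \<union> near j \<subseteq> I" for i j using near_subset by auto
  have sI: "I - J \<subseteq> I" for J by auto
  have pm[measurable]: "psum I \<in> borel_measurable M" "psum (I - J) \<in> borel_measurable M" for J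
    using sI by (intro psum_M; simp)+
  \<comment> \<open>\<open>A\<close> and \<open>B\<close> split \<xi> i f(T) at the sum outside
    \<open>near i\<close>, \<open>B\<close> being the second-order remainder. The first-order terms
    add up to f'(T) times the products over near pairs; \<open>D\<close> and \<open>E\<close> split
    these products minus their means at the sum outside both neighbourhoods, and \<open>s\<close> is
    the share of the variance not carried by near pairs.\<close>
  define A where "A = (\<lambda>i \<omega>. \<xi> i \<omega> * f (psum (I - near i) \<omega>))"
  define B where "B = (\<lambda>i \<omega>. \<xi> i \<omega> *
    (f (psum I \<omega>) - f (psum (I - near i) \<omega>) - f' (psum I \<omega>) * (psum I \<omega> - psum (I - near i) \<omega>)))"
  define D where "D = (\<lambda>i j \<omega>. (\<xi> i \<omega> * \<xi> j \<omega> - \<sigma> i j) * f' (psum (I - (near i \<union> near j)) \<omega>))"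
  define E where "E = (\<lambda>i j \<omega>. (\<xi> i \<omega> * \<xi> j \<omega> - \<sigma> i j) *
    (f' (psum I \<omega>) - f' (psum (I - (near i \<union> near j)) \<omega>)))"
  define s where "s = 1 - (\<Sum>i\<in>I. \<Sum>j\<in>near i. \<sigma> i j)"
  let ?b1 = "b 1 \<infinity> powr (\<delta> / (1 + \<delta>))" and ?b11 = "b 1 1 powr (\<delta> / (2 + \<delta>))"
    and ?b2 = "b 2 \<infinity> powr (\<delta> / (2 + \<delta>))"
  have eq: "f' (psum I \<omega>) - psum I \<omega> * f (psum I \<omega>) = s * f' (psum I \<omega>) - (\<Sum>i\<in>I. A i \<omega>) - (\<Sum>i\<in>I. B i \<omega>)
      - (\<Sum>i\<in>I. \<Sum>j\<in>near i. D i j \<omega>) - (\<Sum>i\<in>I. \<Sum>j\<in>near i. E i j \<omega>)" for \<omega>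
  proof -
    have "(\<Sum>i\<in>I. A i \<omega>) + (\<Sum>i\<in>I. B i \<omega>)
        = (\<Sum>i\<in>I. \<xi> i \<omega> * f (psum I \<omega>) - f' (psum I \<omega>) * (\<Sum>j\<in>near i. \<xi> i \<omega> * \<xi> j \<omega>))"
      unfolding A_def B_def psum_diff[OF nI(1)] sum.distrib[symmetric]
      by (intro sum.cong refl) (simp add: psum_def[of "near _"] algebra_simps sum_distrib_left)
    also have "\<dots> = psum I \<omega> * f (psum I \<omega>) - f' (psum I \<omega>) * (\<Sum>i\<in>I. \<Sum>j\<in>near i. \<xi> i \<omega> * \<xi> j \<omega>)"
      by (simp add: sum_subtractf sum_distrib_left sum_distrib_right psum_def)
    finally have 1: "(\<Sum>i\<in>I. A i \<omega>) + (\<Sum>i\<in>I. B i \<omega>)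
        = psum I \<omega> * f (psum I \<omega>) - f' (psum I \<omega>) * (\<Sum>i\<in>I. \<Sum>j\<in>near i. \<xi> i \<omega> * \<xi> j \<omega>)" .
    have "(\<Sum>i\<in>I. \<Sum>j\<in>near i. D i j \<omega>) + (\<Sum>i\<in>I. \<Sum>j\<in>near i. E i j \<omega>)
        = (\<Sum>i\<in>I. \<Sum>j\<in>near i. f' (psum I \<omega>) * (\<xi> i \<omega> * \<xi> j \<omega> - \<sigma> i j))"
      unfolding D_def E_def sum.distrib[symmetric] by (intro sum.cong refl) (simp add: algebra_simps)
    also have "\<dots> = f' (psum I \<omega>) * ((\<Sum>i\<in>I. \<Sum>j\<in>near i. \<xi> i \<omega> * \<xi> j \<omega>) - (\<Sum>i\<in>I. \<Sum>j\<in>near i. \<sigma> i j))"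
      by (simp add: sum_subtractf sum_distrib_left right_diff_distrib)
    finally have 2: "(\<Sum>i\<in>I. \<Sum>j\<in>near i. D i j \<omega>) + (\<Sum>i\<in>I. \<Sum>j\<in>near i. E i j \<omega>)
        = f' (psum I \<omega>) * ((\<Sum>i\<in>I. \<Sum>j\<in>near i. \<xi> i \<omega> * \<xi> j \<omega>) - (\<Sum>i\<in>I. \<Sum>j\<in>near i. \<sigma> i j))" .
    show ?thesis using 1 2 unfolding s_def by (simp add: algebra_simps)
  qed
  have K3: "0 \<le> K3 ^ 3" if "i \<in> I" for i using Lp_boundD(4)[OF \<xi>_L3[OF that]] by simp
  have Ai: "integrable M (A i)" if "i \<in> I" for i
    unfolding A_def using \<xi>_integrable[OF that] b0 by (intro integrable_mult_bounded) auto
  \<comment> \<open>The constants from here on are those of the single terms times the bounds on f,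
    f' and f'': 96 = 8 * 12, 78 = 3 * 26, 4992 = 32 * 156 and 156 = 6 * 26.\<close>
  have Ab: "\<bar>\<integral>\<omega>. A i \<omega> \<partial>M\<bar> \<le> 96 * K1 * ?b1" if "i \<in> I" for i
    using stein_term_isolated[where f = f and c = 12, OF that _ b0] unfolding A_def by simp
  have Bi: "integrable M (B i)" "\<bar>\<integral>\<omega>. B i \<omega> \<partial>M\<bar> \<le> 78 * K3 ^ 3 * (real (card (near i)))\<^sup>2" if "i \<in> I" for i
  proof -
    have le: "\<bar>f (psum I \<omega>) - f (psum (I - near i) \<omega>) - f' (psum I \<omega>) * (psum I \<omega> - psum (I - near i) \<omega>)\<bar>
        \<le> 26 * (psum (near i) \<omega>)\<^sup>2" for \<omega>
      using second_order_bound[OF f b2] unfolding psum_diff[OF nI(1), symmetric] .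
    show "integrable M (B i)" unfolding B_def
      by (rule stein_term_taylor(1)[OF that _ le]) auto
    show "\<bar>\<integral>\<omega>. B i \<omega> \<partial>M\<bar> \<le> 78 * K3 ^ 3 * (real (card (near i)))\<^sup>2"
      using stein_term_taylor(2)[OF that _ le] unfolding B_def by simp
  qed
  have Di: "integrable M (D i j)" "\<bar>\<integral>\<omega>. D i j \<omega> \<partial>M\<bar> \<le> 4992 * K2\<^sup>2 * ?b2" if "i \<in> I" "j \<in> near i" for i j
  proof -
    have j: "j \<in> I" using that nI by auto
    show "integrable M (D i j)" unfolding D_def
      using \<xi>_product_L(3)[OF that(1) j] b1 by (intro integrable_mult_bounded) auto
    show "\<bar>\<integral>\<omega>. D i j \<omega> \<partial>M\<bar> \<le> 4992 * K2\<^sup>2 * ?b2"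
      using stein_term_pair[where f = f' and c = 156, OF that(1) j _ b1] unfolding D_def by simp
  qed
  have Ei: "integrable M (E i j)" "\<bar>\<integral>\<omega>. E i j \<omega> \<partial>M\<bar> \<le> 156 * K3 ^ 3 * real (card (near i \<union> near j))"
    if "i \<in> I" "j \<in> near i" for i j
  proof -
    have j: "j \<in> I" using that nI by auto
    have le: "\<bar>f' (psum I \<omega>) - f' (psum (I - (near i \<union> near j)) \<omega>)\<bar> \<le> 26 * \<bar>psum (near i \<union> near j) \<omega>\<bar>" for \<omega>
      using derivative_bound_imp_lipschitz[OF f(2) b2] unfolding psum_diff[OF nI(2), symmetric] .
    show "integrable M (E i j)" unfolding E_def
      by (rule stein_term_recentre(1)[OF that(1) j nI(2)[of i j] _ le]) auto
    show "\<bar>\<integral>\<omega>. E i j \<omega> \<partial>M\<bar> \<le> 156 * K3 ^ 3 * real (card (near i \<union> near j))"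
      using stein_term_recentre(2)[OF that(1) j nI(2)[of i j] _ le] unfolding E_def by simp
  qed
  have SD: "integrable M (\<lambda>\<omega>. \<Sum>j\<in>near i. D i j \<omega>)"
      "\<bar>\<integral>\<omega>. (\<Sum>j\<in>near i. D i j \<omega>) \<partial>M\<bar> \<le> real (card (near i)) * (4992 * K2\<^sup>2 * ?b2)" if "i \<in> I" for i
    using integral_sum_bound[OF Di[OF that], of "near i"] by simp_all
  have SE: "integrable M (\<lambda>\<omega>. \<Sum>j\<in>near i. E i j \<omega>)"
      "\<bar>\<integral>\<omega>. (\<Sum>j\<in>near i. E i j \<omega>) \<partial>M\<bar> \<le> (\<Sum>j\<in>near i. 156 * K3 ^ 3 * real (card (near i \<union> near j)))" if "i \<in> I" for i
    using integral_sum_bound[OF Ei[OF that], of "near i"] by simp_all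
  have SA: "integrable M (\<lambda>\<omega>. \<Sum>i\<in>I. A i \<omega>)" "\<bar>\<integral>\<omega>. (\<Sum>i\<in>I. A i \<omega>) \<partial>M\<bar> \<le> (\<Sum>i\<in>I. 96 * K1 * ?b1)"
    by (rule integral_sum_bound, erule Ai, erule Ab)+
  have SB: "integrable M (\<lambda>\<omega>. \<Sum>i\<in>I. B i \<omega>)"
      "\<bar>\<integral>\<omega>. (\<Sum>i\<in>I. B i \<omega>) \<partial>M\<bar> \<le> (\<Sum>i\<in>I. 78 * K3 ^ 3 * (real (card (near i)))\<^sup>2)"
    by (rule integral_sum_bound, erule Bi, erule Bi)+
  have SSD: "integrable M (\<lambda>\<omega>. \<Sum>i\<in>I. \<Sum>j\<in>near i. D i j \<omega>)"
      "\<bar>\<integral>\<omega>. (\<Sum>i\<in>I. \<Sum>j\<in>near i. D i j \<omega>) \<partial>M\<bar> \<le> (\<Sum>i\<in>I. real (card (near i)) * (4992 * K2\<^sup>2 * ?b2))"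
    by (rule integral_sum_bound, erule SD, erule SD)+
  have SSE: "integrable M (\<lambda>\<omega>. \<Sum>i\<in>I. \<Sum>j\<in>near i. E i j \<omega>)"
      "\<bar>\<integral>\<omega>. (\<Sum>i\<in>I. \<Sum>j\<in>near i. E i j \<omega>) \<partial>M\<bar>
        \<le> (\<Sum>i\<in>I. \<Sum>j\<in>near i. 156 * K3 ^ 3 * real (card (near i \<union> near j)))"
    by (rule integral_sum_bound, erule SE, erule SE)+
  have f'i: "integrable M (\<lambda>\<omega>. f' (psum I \<omega>))"
    using b1 by (intro integrable_const_bound[of _ 156]) auto
  have f'b: "\<bar>\<integral>\<omega>. f' (psum I \<omega>) \<partial>M\<bar> \<le> 156"
    using f'i b1 order_trans[OF integral_abs_bound integral_mono[of M "\<lambda>\<omega>. \<bar>f' (psum I \<omega>)\<bar>" "\<lambda>_. 156"]]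
    by (simp add: prob_space)
  have "(\<integral>\<omega>. f' (psum I \<omega>) - psum I \<omega> * f (psum I \<omega>) \<partial>M)
      = s * (\<integral>\<omega>. f' (psum I \<omega>) \<partial>M) - (\<integral>\<omega>. (\<Sum>i\<in>I. A i \<omega>) \<partial>M) - (\<integral>\<omega>. (\<Sum>i\<in>I. B i \<omega>) \<partial>M)
        - (\<integral>\<omega>. (\<Sum>i\<in>I. \<Sum>j\<in>near i. D i j \<omega>) \<partial>M) - (\<integral>\<omega>. (\<Sum>i\<in>I. \<Sum>j\<in>near i. E i j \<omega>) \<partial>M)"
    unfolding eq using f'i SA(1) SB(1) SSD(1) SSE(1)
    by (simp add: Bochner_Integration.integral_diff Bochner_Integration.integrable_diff)
  then have tot: "\<bar>\<integral>\<omega>. f' (psum I \<omega>) - psum I \<omega> * f (psum I \<omega>) \<partial>M\<bar>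
      \<le> \<bar>s * (\<integral>\<omega>. f' (psum I \<omega>) \<partial>M)\<bar> + (\<Sum>i\<in>I. 96 * K1 * ?b1) + (\<Sum>i\<in>I. 78 * K3 ^ 3 * (real (card (near i)))\<^sup>2)
        + (\<Sum>i\<in>I. real (card (near i)) * (4992 * K2\<^sup>2 * ?b2))
        + (\<Sum>i\<in>I. \<Sum>j\<in>near i. 156 * K3 ^ 3 * real (card (near i \<union> near j)))"
    using SA(2) SB(2) SSD(2) SSE(2) by linarith
  have "\<bar>s\<bar> \<le> (real (card I))\<^sup>2 * (8 * K2\<^sup>2 * ?b11)"
  proof -
    \<comment> \<open>As the total variance is 1, \<open>s\<close> is the sum of the covariances of
      far pairs, each small by mixing.\<close>
    have "s = (\<Sum>i\<in>I. \<Sum>j\<in>I - near i. \<sigma> i j)"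
      unfolding s_def \<sigma>_total[symmetric] sum_subtractf[symmetric]
      using nI by (intro sum.cong refl) (simp add: sum_diff)
    also have "\<bar>\<dots>\<bar> \<le> (\<Sum>i\<in>I. \<Sum>j\<in>I - near i. 8 * K2\<^sup>2 * ?b11)"
      by (intro order_trans[OF sum_abs] sum_mono covariance_far) (auto simp: near_def)
    also have "\<dots> \<le> (\<Sum>i\<in>I. \<Sum>j\<in>I. 8 * K2\<^sup>2 * ?b11)"
      by (intro sum_mono sum_mono2) auto
    finally show ?thesis by (simp add: power2_eq_square)
  qed
  then have t1: "\<bar>s * (\<integral>\<omega>. f' (psum I \<omega>) \<partial>M)\<bar> \<le> ((real (card I))\<^sup>2 * (8 * K2\<^sup>2 * ?b11)) * 156"
    unfolding abs_mult using f'b by (intro mult_mono) auto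
  have t3: "(\<Sum>i\<in>I. real (card (near i)) * (4992 * K2\<^sup>2 * ?b2)) \<le> real (tau I d m [2]) * (4992 * K2\<^sup>2 * ?b2)"
    unfolding sum_distrib_right[symmetric] of_nat_sum[symmetric]
    using near_pairs_le_tau by (intro mult_right_mono) (auto simp del: of_nat_sum)
  \<comment> \<open>Nonnegativity of \<open>K3\<close> is available only through some index, hence
    the case distinction; without indices the count is 0.\<close>
  have K30: "(\<Sum>i\<in>I. \<Sum>j\<in>near i. c * K3 ^ 3 * real (card (near i \<union> near j))) \<le> c * K3 ^ 3 * real (tau I d m [3])"
    if c: "0 \<le> c" for c
  proof (cases "I = {}")
    case False
    then have k: "0 \<le> K3 ^ 3" using K3 by auto
    have "(\<Sum>i\<in>I. \<Sum>j\<in>near i. c * K3 ^ 3 * real (card (near i \<union> near j)))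
        = c * K3 ^ 3 * real (\<Sum>i\<in>I. \<Sum>j\<in>near i. card (near i \<union> near j))"
      by (simp add: sum_distrib_left)
    also have "\<dots> \<le> c * K3 ^ 3 * real (tau I d m [3])"
      using near_triples_le_tau k c by (intro mult_left_mono) (auto simp del: of_nat_sum)
    finally show ?thesis .
  next
    case True
    then have "tau I d m [3] = 0" by (auto simp: tau_def card_eq_0_iff)
    then show ?thesis using True by simp
  qed
  \<comment> \<open>One factor of the square becomes a sum over j, and \<open>near i\<close> is
    contained in \<open>near i \<union> near j\<close>, so connected triples count this term
    too.\<close>
  have "(\<Sum>i\<in>I. 78 * K3 ^ 3 * (real (card (near i)))\<^sup>2)
      = (\<Sum>i\<in>I. \<Sum>j\<in>near i. 78 * K3 ^ 3 * real (card (near i)))"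
    by (simp add: power2_eq_square mult_ac)
  also have "\<dots> \<le> (\<Sum>i\<in>I. \<Sum>j\<in>near i. 78 * K3 ^ 3 * real (card (near i \<union> near j)))"
    using K3 by (intro sum_mono mult_left_mono) (auto intro: card_mono)
  also have "\<dots> \<le> 78 * K3 ^ 3 * real (tau I d m [3])" by (rule K30) simp
  finally have t2: "(\<Sum>i\<in>I. 78 * K3 ^ 3 * (real (card (near i)))\<^sup>2) \<le> 78 * K3 ^ 3 * real (tau I d m [3])" .
  have t4: "(\<Sum>i\<in>I. \<Sum>j\<in>near i. 156 * K3 ^ 3 * real (card (near i \<union> near j))) \<le> 156 * K3 ^ 3 * real (tau I d m [3])"
    by (rule K30) simp
  have p1: "0 \<le> real (card I) * K1 * ?b1"
  proof (cases "I = {}")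
    case False
    then obtain i where "i \<in> I" by blast
    then have "0 \<le> K1" by (rule Lp_boundD(4)[OF \<xi>_L1])
    then show ?thesis by simp
  qed simp
  have p4: "0 \<le> real (tau I d m [3]) * K3 ^ 3"
  proof -
    have "0 \<le> (\<Sum>i\<in>I. \<Sum>j\<in>near i. 1 * K3 ^ 3 * real (card (near i \<union> near j)))"
      by (intro sum_nonneg mult_nonneg_nonneg K3) auto
    also have "\<dots> \<le> 1 * K3 ^ 3 * real (tau I d m [3])" by (rule K30) simp
    finally show ?thesis by (simp add: mult.commute)
  qed
  have p2: "0 \<le> (real (card I))\<^sup>2 * K2\<^sup>2 * ?b11" and p3: "0 \<le> real (tau I d m [2]) * K2\<^sup>2 * ?b2" by simp_all
  \<comment> \<open>Here 1248 = 8 * 156 and 234 = 78 + 156; the largest coefficient 4992 is rounded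
    up to 5000.\<close>
  have "\<bar>\<integral>\<omega>. f' (psum I \<omega>) - psum I \<omega> * f (psum I \<omega>) \<partial>M\<bar>
      \<le> 1248 * ((real (card I))\<^sup>2 * K2\<^sup>2 * ?b11) + 96 * (real (card I) * K1 * ?b1) + 234 * (real (tau I d m [3]) * K3 ^ 3)
        + 4992 * (real (tau I d m [2]) * K2\<^sup>2 * ?b2)"
    using tot t1 t2 t3 t4 by (simp add: mult_ac)
  also have "\<dots> \<le> 5000 * (real (card I) * K1 * ?b1 + (real (card I))\<^sup>2 * K2\<^sup>2 * ?b11
      + real (tau I d m [2]) * K2\<^sup>2 * ?b2 + real (tau I d m [3]) * K3 ^ 3)"
  proof -
    have "1248 * y + 96 * x + 234 * w + 4992 * z \<le> 5000 * (x + y + z + w)"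
      if "0 \<le> x" "0 \<le> y" "0 \<le> z" "0 \<le> w" for x y z w :: real
      using that by simp
    from this[OF p1 p2 p3 p4] show ?thesis .
  qed
  finally show "\<bar>\<integral>\<omega>. f' (psum I \<omega>) - psum I \<omega> * f (psum I \<omega>) \<partial>M\<bar> \<le> 5000 * (
      real (card I) * K1 * ?b1 + (real (card I))\<^sup>2 * K2\<^sup>2 * ?b11
      + real (tau I d m [2]) * K2\<^sup>2 * ?b2 + real (tau I d m [3]) * K3 ^ 3)" .
qed

end

text \<open>Stein's equation is solved for a differentiable test function within e / 2 of g. The
  smoothing error enters twice, under the law of the sum and under the normal law, and e is
  arbitrary.\<close>

lemma (in mixing_sum) wasserstein_bound:
  fixes g :: "real \<Rightarrow> real"
  assumes g: "1-lipschitz_on UNIV g"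
  shows "\<bar>(\<integral>\<omega>. g (psum I \<omega>) \<partial>M) - (\<integral>z. g z \<partial>std_gauss)\<bar> \<le> 5000 * (
      real (card I) * K1 * b 1 \<infinity> powr (\<delta> / (1 + \<delta>))
      + (real (card I))\<^sup>2 * K2\<^sup>2 * b 1 1 powr (\<delta> / (2 + \<delta>))
      + real (tau I d m [2]) * K2\<^sup>2 * b 2 \<infinity> powr (\<delta> / (2 + \<delta>))
      + real (tau I d m [3]) * K3 ^ 3)" (is "_ \<le> ?B")
proof (rule field_le_epsilon)
  fix e :: real assume "0 < e"
  then have e2: "0 < e / 2" by simp
  interpret N: prob_space std_gauss by (rule prob_space_normal_density) simp
  obtain k k' where k: "\<And>x. (k has_real_derivative k' x) (at x)" "\<And>x. \<bar>k' x\<bar> \<le> 1"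
      "\<And>x. \<bar>k x - g x\<bar> \<le> e / 2"
    using lipschitz_smoothing[OF g e2] by blast
  have klip: "1-lipschitz_on UNIV k"
  proof (rule lipschitz_onI)
    fix x y :: real
    show "dist (k x) (k y) \<le> 1 * dist x y"
      using derivative_bound_imp_lipschitz[OF k(1,2), of x y] by (simp add: dist_real_def)
  qed simp
  obtain f f' f'' where f: "\<And>x. (f has_real_derivative f' x) (at x)" "\<And>x. (f' has_real_derivative f'' x) (at x)"
      "\<And>x. \<bar>f x\<bar> \<le> 12" "\<And>x. \<bar>f' x\<bar> \<le> 156" "\<And>x. \<bar>f'' x\<bar> \<le> 26"
      "\<And>x. f' x - x * f x = k x - (\<integral>z. k z \<partial>std_gauss)"
    using stein_solution[OF k(1,2)] by blast
  have close: "\<bar>(\<integral>x. g (Y x) \<partial>Q) - (\<integral>x. k (Y x) \<partial>Q)\<bar> \<le> e / 2"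
    if Q: "prob_space Q" "integrable Q Y" for Q :: "'b measure" and Y
  proof -
    interpret Q: prob_space Q by fact
    have i: "integrable Q (\<lambda>x. g (Y x))" "integrable Q (\<lambda>x. k (Y x))"
      using lipschitz_integrable[OF g Q.finite_measure_axioms Q(2)]
        lipschitz_integrable[OF klip Q.finite_measure_axioms Q(2)] by auto
    then have "(\<integral>x. g (Y x) \<partial>Q) - (\<integral>x. k (Y x) \<partial>Q) = (\<integral>x. g (Y x) - k (Y x) \<partial>Q)" by simp
    also have "\<bar>\<dots>\<bar> \<le> (\<integral>x. e / 2 \<partial>Q)"
    proof (rule order_trans[OF integral_abs_bound], rule integral_mono)
      show "\<bar>g (Y x) - k (Y x)\<bar> \<le> e / 2" for x using k(3)[of "Y x"] by (simp add: abs_minus_commute)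
    qed (use i in auto)
    finally show ?thesis by (simp add: Q.prob_space)
  qed
  have ki: "integrable M (\<lambda>\<omega>. k (psum I \<omega>))"
    by (rule lipschitz_integrable[OF klip finite_measure_axioms psum_integrable]) simp
  have "\<bar>(\<integral>\<omega>. k (psum I \<omega>) \<partial>M) - (\<integral>z. k z \<partial>std_gauss)\<bar> = \<bar>\<integral>\<omega>. f' (psum I \<omega>) - psum I \<omega> * f (psum I \<omega>) \<partial>M\<bar>"
    unfolding f(6) using ki by (simp add: prob_space)
  also have "\<dots> \<le> ?B" by (rule stein_bound[OF f(1-5)])
  finally have "\<bar>(\<integral>\<omega>. k (psum I \<omega>) \<partial>M) - (\<integral>z. k z \<partial>std_gauss)\<bar> \<le> ?B" .
  moreover have "\<bar>(\<integral>\<omega>. g (psum I \<omega>) \<partial>M) - (\<integral>\<omega>. k (psum I \<omega>) \<partial>M)\<bar> \<le> e / 2"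
    by (rule close[OF prob_space_axioms psum_integrable]) simp
  moreover have "\<bar>(\<integral>z. g z \<partial>std_gauss) - (\<integral>z. k z \<partial>std_gauss)\<bar> \<le> e / 2"
    by (rule close[OF N.prob_space_axioms std_gauss_abs_moment(1)])
  ultimately show "\<bar>(\<integral>\<omega>. g (psum I \<omega>) \<partial>M) - (\<integral>z. g z \<partial>std_gauss)\<bar> \<le> ?B + e"
    by linarith
qed

subsection \<open>Hoeffding decomposition\<close>

locale ustat_array = mixing_array M I d X m b for M I d and X :: "'i \<Rightarrow> 'a \<Rightarrow> 'v::euclidean_space" and m b +
  fixes H :: "'v \<Rightarrow> 'v \<Rightarrow> real"
  assumes H_meas[measurable]: "(\<lambda>(x, y). H x y) \<in> borel_measurable (borel \<Otimes>\<^sub>M borel)"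
    and H_sym: "\<And>x y. H x y = H y x"
    and H_mom2: "Hmom_finite M I X H 2"
begin

abbreviation K :: "real \<Rightarrow> real" where "K \<equiv> Hnorm M I X H"
abbreviation Hh :: "'i \<Rightarrow> 'v \<Rightarrow> real" where "Hh \<equiv> Hhat M X H"
abbreviation \<theta> :: "'i \<Rightarrow> 'i \<Rightarrow> real" where "\<theta> \<equiv> theta M X H"

lemma H_measurable:
  assumes "u \<in> borel_measurable N" "v \<in> borel_measurable N"
  shows "(\<lambda>x. H (u x) (v x)) \<in> borel_measurable N"
  using measurable_compose[OF measurable_Pair[OF assms] H_meas] by simp

text \<open>Over a finite index set the supremum in \<open>Hnorm\<close> dominates every pair. The
  product of the marginal laws is an image of \<open>M \<Otimes>\<^sub>M M\<close>, so the decoupled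
  kernel lives on the space used by the mixing estimate.\<close>

lemma kernel_Lp:
  assumes p: "0 < p" and mom: "Hmom_finite M I X H p" and ij: "i \<in> I" "j \<in> I" "i \<noteq> j"
  shows "Lp_bound M p (\<lambda>\<omega>. H (X i \<omega>) (X j \<omega>)) (K p)"
    "Lp_bound (M \<Otimes>\<^sub>M M) p (\<lambda>(x, y). H (X i x) (X j y)) (K p)"
proof -
  have [measurable]: "X i \<in> M \<rightarrow>\<^sub>M borel" "X j \<in> M \<rightarrow>\<^sub>M borel" using X_meas ij by auto
  let ?S = "{(i, j). i \<in> I \<and> j \<in> I \<and> i \<noteq> j}"
  let ?g = "\<lambda>ij. max (Lp_norm M (\<lambda>\<omega>. H (X (fst ij) \<omega>) (X (snd ij) \<omega>)) p)
            (Lp_norm (law M (X (fst ij)) \<Otimes>\<^sub>M law M (X (snd ij))) (\<lambda>(x, y). H x y) p)"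
  have "finite ?S" by (rule finite_subset[of _ "I \<times> I"]) auto
  then have "?g (i, j) \<le> K p"
    unfolding Hnorm_def using ij by (intro cSUP_upper) (auto intro: bdd_above_finite)
  then have le: "Lp_norm M (\<lambda>\<omega>. H (X i \<omega>) (X j \<omega>)) p \<le> K p"
    "Lp_norm (law M (X i) \<Otimes>\<^sub>M law M (X j)) (\<lambda>(x, y). H x y) p \<le> K p" by auto
  have bound: "Lp_bound N p f (K p)"
    if "f \<in> borel_measurable N" "integrable N (\<lambda>x. \<bar>f x\<bar> powr p)" "Lp_norm N f p \<le> K p"
    for N :: "'x measure" and f
  proof -
    have n: "0 \<le> (\<integral>x. \<bar>f x\<bar> powr p \<partial>N)" by simp
    have "(\<integral>x. \<bar>f x\<bar> powr p \<partial>N) = Lp_norm N f p powr p"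
      unfolding Lp_norm_def using p n by (simp add: powr_powr)
    also have "\<dots> \<le> K p powr p"
      using that(3) p by (intro powr_mono2) (auto simp: Lp_norm_def)
    finally show ?thesis
      using that n order_trans[OF _ that(3), of 0] by (simp add: Lp_bound_def Lp_norm_def)
  qed
  show "Lp_bound M p (\<lambda>\<omega>. H (X i \<omega>) (X j \<omega>)) (K p)"
    using mom ij by (intro bound le H_measurable) (auto simp: Hmom_finite_def)
  have sf: "sigma_finite_measure (distr M borel (X j))"
    by (intro prob_space_imp_sigma_finite prob_space_distr) simp
  have eq: "law M (X i) \<Otimes>\<^sub>M law M (X j) = distr (M \<Otimes>\<^sub>M M) (borel \<Otimes>\<^sub>M borel) (\<lambda>(x, y). (X i x, X j y))"
    unfolding law_def by (rule pair_measure_distr[OF _ _ sf]) auto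
  have "Lp_bound (law M (X i) \<Otimes>\<^sub>M law M (X j)) p (\<lambda>(x, y). H x y) (K p)"
  proof (rule bound)
    show "(\<lambda>(x, y). H x y) \<in> borel_measurable (law M (X i) \<Otimes>\<^sub>M law M (X j))"
      unfolding eq by simp
    show "integrable (law M (X i) \<Otimes>\<^sub>M law M (X j)) (\<lambda>x. \<bar>case x of (x, y) \<Rightarrow> H x y\<bar> powr p)"
      using mom ij by (simp add: Hmom_finite_def case_prod_unfold)
  qed (rule le)
  then show "Lp_bound (M \<Otimes>\<^sub>M M) p (\<lambda>(x, y). H (X i x) (X j y)) (K p)"
    unfolding eq by (subst (asm) Lp_bound_distr) (auto simp: case_prod_unfold)
qed

lemma Hhat_measurable:
  assumes k: "k \<in> I"
  shows "Hh k \<in> borel_measurable borel"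
proof -
  have [measurable]: "X k \<in> M \<rightarrow>\<^sub>M borel" using X_meas k by auto
  show ?thesis
    unfolding Hhat_def[abs_def]
  proof (rule borel_measurable_lebesgue_integral)
    show "(\<lambda>(x, \<omega>). H (X k \<omega>) x) \<in> borel_measurable (borel \<Otimes>\<^sub>M M)"
      unfolding case_prod_unfold by (rule H_measurable) auto
  qed
qed

text \<open>Averaging one argument of the decoupled kernel does not increase the moment bound, and a
  further Jensen inequality passes it to the mean.\<close>

lemma Hhat_Lp:
  assumes p: "1 < p" and mom: "Hmom_finite M I X H p" and ij: "i \<in> I" "k \<in> I" "i \<noteq> k"
  shows "Lp_bound M p (\<lambda>\<omega>. Hh k (X i \<omega>)) (K p)" "\<bar>\<theta> i k\<bar> \<le> K p"
proof -
  show L: "Lp_bound M p (\<lambda>\<omega>. Hh k (X i \<omega>)) (K p)"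
    unfolding Hhat_def using p ij
    by (intro Lp_bound_partial_expectation[OF prob_space_axioms prob_space_axioms] kernel_Lp mom) auto
  show "\<bar>\<theta> i k\<bar> \<le> K p"
    unfolding theta_def by (rule Lp_bound_abs_expectation(2)[OF prob_space_axioms L p])
qed

lemma Hhat_integrable:
  assumes "i \<in> I" "k \<in> I" "i \<noteq> k"
  shows "integrable M (\<lambda>\<omega>. Hh k (X i \<omega>))"
  using Lp_bound_integrable[OF finite_measure_axioms Hhat_Lp(1)[OF _ H_mom2 assms]] by simp

text \<open>Fubini and the symmetry of the kernel. It makes the two projections of a pair add up to
  the same sum over ordered pairs.\<close>

lemma theta_sym:
  assumes "i \<in> I" "k \<in> I" "i \<noteq> k"
  shows "\<theta> i k = \<theta> k i"
proof -
  interpret PP: pair_prob_space M M ..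
  have int: "integrable (M \<Otimes>\<^sub>M M) (\<lambda>(x, y). H (X k x) (X i y))"
    using Lp_bound_integrable[OF PP.finite_measure_axioms kernel_Lp(2)[OF _ H_mom2, of k i]] assms by simp
  have "\<theta> i k = (\<integral>z. (case z of (x, y) \<Rightarrow> H (X k x) (X i y)) \<partial>(M \<Otimes>\<^sub>M M))"
    unfolding theta_def Hhat_def by (rule PP.integral_snd[OF int])
  also have "\<dots> = (\<integral>x. \<integral>y. H (X k x) (X i y) \<partial>M \<partial>M)"
    by (rule PP.integral_fst[OF int, symmetric])
  also have "\<dots> = \<theta> k i"
    unfolding theta_def Hhat_def by (subst H_sym) (rule refl)
  finally show ?thesis .
qed

text \<open>The canonical kernel of the Hoeffding decomposition, whose partial expectations vanish
  for i \<noteq> k. Bracketing it as a difference of two differences matches two uses of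
  \<open>Lp_bound_diff\<close>, whence the factor 4 * 4 = 16 in its moment bounds.\<close>

definition R :: "'i \<Rightarrow> 'i \<Rightarrow> 'v \<Rightarrow> 'v \<Rightarrow> real" where
  "R i k x y = (H x y - Hh k x) - (Hh i y - \<theta> i k)"

lemma R_swap: "i \<in> I \<Longrightarrow> k \<in> I \<Longrightarrow> i \<noteq> k \<Longrightarrow> R i k x y = R k i y x"
  unfolding R_def using theta_sym[of i k] H_sym[of x y] by simp

lemma R_measurable:
  assumes "i \<in> I" "k \<in> I" "u \<in> borel_measurable N" "v \<in> borel_measurable N"
  shows "(\<lambda>x. R i k (u x) (v x)) \<in> borel_measurable N"
  unfolding R_def
  using H_measurable[OF assms(3,4)] measurable_compose[OF assms(3) Hhat_measurable[OF assms(2)]]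
    measurable_compose[OF assms(4) Hhat_measurable[OF assms(1)]]
  by (intro borel_measurable_diff borel_measurable_const)

lemma R_Lp:
  assumes p: "1 < p" and mom: "Hmom_finite M I X H p" and ik: "i \<in> I" "k \<in> I" "i \<noteq> k"
  shows "Lp_bound M p (\<lambda>\<omega>. R i k (X i \<omega>) (X k \<omega>)) (16 * K p)"
    "Lp_bound (M \<Otimes>\<^sub>M M) p (\<lambda>z. R i k (X i (fst z)) (X k (snd z))) (16 * K p)"
proof -
  interpret PP: pair_prob_space M M ..
  note ki = ik(2,1) ik(3)[symmetric]
  have h: "Lp_bound M p (\<lambda>\<omega>. Hh k (X i \<omega>)) (K p)" "Lp_bound M p (\<lambda>\<omega>. Hh i (X k \<omega>)) (K p)"
    "\<bar>\<theta> i k\<bar> \<le> K p"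
    using Hhat_Lp[OF p mom ik] Hhat_Lp[OF p mom ki] by auto
  have "Lp_bound M p (\<lambda>\<omega>. R i k (X i \<omega>) (X k \<omega>)) (4 * (4 * K p))"
    unfolding R_def using p ik
    by (intro Lp_bound_diff kernel_Lp mom h Lp_bound_const prob_space_axioms) auto
  then show "Lp_bound M p (\<lambda>\<omega>. R i k (X i \<omega>) (X k \<omega>)) (16 * K p)" by simp
  have "Lp_bound (M \<Otimes>\<^sub>M M) p (\<lambda>z. R i k (X i (fst z)) (X k (snd z))) (4 * (4 * K p))"
    unfolding R_def
    using p ik kernel_Lp(2)[OF _ mom ik]
      Lp_bound_fst[OF prob_space_axioms prob_space_axioms h(1)]
      Lp_bound_snd[OF prob_space_axioms prob_space_axioms h(2)]
    by (intro Lp_bound_diff h Lp_bound_const PP.prob_space_axioms) (auto simp: case_prod_unfold)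
  then show "Lp_bound (M \<Otimes>\<^sub>M M) p (\<lambda>z. R i k (X i (fst z)) (X k (snd z))) (16 * K p)" by simp
qed

text \<open>This holds for every \<open>y\<close>: if \<open>H (X i) y\<close> is not integrable, then neither is the integrand,
  and its Bochner integral is 0 by convention.\<close>

lemma R_degenerate:
  assumes ik: "i \<in> I" "k \<in> I" "i \<noteq> k"
  shows "(\<integral>x. R i k (X i x) y \<partial>M) = 0"
proof -
  have hi: "integrable M (\<lambda>x. Hh k (X i x))" by (rule Hhat_integrable[OF ik])
  show ?thesis
  proof (cases "integrable M (\<lambda>x. H (X i x) y)")
    case True
    then show ?thesis using hi by (simp add: R_def prob_space Hhat_def[of _ _ _ i] theta_def)
  next
    case False
    have "\<not> integrable M (\<lambda>x. R i k (X i x) y)"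
    proof
      assume "integrable M (\<lambda>x. R i k (X i x) y)"
      then have "integrable M (\<lambda>x. R i k (X i x) y + Hh k (X i x) + (Hh i y - \<theta> i k))"
        using hi by auto
      then show False using False by (simp add: R_def)
    qed
    then show ?thesis by (rule not_integrable_integral_eq)
  qed
qed

definition q :: "'i \<Rightarrow> 'i \<Rightarrow> 'i \<Rightarrow> 'i \<Rightarrow> real" where
  "q i k j l = (\<integral>\<omega>. R i k (X i \<omega>) (X k \<omega>) * R j l (X j \<omega>) (X l \<omega>) \<partial>M)"

text \<open>The fallback for connected quadruples: second moments of the kernels make the product
  integrable, with 256 = 16 * 16.\<close>

lemma q_integrable_bound:
  assumes ik: "i \<in> I" "k \<in> I" "i \<noteq> k" and jl: "j \<in> I" "l \<in> I" "j \<noteq> l"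
  shows "integrable M (\<lambda>\<omega>. R i k (X i \<omega>) (X k \<omega>) * R j l (X j \<omega>) (X l \<omega>))"
    "\<bar>q i k j l\<bar> \<le> 256 * (K 2)\<^sup>2"
proof -
  have L: "Lp_bound M (2 / 2) (\<lambda>\<omega>. R i k (X i \<omega>) (X k \<omega>) * R j l (X j \<omega>) (X l \<omega>)) ((16 * K 2)\<^sup>2)"
    using ik jl by (intro Lp_bound_mult R_Lp H_mom2) auto
  show "integrable M (\<lambda>\<omega>. R i k (X i \<omega>) (X k \<omega>) * R j l (X j \<omega>) (X l \<omega>))"
    using Lp_bound_integrable[OF finite_measure_axioms L] by simp
  have "(\<integral>\<omega>. \<bar>R i k (X i \<omega>) (X k \<omega>) * R j l (X j \<omega>) (X l \<omega>)\<bar> \<partial>M) \<le> (16 * K 2)\<^sup>2"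
    using Lp_boundD(3)[OF L] by simp
  then show "\<bar>q i k j l\<bar> \<le> 256 * (K 2)\<^sup>2"
    unfolding q_def by (rule order_trans[OF integral_abs_bound, THEN order_trans]) (simp add: power_mult_distrib)
qed

text \<open>Only \<open>X i\<close> is read from the first coordinate. Integrating that coordinate
  out annihilates \<open>R i k\<close> for every value of the second, however k, j and l may
  coincide. The constant is 2048 = 8 * 16 * 16.\<close>

lemma q_first_isolated:
  assumes \<delta>: "0 < \<delta>" and mom: "Hmom_finite M I X H (2 + \<delta>)"
    and ik: "i \<in> I" "k \<in> I" "i \<noteq> k" and jl: "j \<in> I" "l \<in> I" "j \<noteq> l"
    and iso: "isolated d m i {k, j, l}"
  shows "\<bar>q i k j l\<bar> \<le> 2048 * (K (2 + \<delta>))\<^sup>2 * b 1 3 powr (\<delta> / (2 + \<delta>))"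
proof -
  interpret PP: pair_prob_space M M ..
  let ?f = "\<lambda>z. R i k (X i (fst z)) (X k (snd z)) * R j l (X j (snd z)) (X l (snd z))"
  have p: "1 < 2 + \<delta>" "1 < (2 + \<delta>) / 2" using \<delta> by auto
  have 1: "Lp_bound M ((2 + \<delta>) / 2) (\<lambda>\<omega>. ?f (\<omega>, \<omega>)) ((16 * K (2 + \<delta>))\<^sup>2)"
    using Lp_bound_mult[OF R_Lp(1)[OF p(1) mom ik] R_Lp(1)[OF p(1) mom jl]] by simp
  have 2: "Lp_bound (M \<Otimes>\<^sub>M M) ((2 + \<delta>) / 2) ?f ((16 * K (2 + \<delta>))\<^sup>2)"
    by (rule Lp_bound_mult[OF R_Lp(2)[OF p(1) mom ik]
          Lp_bound_snd[OF prob_space_axioms prob_space_axioms R_Lp(1)[OF p(1) mom jl]]])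
  have "integrable (M \<Otimes>\<^sub>M M) ?f"
    using Lp_bound_integrable[OF PP.finite_measure_axioms 2] p by simp
  then have int: "integrable (M \<Otimes>\<^sub>M M) (\<lambda>(x, y). R i k (X i x) (X k y) * R j l (X j y) (X l y))"
    by (simp add: case_prod_unfold)
  have z: "(\<integral>z. ?f z \<partial>(M \<Otimes>\<^sub>M M)) = 0"
    using PP.integral_snd[OF int] R_degenerate[OF ik] by (simp add: case_prod_unfold)
  have fm: "?f \<in> borel_measurable (N1 \<Otimes>\<^sub>M N2)"
    if "\<And>i'. i' \<in> {i} \<Longrightarrow> X i' \<in> borel_measurable N1" "\<And>i'. i' \<in> {k, j, l} \<Longrightarrow> X i' \<in> borel_measurable N2" for N1 N2
    using ik jl that
    by (intro borel_measurable_times R_measurable measurable_compose[OF measurable_fst] measurable_compose[OF measurable_snd]) auto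
  have "card {k, j, l} \<le> 3" by (simp add: card_insert_if)
  then have c3: "enat (card {k, j, l}) \<le> 3" by (metis enat_ord_simps(1) numeral_eq_enat)
  have "\<bar>\<integral>\<omega>. ?f (\<omega>, \<omega>) \<partial>M\<bar> \<le> 8 * (16 * K (2 + \<delta>))\<^sup>2 * b 1 3 powr (1 - 1 / ((2 + \<delta>) / 2))"
    by (rule mixing_covariance[where ?J1.0 = "{i}" and ?J2.0 = "{k, j, l}" and f = ?f, OF _ _ _ c3 _ p(2) fm 1 2 z])
      (use ik jl iso in \<open>auto simp: one_enat_def isolated_def\<close>)
  also have "1 - 1 / ((2 + \<delta>) / 2) = \<delta> / (2 + \<delta>)" using \<delta> by (simp add: field_simps)
  finally show ?thesis by (simp add: q_def power_mult_distrib)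
qed

text \<open>Swapping the arguments of a kernel, or the two factors, brings any isolated index to the
  front.\<close>

lemma q_isolated:
  assumes \<delta>: "0 < \<delta>" and mom: "Hmom_finite M I X H (2 + \<delta>)"
    and ik: "i \<in> I" "k \<in> I" "i \<noteq> k" and jl: "j \<in> I" "l \<in> I" "j \<noteq> l"
    and iso: "isolated d m i {k, j, l} \<or> isolated d m k {i, j, l} \<or>
      isolated d m j {i, k, l} \<or> isolated d m l {i, k, j}"
  shows "\<bar>q i k j l\<bar> \<le> 2048 * (K (2 + \<delta>))\<^sup>2 * b 1 3 powr (\<delta> / (2 + \<delta>))"
proof -
  note ki = ik(2,1) ik(3)[symmetric] and lj = jl(2,1) jl(3)[symmetric]
  have s1: "q i k j l = q k i j l" unfolding q_def using R_swap[OF ik] by simp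
  have s2: "q i k j l = q j l i k" unfolding q_def by (simp add: mult.commute)
  have s3: "q j l i k = q l j i k" unfolding q_def using R_swap[OF jl] by simp
  from iso show ?thesis
  proof (elim disjE)
    assume "isolated d m i {k, j, l}"
    then show ?thesis by (rule q_first_isolated[OF \<delta> mom ik jl])
  next
    assume "isolated d m k {i, j, l}"
    then show ?thesis unfolding s1 by (rule q_first_isolated[OF \<delta> mom ki jl])
  next
    assume "isolated d m j {i, k, l}"
    then have "isolated d m j {l, i, k}" by (simp add: insert_commute)
    then show ?thesis unfolding s2 by (rule q_first_isolated[OF \<delta> mom jl ik])
  next
    assume "isolated d m l {i, k, j}"
    then have "isolated d m l {j, i, k}" by (simp add: insert_commute)
    then show ?thesis unfolding s2 s3 by (rule q_first_isolated[OF \<delta> mom lj ik])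
  qed
qed

definition U :: "'a \<Rightarrow> real" where "U \<omega> = (\<Sum>i\<in>I. \<Sum>k\<in>I - {i}. R i k (X i \<omega>) (X k \<omega>))"

lemma U_second_moment:
  assumes \<delta>: "0 < \<delta>" and mom: "Hmom_finite M I X H (2 + \<delta>)"
  shows "integrable M (\<lambda>\<omega>. (U \<omega>)\<^sup>2)"
    "(\<integral>\<omega>. (U \<omega>)\<^sup>2 \<partial>M) \<le> 2048 * ((real (tau I d m [4]) + real (tau I d m [2, 2])) * (K 2)\<^sup>2
      + real (card I) ^ 4 * (K (2 + \<delta>))\<^sup>2 * b 1 3 powr (\<delta> / (2 + \<delta>)))"
proof -
  define S where "S = {(i, k, j, l). i \<in> I \<and> k \<in> I - {i} \<and> j \<in> I \<and> l \<in> I - {j}}"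
  define S' where "S' = {(i, k, j, l). i \<in> I \<and> k \<in> I \<and> j \<in> I \<and> l \<in> I \<and>
      \<not> isolated d m i {k, j, l} \<and> \<not> isolated d m k {i, j, l} \<and>
      \<not> isolated d m j {i, k, l} \<and> \<not> isolated d m l {i, k, j}}"
  let ?r = "\<lambda>(i, k, j, l) \<omega>. R i k (X i \<omega>) (X k \<omega>) * R j l (X j \<omega>) (X l \<omega>)"
  let ?B = "(K (2 + \<delta>))\<^sup>2 * b 1 3 powr (\<delta> / (2 + \<delta>))"
  have S_Sigma: "S = (SIGMA i:I. SIGMA k:I - {i}. SIGMA j:I. I - {j})" by (auto simp: S_def)
  have fS: "finite S" unfolding S_Sigma by (intro finite_SigmaI) auto
  have fS': "finite S'" by (rule finite_subset[of _ "I \<times> I \<times> I \<times> I"]) (auto simp: S'_def)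
  have U2: "(U \<omega>)\<^sup>2 = (\<Sum>s\<in>S. ?r s \<omega>)" for \<omega>
  proof -
    let ?a = "\<lambda>i k. R i k (X i \<omega>) (X k \<omega>)"
    have "(U \<omega>)\<^sup>2 = (\<Sum>i\<in>I. \<Sum>k\<in>I - {i}. ?a i k * (\<Sum>j\<in>I. \<Sum>l\<in>I - {j}. ?a j l))"
      unfolding U_def power2_eq_square sum_distrib_right ..
    also have "\<dots> = (\<Sum>i\<in>I. \<Sum>k\<in>I - {i}. \<Sum>j\<in>I. \<Sum>l\<in>I - {j}. ?a i k * ?a j l)"
      unfolding sum_distrib_left ..
    also have "\<dots> = (\<Sum>(i, k, j, l)\<in>S. ?a i k * ?a j l)"
      unfolding S_Sigma by (simp add: sum.Sigma)
    also have "\<dots> = (\<Sum>s\<in>S. ?r s \<omega>)" by (simp add: case_prod_unfold)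
    finally show ?thesis .
  qed
  have ri: "integrable M (?r s)" if "s \<in> S" for s
    using that q_integrable_bound(1) by (auto simp: S_def)
  show "integrable M (\<lambda>\<omega>. (U \<omega>)\<^sup>2)"
    unfolding U2 using ri by (rule Bochner_Integration.integrable_sum)
  have "(\<integral>\<omega>. (U \<omega>)\<^sup>2 \<partial>M) = (\<Sum>s\<in>S. \<integral>\<omega>. ?r s \<omega> \<partial>M)"
    unfolding U2 using ri by (rule Bochner_Integration.integral_sum)
  \<comment> \<open>The mixing term is granted to every tuple, so it is simply multiplied by the
    number of tuples, at most n^4, and the tuples in \<open>S'\<close> add their own
    contribution.\<close>
  also have "\<dots> \<le> (\<Sum>s\<in>S. (if s \<in> S' then 256 * (K 2)\<^sup>2 else 0) + 2048 * ?B)"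
  proof (rule sum_mono)
    fix s assume s: "s \<in> S"
    obtain i k j l where e: "s = (i, k, j, l)" by (cases s)
    have ik: "i \<in> I" "k \<in> I" "i \<noteq> k" and jl: "j \<in> I" "l \<in> I" "j \<noteq> l" using s by (auto simp: e S_def)
    have qe: "(\<integral>\<omega>. ?r s \<omega> \<partial>M) = q i k j l" by (simp add: e q_def)
    have B0: "0 \<le> ?B" by simp
    show "(\<integral>\<omega>. ?r s \<omega> \<partial>M) \<le> (if s \<in> S' then 256 * (K 2)\<^sup>2 else 0) + 2048 * ?B"
    proof (cases "s \<in> S'")
      case True
      have "q i k j l \<le> 256 * (K 2)\<^sup>2" using q_integrable_bound(2)[OF ik jl] by simp
      then have "q i k j l + 0 \<le> 256 * (K 2)\<^sup>2 + 2048 * ?B" using B0 by (intro add_mono) auto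
      then show ?thesis using True unfolding qe by simp
    next
      case False
      then have "\<bar>q i k j l\<bar> \<le> 2048 * (K (2 + \<delta>))\<^sup>2 * b 1 3 powr (\<delta> / (2 + \<delta>))"
        using ik jl by (intro q_isolated[OF \<delta> mom ik jl]) (auto simp: S'_def e)
      then show ?thesis using False unfolding qe by simp
    qed
  qed
  also have "\<dots> = real (card (S \<inter> S')) * (256 * (K 2)\<^sup>2) + real (card S) * (2048 * ?B)"
    using fS by (simp add: sum.distrib sum.If_cases)
  also have "\<dots> \<le> (real (tau I d m [4]) + real (tau I d m [2, 2])) * (256 * (K 2)\<^sup>2) + real (card I) ^ 4 * (2048 * ?B)"
  proof (intro add_mono mult_right_mono)
    have "card (S \<inter> S') \<le> card S'" by (intro card_mono fS') auto
    also have "\<dots> \<le> tau I d m [4] + tau I d m [2, 2]"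
      unfolding S'_def using d_sym by (intro card_quadruples_le_tau) auto
    finally show "real (card (S \<inter> S')) \<le> real (tau I d m [4]) + real (tau I d m [2, 2])"
      unfolding of_nat_add[symmetric] of_nat_le_iff .
    have "card S \<le> card (I \<times> I \<times> I \<times> I)" by (intro card_mono) (auto simp: S_def)
    then have "card S \<le> card I ^ 4" by (simp add: card_cartesian_product power4_eq_xxxx mult.assoc)
    then show "real (card S) \<le> real (card I) ^ 4" unfolding of_nat_power[symmetric] of_nat_le_iff .
  qed auto
  also have "\<dots> \<le> 2048 * ((real (tau I d m [4]) + real (tau I d m [2, 2])) * (K 2)\<^sup>2 + real (card I) ^ 4 * ?B)"
  proof -
    have "0 \<le> (real (tau I d m [4]) + real (tau I d m [2, 2])) * (K 2)\<^sup>2" by simp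
    then show ?thesis by (simp add: algebra_simps)
  qed
  finally show "(\<integral>\<omega>. (U \<omega>)\<^sup>2 \<partial>M) \<le> 2048 * ((real (tau I d m [4]) + real (tau I d m [2, 2])) * (K 2)\<^sup>2
      + real (card I) ^ 4 * (K (2 + \<delta>))\<^sup>2 * b 1 3 powr (\<delta> / (2 + \<delta>)))"
    by (simp add: mult.assoc)
qed

end

section \<open>From the linear part to the U-statistic\<close>

lemma nu_pos_imp_card:
  assumes "0 < nu M I X H" "finite I"
  shows "2 \<le> card I"
proof (rule ccontr)
  assume "\<not> 2 \<le> card I"
  then have "card I = 0 \<or> card I = 1" by linarith
  then have "I = {} \<or> (\<exists>i. I = {i})" using assms(2) by (auto simp: card_1_singleton_iff)
  then have "(\<Sum>i\<in>I. hproj M I X H i \<omega>) = 0" for \<omega> by (auto simp: hproj_def)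
  then show False using assms(1) by (simp add: nu_def)
qed

context ustat_array
begin

lemma sum_offdiag_swap:
  fixes f :: "'i \<Rightarrow> 'i \<Rightarrow> real"
  shows "(\<Sum>i\<in>I. \<Sum>k\<in>I - {i}. f i k) = (\<Sum>i\<in>I. \<Sum>k\<in>I - {i}. f k i)"
proof -
  have e: "I - {i} = {k \<in> I. k \<noteq> i}" "I - {i} = {k \<in> I. i \<noteq> k}" for i by auto
  show ?thesis
    unfolding e(1) by (subst sum.swap_restrict) (auto intro!: sum.cong)
qed

lemma U_Lp: "Lp_bound M 2 U (sqrt (\<integral>\<omega>. (U \<omega>)\<^sup>2 \<partial>M))" if "0 < \<delta>" "Hmom_finite M I X H (2 + \<delta>)"
proof -
  have "U \<in> borel_measurable M"
    unfolding U_def using X_meas by (intro borel_measurable_sum R_measurable) auto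
  moreover have "0 \<le> (\<integral>\<omega>. (U \<omega>)\<^sup>2 \<partial>M)" by simp
  ultimately show ?thesis
    using U_second_moment(1)[OF that] by (simp add: Lp_bound_def)
qed

text \<open>Each ordered pair carries two projections, and exchanging its indices shows that both
  sum to the same \<open>P\<close>. The linear part is therefore 2 (n - 1) times the sum of the
  \<open>hproj\<close>, which explains the divisor in \<open>Wstat\<close>.\<close>

lemma hoeffding_decomposition:
  assumes n: "2 \<le> card I" and nu: "0 < nu M I X H"
  shows "Wstat M I X H \<omega> = (1 / nu M I X H) * (\<Sum>i\<in>I. hproj M I X H i \<omega>)
    + U \<omega> / (2 * (real (card I) - 1) * nu M I X H)"
proof -
  let ?n1 = "real (card I) - 1" and ?X = "\<lambda>i. X i \<omega>"
  have n1: "0 < ?n1" using n by linarith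
  define P where "P = (\<Sum>i\<in>I. \<Sum>k\<in>I - {i}. Hh k (?X i) - \<theta> i k)"
  have P: "P = ?n1 * (\<Sum>i\<in>I. hproj M I X H i \<omega>)"
    unfolding P_def hproj_def sum_distrib_left[symmetric] using n1 by simp
  have "P = (\<Sum>i\<in>I. \<Sum>k\<in>I - {i}. Hh i (?X k) - \<theta> k i)"
    unfolding P_def by (rule sum_offdiag_swap)
  also have "\<dots> = (\<Sum>i\<in>I. \<Sum>k\<in>I - {i}. Hh i (?X k) - \<theta> i k)"
    using theta_sym by (intro sum.cong refl) auto
  finally have P': "P = (\<Sum>i\<in>I. \<Sum>k\<in>I - {i}. Hh i (?X k) - \<theta> i k)" .
  have "Ustat I X H \<omega> - (\<Sum>i\<in>I. \<Sum>k\<in>I - {i}. \<theta> i k)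
      = (\<Sum>i\<in>I. \<Sum>k\<in>I - {i}. R i k (?X i) (?X k) + ((Hh k (?X i) - \<theta> i k) + (Hh i (?X k) - \<theta> i k)))"
    unfolding Ustat_def sum_subtractf[symmetric] R_def by (intro sum.cong refl) simp
  also have "\<dots> = U \<omega> + (P + P)"
    unfolding sum.distrib U_def[symmetric] P_def[symmetric] P'[symmetric] ..
  finally have F: "Ustat I X H \<omega> - (\<Sum>i\<in>I. \<Sum>k\<in>I - {i}. \<theta> i k) = U \<omega> + (P + P)" .
  have "(u + (r * s + r * s)) / (2 * r * v) = (1 / v) * s + u / (2 * r * v)"
    if "0 < r" "0 < v" for u r s v :: real
    using that by (simp add: field_simps)
  from this[OF n1 nu] show ?thesis unfolding Wstat_def F P .
qed

text \<open>Replacing W by its linear part changes a Lipschitz expectation by at most E |U| / (2 (n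
  - 1) \<nu>), and E |U| is at most the root of the second moment. The linear part is an instance of
  \<open>mixing_sum\<close>.\<close>

lemma ustat_wasserstein_bound:
  assumes n: "2 \<le> card I" and nu: "0 < nu M I X H" and \<delta>: "0 < \<delta>"
    and mom: "Hmom_finite M I X H (1 + \<delta>)" "Hmom_finite M I X H (2 + \<delta>)" "Hmom_finite M I X H 3"
  shows "dW_normal M (Wstat M I X H) \<le> 320000 * (
      1 / (nu M I X H * real (card I)) *
        sqrt ((real (tau I d m [4]) + real (tau I d m [2, 2])) * (K 2)\<^sup>2
          + real (card I) ^ 4 * (K (2 + \<delta>))\<^sup>2 * b 1 3 powr (\<delta> / (2 + \<delta>)))
      + real (card I) / nu M I X H * K (1 + \<delta>) * b 1 \<infinity> powr (\<delta> / (1 + \<delta>))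
      + (real (card I))\<^sup>2 / (nu M I X H)\<^sup>2 * (K (2 + \<delta>))\<^sup>2 * b 1 1 powr (\<delta> / (2 + \<delta>))
      + real (tau I d m [2]) / (nu M I X H)\<^sup>2 * (K (2 + \<delta>))\<^sup>2 * b 2 \<infinity> powr (\<delta> / (2 + \<delta>))
      + real (tau I d m [3]) / (nu M I X H) ^ 3 * (K 3) ^ 3)"
    (is "_ \<le> 320000 * (?t0 * sqrt ?Y + ?t1 + ?t2 + ?t3 + ?t4)")
proof -
  define \<nu> where "\<nu> = nu M I X H"
  have \<nu>: "0 < \<nu>" using nu by (simp add: \<nu>_def)
  let ?n1 = "real (card I) - 1"
  have n1: "0 < ?n1" using n by linarith
  define \<phi> where "\<phi> = (\<lambda>i x. (1 / \<nu>) * ((1 / ?n1) * (\<Sum>k\<in>I - {i}. Hh k x - \<theta> i k)))"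
  have \<phi>_hproj: "\<phi> i (X i \<omega>) = (1 / \<nu>) * hproj M I X H i \<omega>" for i \<omega>
    by (simp add: \<phi>_def hproj_def)
  have cI: "real (card (I - {i})) = ?n1" if "i \<in> I" for i
    using that n by (simp add: of_nat_diff)
  have ne: "I - {i} \<noteq> {}" if "i \<in> I" for i
    using cI[OF that] n1 by (metis card.empty less_irrefl of_nat_0)
  \<comment> \<open>The factor 4 comes from centring each projection; averaging over k leaves it
    unchanged.\<close>
  have L: "Lp_bound M p (\<lambda>\<omega>. \<phi> i (X i \<omega>)) (4 * K p / \<nu>)"
    if p: "1 < p" and mom: "Hmom_finite M I X H p" and i: "i \<in> I" for p i
  proof -
    have "Lp_bound M p (\<lambda>\<omega>. (1 / real (card (I - {i}))) * (\<Sum>k\<in>I - {i}. Hh k (X i \<omega>) - \<theta> i k)) (4 * K p)"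
      using p i Hhat_Lp[OF p mom i] ne
      by (intro Lp_bound_average Lp_bound_diff Lp_bound_const prob_space_axioms) auto
    from Lp_bound_cmult[OF this, of "1 / \<nu>"] show ?thesis
      using p \<nu> cI[OF i] by (simp add: \<phi>_def)
  qed
  have hi: "integrable M (\<lambda>\<omega>. \<phi> i (X i \<omega>))" if "i \<in> I" for i
    using Lp_bound_integrable[OF finite_measure_axioms L[OF _ mom(3) that]] by simp
  have cent: "(\<integral>\<omega>. \<phi> i (X i \<omega>) \<partial>M) = 0" if "i \<in> I" for i
  proof -
    have "(\<integral>\<omega>. (\<Sum>k\<in>I - {i}. Hh k (X i \<omega>) - \<theta> i k) \<partial>M) = (\<Sum>k\<in>I - {i}. \<integral>\<omega>. Hh k (X i \<omega>) - \<theta> i k \<partial>M)"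
      using Hhat_integrable that by (intro Bochner_Integration.integral_sum) auto
    also have "\<dots> = 0"
    proof (intro sum.neutral ballI)
      fix k assume "k \<in> I - {i}"
      then have "integrable M (\<lambda>\<omega>. Hh k (X i \<omega>))" using that by (intro Hhat_integrable) auto
      then show "(\<integral>\<omega>. Hh k (X i \<omega>) - \<theta> i k \<partial>M) = 0" by (simp add: theta_def prob_space)
    qed
    finally show ?thesis by (simp add: \<phi>_def)
  qed
  have norm1: "(\<integral>\<omega>. (\<Sum>i\<in>I. \<phi> i (X i \<omega>))\<^sup>2 \<partial>M) = 1"
  proof -
    let ?T = "\<lambda>\<omega>. \<Sum>i\<in>I. hproj M I X H i \<omega>"
    have T: "?T \<omega> = \<nu> * (\<Sum>i\<in>I. \<phi> i (X i \<omega>))" for \<omega>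
      unfolding \<phi>_hproj sum_distrib_left[symmetric] using \<nu> by simp
    have e0: "expectation ?T = 0"
      unfolding T using hi cent by (simp add: Bochner_Integration.integral_sum)
    have "\<nu> = sqrt (expectation (\<lambda>\<omega>. (?T \<omega>)\<^sup>2))"
      using e0 by (simp add: \<nu>_def nu_def)
    moreover have "0 \<le> expectation (\<lambda>\<omega>. (?T \<omega>)\<^sup>2)" by simp
    ultimately have "\<nu>\<^sup>2 = expectation (\<lambda>\<omega>. (?T \<omega>)\<^sup>2)" by simp
    also have "\<dots> = \<nu>\<^sup>2 * (\<integral>\<omega>. (\<Sum>i\<in>I. \<phi> i (X i \<omega>))\<^sup>2 \<partial>M)"
      unfolding T by (simp add: power_mult_distrib)
    finally show ?thesis using \<nu> by simp
  qed
  have \<phi>m: "\<phi> i \<in> borel_measurable borel" for i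
    unfolding \<phi>_def using Hhat_measurable
    by (intro borel_measurable_times borel_measurable_const borel_measurable_sum borel_measurable_diff) auto
  interpret S: mixing_sum M I d X m b \<phi> \<delta> "4 * K (1 + \<delta>) / \<nu>" "4 * K (2 + \<delta>) / \<nu>" "4 * K 3 / \<nu>"
    by (unfold_locales) (use \<delta> L mom \<phi>m cent norm1 in auto)
  have W: "Wstat M I X H \<omega> = S.psum I \<omega> + U \<omega> / (2 * ?n1 * \<nu>)" for \<omega>
    unfolding hoeffding_decomposition[OF n nu] \<nu>_def[symmetric]
    by (simp add: S.psum_def S.\<xi>_def \<phi>_hproj sum_distrib_left)
  have Ui: "integrable M U"
    using Lp_bound_integrable[OF finite_measure_axioms U_Lp[OF \<delta> mom(2)]] by simp
  have Ti: "integrable M (S.psum I)" by (rule S.psum_integrable) simp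
  have Wi: "integrable M (Wstat M I X H)"
    unfolding W[abs_def] using Ui Ti by auto
  have Y0: "0 \<le> ?Y" by simp
  \<comment> \<open>The constant is chosen because 46 * 46 = 2116 exceeds 2048.\<close>
  have EU: "(\<integral>\<omega>. \<bar>U \<omega>\<bar> \<partial>M) \<le> 46 * sqrt ?Y"
  proof -
    have "(\<integral>\<omega>. \<bar>U \<omega>\<bar> \<partial>M)\<^sup>2 \<le> (\<integral>\<omega>. (U \<omega>)\<^sup>2 \<partial>M)"
      using Lp_bound_abs_expectation(1)[OF prob_space_axioms U_Lp[OF \<delta> mom(2)]] by simp
    also have "\<dots> \<le> 2048 * ?Y" by (rule U_second_moment(2)[OF \<delta> mom(2)])
    also have "\<dots> \<le> (46 * sqrt ?Y)\<^sup>2" using Y0 by (simp add: power_mult_distrib)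
    finally show ?thesis by (rule power2_le_imp_le) (use Y0 in simp)
  qed
  have K0: "0 \<le> K (1 + \<delta>)" "0 \<le> K 3"
  proof -
    have "I \<noteq> {}" using n by auto
    then obtain i where i: "i \<in> I" by blast
    show "0 \<le> K (1 + \<delta>)" using Lp_boundD(4)[OF S.L1[OF i]] \<nu> by (simp add: zero_le_divide_iff)
    show "0 \<le> K 3" using Lp_boundD(4)[OF S.L3[OF i]] \<nu> by (simp add: zero_le_divide_iff)
  qed
  have bound: "\<bar>(\<integral>\<omega>. g (Wstat M I X H \<omega>) \<partial>M) - (\<integral>z. g z \<partial>std_gauss)\<bar>
      \<le> 320000 * (?t0 * sqrt ?Y + ?t1 + ?t2 + ?t3 + ?t4)" if g: "1-lipschitz_on UNIV g" for g
  proof -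
    have gi: "integrable M (\<lambda>\<omega>. g (Wstat M I X H \<omega>))" "integrable M (\<lambda>\<omega>. g (S.psum I \<omega>))"
      using lipschitz_integrable[OF g finite_measure_axioms] Wi Ti by auto
    have "\<bar>(\<integral>\<omega>. g (Wstat M I X H \<omega>) \<partial>M) - (\<integral>\<omega>. g (S.psum I \<omega>) \<partial>M)\<bar>
        = \<bar>\<integral>\<omega>. g (Wstat M I X H \<omega>) - g (S.psum I \<omega>) \<partial>M\<bar>" using gi by simp
    also have "\<dots> \<le> (\<integral>\<omega>. ?t0 * \<bar>U \<omega>\<bar> \<partial>M)"
    proof (rule order_trans[OF integral_abs_bound], rule integral_mono)
      fix \<omega>
      have "\<bar>g (Wstat M I X H \<omega>) - g (S.psum I \<omega>)\<bar> \<le> \<bar>U \<omega> / (2 * ?n1 * \<nu>)\<bar>"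
        using lipschitz_onD[OF g, of "Wstat M I X H \<omega>" "S.psum I \<omega>"] by (simp add: dist_real_def W)
      also have "\<dots> = \<bar>U \<omega>\<bar> / (2 * ?n1 * \<nu>)" using n1 \<nu> by (simp add: abs_mult)
      \<comment> \<open>From n \<ge> 2 follows n \<le> 2 (n - 1), which brings the divisor to the
        form in the claim.\<close>
      also have "\<dots> \<le> \<bar>U \<omega>\<bar> / (\<nu> * real (card I))"
      proof (rule divide_left_mono)
        have "2 \<le> real (card I)" using n by simp
        then have "real (card I) \<le> 2 * ?n1" by (simp add: right_diff_distrib)
        then show "\<nu> * real (card I) \<le> 2 * ?n1 * \<nu>" using \<nu> by (simp add: mult.commute)
        show "0 < 2 * ?n1 * \<nu> * (\<nu> * real (card I))" using \<nu> n1 by simp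
      qed simp
      finally show "\<bar>g (Wstat M I X H \<omega>) - g (S.psum I \<omega>)\<bar> \<le> ?t0 * \<bar>U \<omega>\<bar>" by (simp add: \<nu>_def)
    qed (use gi Ui in auto)
    also have "\<dots> = ?t0 * (\<integral>\<omega>. \<bar>U \<omega>\<bar> \<partial>M)" by simp
    also have "\<dots> \<le> ?t0 * (46 * sqrt ?Y)"
      using EU nu by (intro mult_left_mono) auto
    finally have 1: "\<bar>(\<integral>\<omega>. g (Wstat M I X H \<omega>) \<partial>M) - (\<integral>\<omega>. g (S.psum I \<omega>) \<partial>M)\<bar> \<le> 46 * (?t0 * sqrt ?Y)"
      by simp
    \<comment> \<open>The moment constants are 4 K / \<nu>, so their first, second and third powers
      yield 4, 16 and 64; 5000 * 64 = 320000 covers all five terms.\<close>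
    have 2: "\<bar>(\<integral>\<omega>. g (S.psum I \<omega>) \<partial>M) - (\<integral>z. g z \<partial>std_gauss)\<bar> \<le> 5000 * (4 * ?t1 + 16 * ?t2 + 16 * ?t3 + 64 * ?t4)"
      using S.wasserstein_bound[OF g] unfolding \<nu>_def[symmetric]
      by (simp add: power_divide power_mult_distrib)
    have nn: "0 \<le> ?t0 * sqrt ?Y" "0 \<le> ?t1" "0 \<le> ?t2" "0 \<le> ?t3" "0 \<le> ?t4"
      using Y0 K0 nu by simp_all
    have "46 * x + 5000 * (4 * y + 16 * z + 16 * u + 64 * v) \<le> 320000 * (x + y + z + u + v)"
      if "0 \<le> x" "0 \<le> y" "0 \<le> z" "0 \<le> u" "0 \<le> v" for x y z u v :: real
      using that by simp
    from this[OF nn] show ?thesis using 1 2 by linarith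
  qed
  show ?thesis
    unfolding dW_normal_def
  proof (rule cSUP_least)
    have "1-lipschitz_on UNIV (\<lambda>x::real. x)" by (rule lipschitz_onI) auto
    then show "{g :: real \<Rightarrow> real. 1-lipschitz_on UNIV g} \<noteq> {}" by blast
  qed (use bound in simp)
qed

end

text \<open>All norms are real numbers: an infinite moment would turn \<open>Lp_norm\<close> into 0
  by the convention for Bochner integrals, and \<nu> = 0 would turn the quotients into 0. Finite
  moments and positive \<nu> are therefore premises. They stand inside the quantifiers, so that C is
  chosen before n and m.\<close>

theorem mainTheorem3:
  fixes M :: "'a measure"
    and I :: "nat \<Rightarrow> 'i set"
    and d :: "nat \<Rightarrow> 'i \<Rightarrow> 'i \<Rightarrow> ennreal"
    and X :: "nat \<Rightarrow> 'i \<Rightarrow> 'a \<Rightarrow> 'v::euclidean_space"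
    and H :: "nat \<Rightarrow> 'v \<Rightarrow> 'v \<Rightarrow> real"
    and \<beta> :: "enat \<Rightarrow> enat \<Rightarrow> real \<Rightarrow> real"
    and \<delta> :: real
  assumes prob: "prob_space M"
    and card_I: "\<And>n. finite (I n) \<and> card (I n) = n"
    and metric: "\<And>n i j k. i \<in> I n \<Longrightarrow> j \<in> I n \<Longrightarrow> k \<in> I n \<Longrightarrow>
                   d n i i = 0 \<and> d n i j = d n j i \<and> d n i k \<le> d n i j + d n j k \<and> (d n i j = 0 \<longrightarrow> i = j)"
    and meas_X: "\<And>n i. i \<in> I n \<Longrightarrow> X n i \<in> borel_measurable M"
    and A1: "\<And>n i j. i \<in> I n \<Longrightarrow> j \<in> I n \<Longrightarrow> i \<noteq> j \<Longrightarrow> d n i j \<ge> 1"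
    and A2: "\<And>n n1 n2 m J1 J2. (J1, J2) \<in> pairs_P (I n) (d n) n1 n2 m \<Longrightarrow>
               beta_mix M (gen_sigma M (X n) J1) (gen_sigma M (X n) J2) \<le> \<beta> n1 n2 m"
    and A3_meas: "\<And>n. (\<lambda>(x, y). H n x y) \<in> borel_measurable (borel \<Otimes>\<^sub>M borel)"
    and A3_sym: "\<And>n x y. H n x y = H n y x"
    and A3_mom: "\<And>n i j. i \<in> I n \<Longrightarrow> j \<in> I n \<Longrightarrow> i \<noteq> j \<Longrightarrow>
               integrable (law M (X n i) \<Otimes>\<^sub>M law M (X n j)) (\<lambda>(x, y). (H n x y)\<^sup>2)"
    and delta_pos: "\<delta> > 0"
  shows "\<exists>C. \<forall>n. \<forall>m::real. m \<ge> 1 \<longrightarrow> nu M (I n) (X n) (H n) > 0 \<longrightarrow>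
           (\<forall>p\<in>{2, 1 + \<delta>, 2 + \<delta>, 3}. Hmom_finite M (I n) (X n) (H n) p) \<longrightarrow>
           dW_normal M (Wstat M (I n) (X n) (H n))
             \<le> C * (
                 1 / (nu M (I n) (X n) (H n) * real n) *
                   sqrt ((real (tau (I n) (d n) m [4]) + real (tau (I n) (d n) m [2, 2]))
                            * (Hnorm M (I n) (X n) (H n) 2)\<^sup>2
                         + real n ^ 4 * (Hnorm M (I n) (X n) (H n) (2 + \<delta>))\<^sup>2
                            * \<beta> 1 3 m powr (\<delta> / (2 + \<delta>)))
               + real n / nu M (I n) (X n) (H n) * Hnorm M (I n) (X n) (H n) (1 + \<delta>)
                   * \<beta> 1 \<infinity> m powr (\<delta> / (1 + \<delta>))
               + (real n)\<^sup>2 / (nu M (I n) (X n) (H n))\<^sup>2 * (Hnorm M (I n) (X n) (H n) (2 + \<delta>))\<^sup>2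
                   * \<beta> 1 1 m powr (\<delta> / (2 + \<delta>))
               + real (tau (I n) (d n) m [2]) / (nu M (I n) (X n) (H n))\<^sup>2
                   * (Hnorm M (I n) (X n) (H n) (2 + \<delta>))\<^sup>2 * \<beta> 2 \<infinity> m powr (\<delta> / (2 + \<delta>))
               + real (tau (I n) (d n) m [3]) / (nu M (I n) (X n) (H n)) ^ 3
                   * (Hnorm M (I n) (X n) (H n) 3) ^ 3)"
proof (intro exI[of _ 320000] allI impI, goal_cases)
  case (1 n m)
  interpret prob_space M by (rule prob)
  interpret ustat_array M "I n" "d n" "X n" m "\<lambda>n1 n2. \<beta> n1 n2 m" "H n"
    by unfold_locales (use 1 card_I metric meas_X A2 A3_meas A3_sym in auto)
  have card: "card (I n) = n" using card_I by blast
  have "2 \<le> card (I n)" by (rule nu_pos_imp_card[OF 1(2) fin_I])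
  from ustat_wasserstein_bound[OF this 1(2) delta_pos] 1(3)
  show ?case unfolding card by simp
qed

end
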